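(* Let $\mathcal{C}$ be an additive finitely accessible category with products. Suppose further that $\mathcal{C}$ has an additive closed symmetric monoidal structure such that $\mathcal{C}^{\mathrm{fp}}$ is a monoidal subcategory. Let $\mathcal{D}$ be a definable subcategory of $\mathcal{C}$ and let $\mathsf{S} \subseteq \mathcal{C}^{\mathrm{fp}}\text{-}\mathrm{mod}$ be the corresponding Serre subcategory. Then $\mathsf{S}$ is a tensor-ideal of $\mathcal{C}^{\mathrm{fp}}\text{-}\mathrm{mod}$ if and only if $\mathcal{D}$ is fp-hom-closed.
   Context: All functors are additive. $\mathcal{C}$ is finitely accessible if it has direct limits and a set of finitely presented objects such that every object is a direct limit of objects in this set; $\mathcal{C}^{\mathrm{fp}}$ is the (skeletally small) full subcategory of finitely presented objects. $\mathcal{C}^{\mathrm{fp}}\text{-}\mathrm{Mod}$ is the category of additive functors $\mathcal{C}^{\mathrm{fp}}\to\mathbf{Ab}$ and $\mathcal{C}^{\mathrm{fp}}\text{-}\mathrm{mod}$ its full (abelian) subcategory of finitely presented functors. It carries the monoidal structure induced by Day convolution: the tensor product on $\mathcal{C}^{\mathrm{fp}}\text{-}\mathrm{Mod}$ which is colimit-preserving in each variable with $(A,-)\otimes(B,-)\cong(A\otimes B,-)$, restricted to $\mathcal{C}^{\mathrm{fp}}\text{-}\mathrm{mod}$. For $F\in\mathcal{C}^{\mathrm{fp}}\text{-}\mathrm{mod}$, $\overrightarrow{F}:\mathcal{C}\to\mathbf{Ab}$ is the unique extension of $F$ commuting with direct limits. A monomorphism $m:X\to Y$ in $\mathcal{C}$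 is pure if for every $f:A\to B$ in $\mathcal{C}^{\mathrm{fp}}$ and all $h:A\to X$, $h':B\to Y$ with $h'f=mh$ there is $k:B\to X$ with $kf=h$. A full subcategory $\mathcal{D}\subseteq\mathcal{C}$ is definable if closed under products, direct limits and pure subobjects. The Serre subcategory corresponding to $\mathcal{D}$ is $\mathsf{S}=\{F\in\mathcal{C}^{\mathrm{fp}}\text{-}\mathrm{mod}:\overrightarrow{F}(X)=0\ \forall X\in\mathcal{D}\}$; this gives a bijection between definable subcategories of $\mathcal{C}$ and Serre subcategories of $\mathcal{C}^{\mathrm{fp}}\text{-}\mathrm{mod}$, with inverse $\mathsf{S}\mapsto\{X:\overrightarrow{F}(X)=0\ \forall F\in\mathsf{S}\}$. $\mathsf{S}$ is a tensor-ideal if $G\otimes F\in\mathsf{S}$ for all $F\in\mathsf{S}$, $G\in\mathcal{C}^{\mathrm{fp}}\text{-}\mathrm{mod}$. $\mathcal{D}$ is fp-hom-closed if $\mathrm{hom}(A,X)\in\mathcal{D}$ for all $A\in\mathcal{C}^{\mathrm{fp}}$, $X\in\mathcal{D}$, where $\mathrm{hom}$ is the internal hom of $\mathcal{C}$. *)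

theory Defs
  imports "HOL-Algebra.Elementary_Groups" "HOL-Library.Equipollence"
begin

section \<open>The universe of small sets\<close>

text \<open>
  The distinction between sets and classes is made relative to a type \<open>'u\<close> whose
  cardinality is a strongly inaccessible cardinal, that is, a Grothendieck universe: classes
  are sets of elements of \<open>'u\<close>, and small sets are those of strictly smaller cardinality.
\<close>

definition small :: "'u set \<Rightarrow> bool" where
  "small A \<longleftrightarrow> A \<prec> (UNIV :: 'u set)"

definition universe :: "'u itself \<Rightarrow> bool" where
  "universe _ \<longleftrightarrow>
     (UNIV :: nat set) \<prec> (UNIV :: 'u set) \<and>
     (\<forall>A :: 'u set. small A \<longrightarrow> Pow A \<prec> (UNIV :: 'u set)) \<and>
     (\<forall>(I :: 'u set) (A :: 'u \<Rightarrow> 'u set). small I \<and> (\<forall>i\<in>I. small (A i)) \<longrightarrow> small (\<Union>i\<in>I. A i))"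


section \<open>Categories\<close>

record ('o, 'a) category =
  Obj :: "'o set"
  Arr :: "'a set"
  Dom :: "'a \<Rightarrow> 'o"
  Cod :: "'a \<Rightarrow> 'o"
  Ident :: "'o \<Rightarrow> 'a"
  Comp :: "'a \<Rightarrow> 'a \<Rightarrow> 'a"  (infixr \<open>\<cdot>\<index>\<close> 70)

definition Hom :: "('o, 'a, 'x) category_scheme \<Rightarrow> 'o \<Rightarrow> 'o \<Rightarrow> 'a set" where
  "Hom C A B = {f \<in> Arr C. Dom C f = A \<and> Cod C f = B}"

locale category =
  fixes C :: "('o, 'a, 'x) category_scheme" (structure)
  assumes Dom_in_Obj: "f \<in> Arr C \<Longrightarrow> Dom C f \<in> Obj C"
    and Cod_in_Obj: "f \<in> Arr C \<Longrightarrow> Cod C f \<in> Obj C"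
    and Ident_in_Hom: "A \<in> Obj C \<Longrightarrow> Ident C A \<in> Hom C A A"
    and Comp_in_Hom: "\<lbrakk>f \<in> Hom C X Y; g \<in> Hom C Y Z\<rbrakk> \<Longrightarrow> g \<cdot> f \<in> Hom C X Z"
    and Comp_Ident: "f \<in> Hom C X Y \<Longrightarrow> f \<cdot> Ident C X = f"
    and Ident_Comp: "f \<in> Hom C X Y \<Longrightarrow> Ident C Y \<cdot> f = f"
    and Comp_assoc: "\<lbrakk>f \<in> Hom C W X; g \<in> Hom C X Y; h \<in> Hom C Y Z\<rbrakk>
                       \<Longrightarrow> (h \<cdot> g) \<cdot> f = h \<cdot> (g \<cdot> f)"

record ('o, 'a) ab_category = "('o, 'a) category" +
  Add :: "'a \<Rightarrow> 'a \<Rightarrow> 'a"  (infixl \<open>\<^bold>+\<index>\<close> 65)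
  Zero :: "'o \<Rightarrow> 'o \<Rightarrow> 'a"

text \<open>Abelian groups are commutative groups of \<open>HOL-Algebra\<close>, hence written multiplicatively.\<close>

definition hom_group :: "('o, 'a, 'x) ab_category_scheme \<Rightarrow> 'o \<Rightarrow> 'o \<Rightarrow> 'a monoid" where
  "hom_group C A B = \<lparr>carrier = Hom C A B, mult = Add C, one = Zero C A B\<rparr>"

locale preadditive_category = category C
  for C :: "('o, 'a, 'x) ab_category_scheme" (structure) +
  assumes hom_comm_group: "\<lbrakk>A \<in> Obj C; B \<in> Obj C\<rbrakk> \<Longrightarrow> comm_group (hom_group C A B)"
    and Comp_Add: "\<lbrakk>f \<in> Hom C X Y; f' \<in> Hom C X Y; g \<in> Hom C Y Z\<rbrakk>
                     \<Longrightarrow> g \<cdot> (f \<^bold>+ f') = (g \<cdot> f) \<^bold>+ (g \<cdot> f')"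
    and Add_Comp: "\<lbrakk>f \<in> Hom C X Y; g \<in> Hom C Y Z; g' \<in> Hom C Y Z\<rbrakk>
                     \<Longrightarrow> (g \<^bold>+ g') \<cdot> f = (g \<cdot> f) \<^bold>+ (g' \<cdot> f)"

locale additive_category = preadditive_category C
  for C :: "('o, 'a, 'x) ab_category_scheme" (structure) +
  assumes zero_object: "\<exists>Z\<in>Obj C. Ident C Z = Zero C Z Z"
    and biproducts: "\<lbrakk>A \<in> Obj C; B \<in> Obj C\<rbrakk> \<Longrightarrow>
      \<exists>S\<in>Obj C. \<exists>i\<in>Hom C A S. \<exists>j\<in>Hom C B S. \<exists>p\<in>Hom C S A. \<exists>q\<in>Hom C S B.
        p \<cdot> i = Ident C A \<and> q \<cdot> j = Ident C B \<and>
        p \<cdot> j = Zero C B A \<and> q \<cdot> i = Zero C A B \<and>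
        (i \<cdot> p) \<^bold>+ (j \<cdot> q) = Ident C S"

definition locally_small :: "('o, 'u, 'x) category_scheme \<Rightarrow> bool" where
  "locally_small C \<longleftrightarrow> (\<forall>A\<in>Obj C. \<forall>B\<in>Obj C. small (Hom C A B))"

definition full_subcategory :: "('o, 'a, 'x) category_scheme \<Rightarrow> 'o set \<Rightarrow> ('o, 'a, 'x) category_scheme" where
  "full_subcategory C P =
     C\<lparr>Obj := P, Arr := {f \<in> Arr C. Dom C f \<in> P \<and> Cod C f \<in> P}\<rparr>"

definition iso_arrow :: "('o, 'a, 'x) category_scheme \<Rightarrow> 'o \<Rightarrow> 'o \<Rightarrow> 'a \<Rightarrow> bool" where
  "iso_arrow C A B f \<longleftrightarrow> f \<in> Hom C A B \<and>
     (\<exists>g\<in>Hom C B A. g \<cdot>\<^bsub>C\<^esub> f = Ident C A \<and> f \<cdot>\<^bsub>C\<^esub> g = Ident C B)"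

definition isomorphic :: "('o, 'a, 'x) category_scheme \<Rightarrow> 'o \<Rightarrow> 'o \<Rightarrow> bool" where
  "isomorphic C A B \<longleftrightarrow> (\<exists>f. iso_arrow C A B f)"

definition mono_arrow :: "('o, 'a, 'x) category_scheme \<Rightarrow> 'o \<Rightarrow> 'o \<Rightarrow> 'a \<Rightarrow> bool" where
  "mono_arrow C X Y m \<longleftrightarrow> m \<in> Hom C X Y \<and>
     (\<forall>W\<in>Obj C. \<forall>f\<in>Hom C W X. \<forall>g\<in>Hom C W X. m \<cdot>\<^bsub>C\<^esub> f = m \<cdot>\<^bsub>C\<^esub> g \<longrightarrow> f = g)"


section \<open>Functors and natural transformations\<close>

record ('o, 'a, 'p, 'b) func =
  FO :: "'o \<Rightarrow> 'p"
  FA :: "'a \<Rightarrow> 'b"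

definition is_functor ::
  "('o, 'a, 'x) category_scheme \<Rightarrow> ('p, 'b, 'y) category_scheme \<Rightarrow> ('o, 'a, 'p, 'b) func \<Rightarrow> bool" where
  "is_functor C D F \<longleftrightarrow>
     (\<forall>X\<in>Obj C. FO F X \<in> Obj D) \<and>
     (\<forall>X\<in>Obj C. \<forall>Y\<in>Obj C. \<forall>f\<in>Hom C X Y. FA F f \<in> Hom D (FO F X) (FO F Y)) \<and>
     (\<forall>X\<in>Obj C. FA F (Ident C X) = Ident D (FO F X)) \<and>
     (\<forall>X\<in>Obj C. \<forall>Y\<in>Obj C. \<forall>Z\<in>Obj C. \<forall>f\<in>Hom C X Y. \<forall>g\<in>Hom C Y Z.
        FA F (g \<cdot>\<^bsub>C\<^esub> f) = FA F g \<cdot>\<^bsub>D\<^esub> FA F f)"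

definition additive_functor ::
  "('o, 'a, 'x) ab_category_scheme \<Rightarrow> ('p, 'b, 'y) ab_category_scheme \<Rightarrow> ('o, 'a, 'p, 'b) func \<Rightarrow> bool" where
  "additive_functor C D F \<longleftrightarrow> is_functor C D F \<and>
     (\<forall>X\<in>Obj C. \<forall>Y\<in>Obj C. \<forall>f\<in>Hom C X Y. \<forall>g\<in>Hom C X Y.
        FA F (f \<^bold>+\<^bsub>C\<^esub> g) = FA F f \<^bold>+\<^bsub>D\<^esub> FA F g)"

definition comp_functor :: "('p, 'b, 'q, 'c) func \<Rightarrow> ('o, 'a, 'p, 'b) func \<Rightarrow> ('o, 'a, 'q, 'c) func" where
  "comp_functor G F = \<lparr>FO = FO G \<circ> FO F, FA = FA G \<circ> FA F\<rparr>"

definition nat_trans ::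
  "('o, 'a, 'x) category_scheme \<Rightarrow> ('p, 'b, 'y) category_scheme \<Rightarrow>
   ('o, 'a, 'p, 'b) func \<Rightarrow> ('o, 'a, 'p, 'b) func \<Rightarrow> ('o \<Rightarrow> 'b) \<Rightarrow> bool" where
  "nat_trans C D F G \<eta> \<longleftrightarrow>
     (\<forall>X\<in>Obj C. \<eta> X \<in> Hom D (FO F X) (FO G X)) \<and>
     (\<forall>X\<in>Obj C. \<forall>Y\<in>Obj C. \<forall>f\<in>Hom C X Y. \<eta> Y \<cdot>\<^bsub>D\<^esub> FA F f = FA G f \<cdot>\<^bsub>D\<^esub> \<eta> X)"

text \<open>Arrows carry their domain and codomain, so that Hom-sets are disjoint.\<close>

type_synonym ('o, 'a, 'p, 'b) transf =
  "('o, 'a, 'p, 'b) func \<times> ('o, 'a, 'p, 'b) func \<times> ('o \<Rightarrow> 'b)"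

definition components :: "('o, 'a, 'p, 'b) transf \<Rightarrow> 'o \<Rightarrow> 'b" where
  "components \<tau> = snd (snd \<tau>)"

definition additive_functor_category ::
  "('o, 'a, 'x) ab_category_scheme \<Rightarrow> ('p, 'b, 'y) ab_category_scheme \<Rightarrow>
   (('o, 'a, 'p, 'b) func, ('o, 'a, 'p, 'b) transf) ab_category" where
  "additive_functor_category C D =
     \<lparr>Obj = {F. additive_functor C D F},
      Arr = {(F, G, \<eta>). additive_functor C D F \<and> additive_functor C D G \<and>
                        nat_trans C D F G \<eta> \<and> \<eta> \<in> extensional (Obj C)},
      Dom = fst,
      Cod = fst \<circ> snd,
      Ident = (\<lambda>F. (F, F, \<lambda>X\<in>Obj C. Ident D (FO F X))),
      Comp = (\<lambda>(_, H, \<theta>) (F, _, \<eta>). (F, H, \<lambda>X\<in>Obj C. \<theta> X \<cdot>\<^bsub>D\<^esub> \<eta> X)),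
      Add = (\<lambda>(F, G, \<eta>) (_, _, \<eta>'). (F, G, \<lambda>X\<in>Obj C. \<eta> X \<^bold>+\<^bsub>D\<^esub> \<eta>' X)),
      Zero = (\<lambda>F G. (F, G, \<lambda>X\<in>Obj C. Zero D (FO F X) (FO G X)))\<rparr>"


section \<open>Limits and colimits\<close>

definition small_category :: "('u, 'u) category \<Rightarrow> bool" where
  "small_category J \<longleftrightarrow> category J \<and> small (Obj J) \<and> small (Arr J)"

definition is_cocone ::
  "('j, 'k, 'z) category_scheme \<Rightarrow> ('o, 'a, 'x) category_scheme \<Rightarrow>
   ('j, 'k, 'o, 'a) func \<Rightarrow> 'o \<Rightarrow> ('j \<Rightarrow> 'a) \<Rightarrow> bool" where
  "is_cocone J C G L c \<longleftrightarrow> is_functor J C G \<and> L \<in> Obj C \<and>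
     (\<forall>i\<in>Obj J. c i \<in> Hom C (FO G i) L) \<and>
     (\<forall>i\<in>Obj J. \<forall>j\<in>Obj J. \<forall>u\<in>Hom J i j. c j \<cdot>\<^bsub>C\<^esub> FA G u = c i)"

definition is_colimit ::
  "('j, 'k, 'z) category_scheme \<Rightarrow> ('o, 'a, 'x) category_scheme \<Rightarrow>
   ('j, 'k, 'o, 'a) func \<Rightarrow> 'o \<Rightarrow> ('j \<Rightarrow> 'a) \<Rightarrow> bool" where
  "is_colimit J C G L c \<longleftrightarrow> is_cocone J C G L c \<and>
     (\<forall>M d. is_cocone J C G M d \<longrightarrow>
        (\<exists>!h. h \<in> Hom C L M \<and> (\<forall>i\<in>Obj J. h \<cdot>\<^bsub>C\<^esub> c i = d i)))"

definition preserves_colimits_of_shape ::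
  "('j, 'k, 'z) category_scheme \<Rightarrow> ('o, 'a, 'x) category_scheme \<Rightarrow> ('p, 'b, 'y) category_scheme \<Rightarrow>
   ('o, 'a, 'p, 'b) func \<Rightarrow> bool" where
  "preserves_colimits_of_shape J C D F \<longleftrightarrow>
     (\<forall>G L c. is_colimit J C G L c \<longrightarrow>
        is_colimit J D (comp_functor F G) (FO F L) (\<lambda>i. FA F (c i)))"

text \<open>
  Direct limits are colimits over small directed sets, and a (pre)ordered set is a category
  with at most one arrow between any two objects.
\<close>

definition directed :: "('u, 'u) category \<Rightarrow> bool" where
  "directed J \<longleftrightarrow> small_category J \<and> Obj J \<noteq> {} \<and>
     (\<forall>i\<in>Obj J. \<forall>j\<in>Obj J. \<forall>u\<in>Hom J i j. \<forall>v\<in>Hom J i j. u = v) \<and>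
     (\<forall>i\<in>Obj J. \<forall>j\<in>Obj J. \<exists>k\<in>Obj J. Hom J i k \<noteq> {} \<and> Hom J j k \<noteq> {})"

definition has_direct_limits :: "('o, 'u, 'x) category_scheme \<Rightarrow> bool" where
  "has_direct_limits C \<longleftrightarrow>
     (\<forall>(J :: ('u, 'u) category) G. directed J \<and> is_functor J C G \<longrightarrow> (\<exists>L c. is_colimit J C G L c))"

definition is_product ::
  "('o, 'a, 'x) category_scheme \<Rightarrow> 'i set \<Rightarrow> ('i \<Rightarrow> 'o) \<Rightarrow> 'o \<Rightarrow> ('i \<Rightarrow> 'a) \<Rightarrow> bool" where
  "is_product C I X P p \<longleftrightarrow> P \<in> Obj C \<and> (\<forall>i\<in>I. X i \<in> Obj C \<and> p i \<in> Hom C P (X i)) \<and>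
     (\<forall>W\<in>Obj C. \<forall>q. (\<forall>i\<in>I. q i \<in> Hom C W (X i)) \<longrightarrow>
        (\<exists>!h. h \<in> Hom C W P \<and> (\<forall>i\<in>I. p i \<cdot>\<^bsub>C\<^esub> h = q i)))"

definition has_products :: "('o, 'u, 'x) category_scheme \<Rightarrow> bool" where
  "has_products C \<longleftrightarrow>
     (\<forall>(I :: 'u set) X. small I \<and> X ` I \<subseteq> Obj C \<longrightarrow> (\<exists>P p. is_product C I X P p))"


section \<open>The category of abelian groups\<close>

type_synonym 'u ab_hom = "'u monoid \<times> 'u monoid \<times> ('u \<Rightarrow> 'u)"

definition map_of_ab :: "'u ab_hom \<Rightarrow> 'u \<Rightarrow> 'u" where
  "map_of_ab f = snd (snd f)"

text \<open>Every small abelian group is isomorphic to one with carrier in \<open>'u\<close>.\<close>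

definition Ab :: "('u monoid, 'u ab_hom) ab_category" where
  "Ab =
     \<lparr>Obj = {G. comm_group G \<and> small (carrier G)},
      Arr = {(G, H, f). comm_group G \<and> small (carrier G) \<and> comm_group H \<and> small (carrier H) \<and>
                        f \<in> hom G H \<and> f \<in> extensional (carrier G)},
      Dom = fst,
      Cod = fst \<circ> snd,
      Ident = (\<lambda>G. (G, G, \<lambda>x\<in>carrier G. x)),
      Comp = (\<lambda>(_, K, g) (G, _, f). (G, K, \<lambda>x\<in>carrier G. g (f x))),
      Add = (\<lambda>(G, H, f) (_, _, f'). (G, H, \<lambda>x\<in>carrier G. f x \<otimes>\<^bsub>H\<^esub> f' x)),
      Zero = (\<lambda>G H. (G, H, \<lambda>x\<in>carrier G. \<one>\<^bsub>H\<^esub>))\<rparr>"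

type_synonym ('o, 'u) ab_func = "('o, 'u, 'u monoid, 'u ab_hom) func"
type_synonym ('o, 'u) ab_transf = "('o, 'u, 'u monoid, 'u ab_hom) transf"

text \<open>The representable functor \<open>(A,-)\<close>, and the transformation \<open>(f,-) : (B,-) \<rightarrow> (A,-)\<close> for \<open>f : A \<rightarrow> B\<close>.\<close>

definition rep :: "('o, 'u, 'x) ab_category_scheme \<Rightarrow> 'o \<Rightarrow> ('o, 'u) ab_func" where
  "rep C A =
     \<lparr>FO = (\<lambda>X. hom_group C A X),
      FA = (\<lambda>f. (hom_group C A (Dom C f), hom_group C A (Cod C f),
                  \<lambda>g\<in>Hom C A (Dom C f). f \<cdot>\<^bsub>C\<^esub> g))\<rparr>"

definition rep_arrow :: "('o, 'u, 'x) ab_category_scheme \<Rightarrow> 'u \<Rightarrow> ('o, 'u) ab_transf" where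
  "rep_arrow C f =
     (rep C (Cod C f), rep C (Dom C f),
      \<lambda>X\<in>Obj C. (hom_group C (Cod C f) X, hom_group C (Dom C f) X,
                   \<lambda>g\<in>Hom C (Cod C f) X. g \<cdot>\<^bsub>C\<^esub> f))"


section \<open>Finitely accessible categories\<close>

definition preserves_direct_limits :: "('o, 'u, 'x) ab_category_scheme \<Rightarrow> ('o, 'u) ab_func \<Rightarrow> bool" where
  "preserves_direct_limits C E \<longleftrightarrow>
     (\<forall>J :: ('u, 'u) category. directed J \<longrightarrow> preserves_colimits_of_shape J C Ab E)"

definition fp :: "('o, 'u, 'x) ab_category_scheme \<Rightarrow> 'o set" where
  "fp C = {A \<in> Obj C. preserves_direct_limits C (rep C A)}"

text \<open>
  A small set of objects is given as a family with a small index set, since \<open>small\<close> only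
  applies to subsets of \<open>'u\<close>.
\<close>

definition finitely_accessible :: "('o, 'u, 'x) ab_category_scheme \<Rightarrow> bool" where
  "finitely_accessible C \<longleftrightarrow> locally_small C \<and> has_direct_limits C \<and>
     (\<exists>(I :: 'u set) P. small I \<and> P ` I \<subseteq> fp C \<and>
        (\<forall>X\<in>Obj C. \<exists>(J :: ('u, 'u) category) G c.
            directed J \<and> FO G ` Obj J \<subseteq> P ` I \<and> is_colimit J C G X c))"

definition pure_mono :: "('o, 'u, 'x) ab_category_scheme \<Rightarrow> 'o \<Rightarrow> 'o \<Rightarrow> 'u \<Rightarrow> bool" where
  "pure_mono C X Y m \<longleftrightarrow> mono_arrow C X Y m \<and>
     (\<forall>A\<in>fp C. \<forall>B\<in>fp C. \<forall>f\<in>Hom C A B. \<forall>h\<in>Hom C A X. \<forall>h'\<in>Hom C B Y.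
        h' \<cdot>\<^bsub>C\<^esub> f = m \<cdot>\<^bsub>C\<^esub> h \<longrightarrow> (\<exists>k\<in>Hom C B X. k \<cdot>\<^bsub>C\<^esub> f = h))"

text \<open>A full subcategory is given by its set of objects.\<close>

definition definable :: "('o, 'u, 'x) ab_category_scheme \<Rightarrow> 'o set \<Rightarrow> bool" where
  "definable C D \<longleftrightarrow> D \<subseteq> Obj C \<and>
     (\<forall>(I :: 'u set) X P p. small I \<and> X ` I \<subseteq> D \<and> is_product C I X P p \<longrightarrow> P \<in> D) \<and>
     (\<forall>(J :: ('u, 'u) category) G L c.
        directed J \<and> FO G ` Obj J \<subseteq> D \<and> is_colimit J C G L c \<longrightarrow> L \<in> D) \<and>
     (\<forall>X\<in>Obj C. \<forall>Y\<in>D. \<forall>m. pure_mono C X Y m \<longrightarrow> X \<in> D)"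


section \<open>Functors on the finitely presented objects\<close>

abbreviation Cfp :: "('o, 'u, 'x) ab_category_scheme \<Rightarrow> ('o, 'u, 'x) ab_category_scheme" where
  "Cfp C \<equiv> full_subcategory C (fp C)"

text \<open>\<open>FpMod C\<close> and \<open>fp_mod C\<close> are the category \<open>C\<^sup>f\<^sup>p-Mod\<close> and the set of objects of \<open>C\<^sup>f\<^sup>p-mod\<close>.\<close>

definition FpMod :: "('o, 'u, 'x) ab_category_scheme \<Rightarrow> (('o, 'u) ab_func, ('o, 'u) ab_transf) ab_category" where
  "FpMod C = additive_functor_category (Cfp C) Ab"

text \<open>\<open>F\<close> is finitely presented if there is an exact sequence \<open>(B,-) \<rightarrow> (A,-) \<rightarrow> F \<rightarrow> 0\<close>.\<close>

definition fp_mod :: "('o, 'u, 'x) ab_category_scheme \<Rightarrow> ('o, 'u) ab_func set" where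
  "fp_mod C = {F \<in> Obj (FpMod C).
     \<exists>A\<in>fp C. \<exists>B\<in>fp C. \<exists>\<phi>\<in>Hom (FpMod C) (rep (Cfp C) B) (rep (Cfp C) A).
       \<exists>\<pi>\<in>Hom (FpMod C) (rep (Cfp C) A) F. \<forall>X\<in>fp C.
         map_of_ab (components \<pi> X) ` Hom C A X = carrier (FO F X) \<and>
         kernel (hom_group C A X) (FO F X) (map_of_ab (components \<pi> X))
           = map_of_ab (components \<phi> X) ` Hom C B X}"

text \<open>
  As usual, an extension of \<open>F\<close> restricts to \<open>F\<close> up to natural isomorphism; the restriction of
  \<open>E\<close> to \<open>C\<^sup>f\<^sup>p\<close> is \<open>E\<close> itself regarded as an object of \<open>FpMod C\<close>. Being unique up to isomorphism,
  the extension commuting with direct limits may be chosen arbitrarily.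
\<close>

definition direct_limit_extension ::
  "('o, 'u, 'x) ab_category_scheme \<Rightarrow> ('o, 'u) ab_func \<Rightarrow> ('o, 'u) ab_func \<Rightarrow> bool" where
  "direct_limit_extension C F E \<longleftrightarrow>
     additive_functor C Ab E \<and> preserves_direct_limits C E \<and> isomorphic (FpMod C) E F"

definition extend :: "('o, 'u, 'x) ab_category_scheme \<Rightarrow> ('o, 'u) ab_func \<Rightarrow> ('o, 'u) ab_func" where
  "extend C F = (SOME E. direct_limit_extension C F E)"

definition serre_of :: "('o, 'u, 'x) ab_category_scheme \<Rightarrow> 'o set \<Rightarrow> ('o, 'u) ab_func set" where
  "serre_of C D = {F \<in> fp_mod C. \<forall>X\<in>D. trivial_group (FO (extend C F) X)}"


section \<open>Monoidal structures\<close>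

record ('o, 'a) bifunctor =
  TO :: "'o \<Rightarrow> 'o \<Rightarrow> 'o"
  TA :: "'a \<Rightarrow> 'a \<Rightarrow> 'a"

definition additive_bifunctor ::
  "('o, 'a, 'x) ab_category_scheme \<Rightarrow> ('o, 'a, 'y) bifunctor_scheme \<Rightarrow> bool" where
  "additive_bifunctor C T \<longleftrightarrow>
     (\<forall>X\<in>Obj C. \<forall>Y\<in>Obj C. TO T X Y \<in> Obj C \<and>
        TA T (Ident C X) (Ident C Y) = Ident C (TO T X Y)) \<and>
     (\<forall>X\<in>Obj C. \<forall>X'\<in>Obj C. \<forall>Y\<in>Obj C. \<forall>Y'\<in>Obj C. \<forall>f\<in>Hom C X X'. \<forall>g\<in>Hom C Y Y'.
        TA T f g \<in> Hom C (TO T X Y) (TO T X' Y') \<and>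
        (\<forall>f'\<in>Hom C X X'. TA T (f \<^bold>+\<^bsub>C\<^esub> f') g = TA T f g \<^bold>+\<^bsub>C\<^esub> TA T f' g) \<and>
        (\<forall>g'\<in>Hom C Y Y'. TA T f (g \<^bold>+\<^bsub>C\<^esub> g') = TA T f g \<^bold>+\<^bsub>C\<^esub> TA T f g') \<and>
        (\<forall>X''\<in>Obj C. \<forall>Y''\<in>Obj C. \<forall>f'\<in>Hom C X' X''. \<forall>g'\<in>Hom C Y' Y''.
           TA T (f' \<cdot>\<^bsub>C\<^esub> f) (g' \<cdot>\<^bsub>C\<^esub> g) = TA T f' g' \<cdot>\<^bsub>C\<^esub> TA T f g))"

record ('o, 'a) monoidal = "('o, 'a) bifunctor" +
  Unit :: 'o
  assoc :: "'o \<Rightarrow> 'o \<Rightarrow> 'o \<Rightarrow> 'a"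
  lunit :: "'o \<Rightarrow> 'a"
  runit :: "'o \<Rightarrow> 'a"
  braid :: "'o \<Rightarrow> 'o \<Rightarrow> 'a"

locale symmetric_monoidal = preadditive_category C
  for C :: "('o, 'a, 'x) ab_category_scheme" (structure)
    and M :: "('o, 'a, 'y) monoidal_scheme" +
  fixes tensor_obj (infixr \<open>\<odot>\<close> 75) and tensor_arr (infixr \<open>\<star>\<close> 75)
  defines "tensor_obj \<equiv> TO M" and "tensor_arr \<equiv> TA M"
  assumes tensor_bifunctor: "additive_bifunctor C M"
    and Unit_in_Obj: "Unit M \<in> Obj C"
    and assoc_iso: "\<lbrakk>X \<in> Obj C; Y \<in> Obj C; Z \<in> Obj C\<rbrakk>
          \<Longrightarrow> iso_arrow C ((X \<odot> Y) \<odot> Z) (X \<odot> (Y \<odot> Z)) (assoc M X Y Z)"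
    and lunit_iso: "X \<in> Obj C \<Longrightarrow> iso_arrow C (Unit M \<odot> X) X (lunit M X)"
    and runit_iso: "X \<in> Obj C \<Longrightarrow> iso_arrow C (X \<odot> Unit M) X (runit M X)"
    and braid_iso: "\<lbrakk>X \<in> Obj C; Y \<in> Obj C\<rbrakk> \<Longrightarrow> iso_arrow C (X \<odot> Y) (Y \<odot> X) (braid M X Y)"
    and assoc_natural: "\<lbrakk>f \<in> Hom C X X'; g \<in> Hom C Y Y'; h \<in> Hom C Z Z'\<rbrakk>
          \<Longrightarrow> assoc M X' Y' Z' \<cdot> ((f \<star> g) \<star> h) = (f \<star> (g \<star> h)) \<cdot> assoc M X Y Z"
    and lunit_natural: "f \<in> Hom C X X' \<Longrightarrow> lunit M X' \<cdot> (Ident C (Unit M) \<star> f) = f \<cdot> lunit M X"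
    and runit_natural: "f \<in> Hom C X X' \<Longrightarrow> runit M X' \<cdot> (f \<star> Ident C (Unit M)) = f \<cdot> runit M X"
    and braid_natural: "\<lbrakk>f \<in> Hom C X X'; g \<in> Hom C Y Y'\<rbrakk>
          \<Longrightarrow> braid M X' Y' \<cdot> (f \<star> g) = (g \<star> f) \<cdot> braid M X Y"
    and pentagon: "\<lbrakk>W \<in> Obj C; X \<in> Obj C; Y \<in> Obj C; Z \<in> Obj C\<rbrakk>
          \<Longrightarrow> assoc M W X (Y \<odot> Z) \<cdot> assoc M (W \<odot> X) Y Z
            = (Ident C W \<star> assoc M X Y Z) \<cdot> assoc M W (X \<odot> Y) Z \<cdot> (assoc M W X Y \<star> Ident C Z)"
    and triangle: "\<lbrakk>X \<in> Obj C; Y \<in> Obj C\<rbrakk>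
          \<Longrightarrow> (Ident C X \<star> lunit M Y) \<cdot> assoc M X (Unit M) Y = runit M X \<star> Ident C Y"
    and hexagon: "\<lbrakk>X \<in> Obj C; Y \<in> Obj C; Z \<in> Obj C\<rbrakk>
          \<Longrightarrow> assoc M Y Z X \<cdot> braid M X (Y \<odot> Z) \<cdot> assoc M X Y Z
            = (Ident C Y \<star> braid M X Z) \<cdot> assoc M Y X Z \<cdot> (braid M X Y \<star> Ident C Z)"
    and symmetry: "\<lbrakk>X \<in> Obj C; Y \<in> Obj C\<rbrakk> \<Longrightarrow> braid M Y X \<cdot> braid M X Y = Ident C (X \<odot> Y)"

text \<open>
  \<open>ihom M Y Z\<close> with \<open>ev M Y Z : ihom M Y Z \<odot> Y \<rightarrow> Z\<close> is the internal hom: the value at \<open>Z\<close> of the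
  right adjoint of \<open>- \<odot> Y\<close>, together with the counit.
\<close>

record ('o, 'a) closed_monoidal = "('o, 'a) monoidal" +
  ihom :: "'o \<Rightarrow> 'o \<Rightarrow> 'o"
  ev :: "'o \<Rightarrow> 'o \<Rightarrow> 'a"

definition closed_symmetric_monoidal ::
  "('o, 'a, 'x) ab_category_scheme \<Rightarrow> ('o, 'a, 'y) closed_monoidal_scheme \<Rightarrow> bool" where
  "closed_symmetric_monoidal C M \<longleftrightarrow> symmetric_monoidal C M \<and>
     (\<forall>Y\<in>Obj C. \<forall>Z\<in>Obj C. ihom M Y Z \<in> Obj C \<and> ev M Y Z \<in> Hom C (TO M (ihom M Y Z) Y) Z \<and>
        (\<forall>X\<in>Obj C. \<forall>f\<in>Hom C (TO M X Y) Z.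
           \<exists>!g. g \<in> Hom C X (ihom M Y Z) \<and> ev M Y Z \<cdot>\<^bsub>C\<^esub> TA M g (Ident C Y) = f))"

definition full_monoidal_subcategory ::
  "('o, 'a, 'x) ab_category_scheme \<Rightarrow> ('o, 'a, 'y) monoidal_scheme \<Rightarrow> 'o set \<Rightarrow> bool" where
  "full_monoidal_subcategory C M P \<longleftrightarrow> P \<subseteq> Obj C \<and> Unit M \<in> P \<and> (\<forall>A\<in>P. \<forall>B\<in>P. TO M A B \<in> P)"

definition fp_hom_closed ::
  "('o, 'u, 'x) ab_category_scheme \<Rightarrow> ('o, 'u, 'y) closed_monoidal_scheme \<Rightarrow> 'o set \<Rightarrow> bool" where
  "fp_hom_closed C M D \<longleftrightarrow> (\<forall>A\<in>fp C. \<forall>X\<in>D. ihom M A X \<in> D)"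


section \<open>Day convolution\<close>

definition cocontinuous ::
  "('o, 'u, 'x) ab_category_scheme \<Rightarrow>
   (('o, 'u) ab_func, ('o, 'u) ab_transf, ('o, 'u) ab_func, ('o, 'u) ab_transf) func \<Rightarrow> bool" where
  "cocontinuous C \<Phi> \<longleftrightarrow>
     (\<forall>J :: ('u, 'u) category. small_category J \<longrightarrow> preserves_colimits_of_shape J (FpMod C) (FpMod C) \<Phi>)"

text \<open>
  The Day convolution product on \<open>FpMod C\<close> is characterised, up to natural isomorphism, as the
  additive bifunctor that preserves small colimits in each variable and satisfies
  \<open>(A,-) \<otimes> (B,-) \<cong> (A \<otimes> B,-)\<close> naturally in \<open>A\<close> and \<open>B\<close>.
\<close>

definition day_convolution ::
  "('o, 'u, 'x) ab_category_scheme \<Rightarrow> ('o, 'u, 'y) monoidal_scheme \<Rightarrow>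
   (('o, 'u) ab_func, ('o, 'u) ab_transf) bifunctor \<Rightarrow> bool" where
  "day_convolution C M T \<longleftrightarrow> additive_bifunctor (FpMod C) T \<and>
     (\<forall>F\<in>Obj (FpMod C).
        cocontinuous C \<lparr>FO = (\<lambda>G. TO T F G), FA = (\<lambda>\<tau>. TA T (Ident (FpMod C) F) \<tau>)\<rparr> \<and>
        cocontinuous C \<lparr>FO = (\<lambda>G. TO T G F), FA = (\<lambda>\<tau>. TA T \<tau> (Ident (FpMod C) F))\<rparr>) \<and>
     (\<exists>\<phi>.
        (\<forall>A\<in>fp C. \<forall>B\<in>fp C.
           iso_arrow (FpMod C) (TO T (rep (Cfp C) A) (rep (Cfp C) B)) (rep (Cfp C) (TO M A B)) (\<phi> A B)) \<and>
        (\<forall>A\<in>fp C. \<forall>A'\<in>fp C. \<forall>B\<in>fp C. \<forall>B'\<in>fp C. \<forall>f\<in>Hom C A A'. \<forall>g\<in>Hom C B B'.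
           \<phi> A B \<cdot>\<^bsub>FpMod C\<^esub> TA T (rep_arrow (Cfp C) f) (rep_arrow (Cfp C) g)
             = rep_arrow (Cfp C) (TA M f g) \<cdot>\<^bsub>FpMod C\<^esub> \<phi> A' B'))"

definition tensor_ideal ::
  "('o, 'u, 'x) ab_category_scheme \<Rightarrow> (('o, 'u) ab_func, ('o, 'u) ab_transf) bifunctor \<Rightarrow>
   ('o, 'u) ab_func set \<Rightarrow> bool" where
  "tensor_ideal C T S \<longleftrightarrow> (\<forall>F\<in>S. \<forall>G\<in>fp_mod C. TO T G F \<in> S)"

end

theory Submission
  imports Defs "HOL-Algebra.Product_Groups" "HOL-Algebra.Weak_Morphisms"
begin

text \<open>
  A finitely presented functor \<open>F\<close> is the cokernel of \<open>(f,-) : (B,-) \<rightarrow> (A,-)\<close> for an arrow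
  \<open>f : A \<rightarrow> B\<close> of finitely presented objects, and its extension vanishes at \<open>X\<close> if and only if every
  arrow \<open>A \<rightarrow> X\<close> extends along \<open>f\<close> (\<open>extension_trivial_iff\<close>). So membership of \<open>F\<close> in the Serre
  subcategory of \<open>\<D>\<close> means that all objects of \<open>\<D>\<close> are injective with respect to \<open>f\<close>
  (\<open>serre_of_iff\<close>), and the theorem becomes a statement about extending arrows along arrows.

  If \<open>G\<close> is presented by \<open>g : A' \<rightarrow> B'\<close>, then, because Day convolution is right exact in both variables
  and is the tensor product on representable functors, \<open>G \<otimes> F\<close> is the cokernel of
  \<open>(A' \<otimes> B,-) \<oplus> (B' \<otimes> A,-) \<rightarrow> (A' \<otimes> A,-)\<close>, where the maps are induced by \<open>A' \<otimes> f\<close> and \<open>g \<otimes> A\<close>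
  (\<open>tensor_presented\<close>). Hence its extension vanishes at \<open>X\<close> if and only if every arrow
  \<open>h : A' \<otimes> A \<rightarrow> X\<close> has the form \<open>k (A' \<otimes> f) + l (g \<otimes> A)\<close>. On the other hand, by adjunction,
  \<open>hom(A',X)\<close> is injective with respect to \<open>f\<close> if and only if \<open>X\<close> is injective with respect to
  \<open>A' \<otimes> f\<close> (\<open>extends_along_ihom_iff\<close>).

  Let \<open>\<D>\<close> be fp-hom-closed, \<open>F\<close> in the Serre subcategory and \<open>X\<close> in \<open>\<D>\<close>. Then \<open>hom(A',X)\<close> is injective with
  respect to \<open>f\<close>, so every \<open>h\<close> as above is of the required form with \<open>l = 0\<close>, and \<open>G \<otimes> F\<close> lies in
  the Serre subcategory. Conversely, let the Serre subcategory be a tensor-ideal. Taking \<open>g = 0\<close>, that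
  is \<open>G = (A',-)\<close>, shows that for \<open>X\<close> in \<open>\<D>\<close> the object \<open>hom(A',X)\<close> is injective with respect to every
  \<open>f\<close> with respect to which all objects of \<open>\<D>\<close> are injective. A definable subcategory contains every
  object \<open>Y\<close> with this property (\<open>definable_contains\<close>), so \<open>hom(A',X)\<close> lies in \<open>\<D>\<close>.

  The last fact is half of the bijection between definable and Serre subcategories. Its proof
  embeds \<open>Y\<close> purely into a direct limit of products of objects of \<open>\<D>\<close>: if \<open>Y\<close> is the direct limit of
  finitely presented objects \<open>G\<^sub>i\<close>, then for every arrow \<open>u\<close> out of \<open>G\<^sub>i\<close> along which \<open>G\<^sub>i \<rightarrow> Y\<close> does not
  extend some arrow from \<open>G\<^sub>i\<close> to an object of \<open>\<D>\<close> does not extend either, and a product over all \<open>u\<close>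
  detects them simultaneously.

  Direct limits of abelian groups are handled through their elements
  (\<open>directed_colimit_exhausted\<close>, \<open>directed_colimit_dies_early\<close>, \<open>directed_colimit_AbI\<close>), and cokernels
  of functors through pointwise exactness (\<open>coequalizer_exact\<close>, \<open>exact_coequalizer\<close>).
\<close>


section \<open>Small sets\<close>

lemma small_subset: "small B \<Longrightarrow> A \<subseteq> B \<Longrightarrow> small A"
  unfolding small_def by (meson lesspoll_trans1 subset_imp_lepoll)

lemma small_image:
  fixes f :: "'u \<Rightarrow> 'u"
  shows "small A \<Longrightarrow> small (f ` A)"
  unfolding small_def by (meson lesspoll_trans1 image_lepoll)

lemma small_UN:
  fixes A :: "'u \<Rightarrow> 'u set"
  assumes "universe TYPE('u)" "small I" "\<And>i. i \<in> I \<Longrightarrow> small (A i)"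
  shows "small (\<Union>i\<in>I. A i)"
  using assms unfolding universe_def by blast

lemma universe_infinite:
  assumes "universe TYPE('u)"
  shows "infinite (UNIV :: 'u set)"
  using assms unfolding universe_def
  by (simp add: infinite_le_lepoll lesspoll_imp_lepoll)

lemma universe_pairing:
  assumes "universe TYPE('u)"
  obtains e :: "'u \<times> 'u \<Rightarrow> 'u" where "inj e"
proof -
  have "(card_of (UNIV :: ('u \<times> 'u) set), card_of (UNIV :: 'u set)) \<in> ordIso"
    using card_of_Times_same_infinite[OF universe_infinite[OF assms]] by simp
  then have "\<exists>f :: 'u \<times> 'u \<Rightarrow> 'u. inj f"
    by (metis card_of_ordLeq ordIso_iff_ordLeq)
  then show thesis using that by blast
qed

text \<open>A function is encoded by its graph, and the power set of a small set is small.\<close>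

lemma small_PiE:
  fixes I :: "'u set" and A :: "'u \<Rightarrow> 'u set"
  assumes U: "universe TYPE('u)" and I: "small I" and A: "\<And>i. i \<in> I \<Longrightarrow> small (A i)"
  obtains e :: "('u \<Rightarrow> 'u) \<Rightarrow> 'u" where "inj_on e (Pi\<^sub>E I A)" "small (e ` Pi\<^sub>E I A)"
proof -
  obtain p :: "'u \<times> 'u \<Rightarrow> 'u" where p: "inj p" using universe_pairing[OF U] .
  define W where "W = (\<Union>i\<in>I. (\<lambda>a. p (i, a)) ` A i)"
  have "small W" unfolding W_def by (intro small_UN[OF U] I small_image A)
  then have lt: "Pow W \<prec> (UNIV :: 'u set)" using U unfolding universe_def by blast
  then obtain g :: "'u set \<Rightarrow> 'u" where g: "inj_on g (Pow W)"
    using lesspoll_imp_lepoll unfolding lepoll_def by blast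
  have smg: "small (g ` Pow W)"
    unfolding small_def using lt g by (metis inj_on_image_lesspoll_1)
  define gr where "gr = (\<lambda>s. (\<lambda>i. p (i, s i)) ` I)"
  have grW: "gr s \<in> Pow W" if "s \<in> Pi\<^sub>E I A" for s
    using that unfolding gr_def W_def by (auto simp: PiE_iff)
  have "inj_on gr (Pi\<^sub>E I A)"
  proof (rule inj_onI)
    fix s t assume s: "s \<in> Pi\<^sub>E I A" and t: "t \<in> Pi\<^sub>E I A" and eq: "gr s = gr t"
    show "s = t"
    proof (rule PiE_ext[OF s t])
      fix i assume i: "i \<in> I"
      then have "p (i, s i) \<in> gr t" using eq unfolding gr_def by blast
      then obtain j where "j \<in> I" "p (i, s i) = p (j, t j)" unfolding gr_def by blast
      then show "s i = t i" using p by (auto dest: injD)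
    qed
  qed
  then have "inj_on (g \<circ> gr) (Pi\<^sub>E I A)"
    using g grW by (intro comp_inj_on) (auto intro: inj_on_subset)
  moreover have "small ((g \<circ> gr) ` Pi\<^sub>E I A)"
    by (rule small_subset[OF smg]) (use grW in auto)
  ultimately show thesis using that by blast
qed

section \<open>Quotients of abelian groups\<close>

text \<open>
  A function \<open>r\<close> that separates exactly the cosets of \<open>N\<close> identifies the quotient by \<open>N\<close>, whose
  elements are sets, with a group on the range of \<open>r\<close>. Taking for \<open>r\<close> a choice of representatives
  keeps quotients inside the universe \<open>'u\<close>; taking an injective encoding moves a group there.
\<close>

lemma image_group_quotient:
  assumes G: "comm_group G" and N: "subgroup N G"
    and r: "\<And>x y. \<lbrakk>x \<in> carrier G; y \<in> carrier G\<rbrakk> \<Longrightarrow> r x = r y \<longleftrightarrow> x \<otimes>\<^bsub>G\<^esub> inv\<^bsub>G\<^esub> y \<in> N"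
  shows "comm_group (image_group r G)" "r \<in> hom G (image_group r G)"
proof -
  interpret comm_group G by fact
  have w: "weak_group_morphism r N G"
    by (intro weak_group_morphismsI subgroup_imp_normal N r)
  show hom: "r \<in> hom G (image_group r G)"
    using weak_group_morphism_is_hom[OF w] .
  show "comm_group (image_group r G)"
    using hom_imp_img_comm_group[OF hom] by (simp add: image_group_def)
qed

lemma coset_representative:
  fixes G (structure)
  assumes G: "comm_group G" and N: "subgroup N G"
    and x: "x \<in> carrier G" and y: "y \<in> carrier G"
  shows "(SOME z. z \<in> N #>\<^bsub>G\<^esub> x) = (SOME z. z \<in> N #>\<^bsub>G\<^esub> y) \<longleftrightarrow> x \<otimes>\<^bsub>G\<^esub> inv\<^bsub>G\<^esub> y \<in> N"
    and "(SOME z. z \<in> N #>\<^bsub>G\<^esub> x) \<in> carrier G"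
proof -
  interpret comm_group G by fact
  interpret N: subgroup N G by fact
  have ne: "(SOME z. z \<in> N #> a) \<in> N #> a" if "a \<in> carrier G" for a
    by (rule someI_ex) (use rcos_self[OF that N] in blast)
  show "(SOME z. z \<in> N #> x) \<in> carrier G"
    using ne[OF x] r_coset_subset_G[OF N.subset x] by blast
  have "(SOME z. z \<in> N #> x) = (SOME z. z \<in> N #> y) \<longleftrightarrow> N #> x = N #> y"
    using ne[OF x] ne[OF y] repr_independence[OF _ _ N] x y by metis
  also have "\<dots> \<longleftrightarrow> x \<otimes> inv y \<in> N"
  proof
    assume "N #> x = N #> y"
    then have "x \<in> N #> y" using rcos_self[OF x N] by simp
    then obtain n where "n \<in> N" "x = n \<otimes> y" unfolding r_coset_def by blast
    then show "x \<otimes> inv y \<in> N" using y by (simp add: m_assoc)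
  next
    assume "x \<otimes> inv y \<in> N"
    moreover have "x = (x \<otimes> inv y) \<otimes> y" using x y by (simp add: m_assoc)
    ultimately have "x \<in> N #> y" unfolding r_coset_def by blast
    then show "N #> x = N #> y" using repr_independence[OF _ y N] by blast
  qed
  finally show "(SOME z. z \<in> N #> x) = (SOME z. z \<in> N #> y) \<longleftrightarrow> x \<otimes> inv y \<in> N" .
qed

definition coset_rep :: "'a monoid \<Rightarrow> 'a set \<Rightarrow> 'a \<Rightarrow> 'a" where
  "coset_rep G N x = (SOME z. z \<in> N #>\<^bsub>G\<^esub> x)"

definition quot :: "'a monoid \<Rightarrow> 'a set \<Rightarrow> 'a monoid" where
  "quot G N = image_group (coset_rep G N) G"

lemma quot_group:
  assumes "comm_group G" "subgroup N G"
  shows "comm_group (quot G N)" "coset_rep G N \<in> hom G (quot G N)"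
  unfolding quot_def
  by (rule image_group_quotient[OF assms]; simp add: coset_rep_def coset_representative[OF assms])+

lemma carrier_quot: "carrier (quot G N) = coset_rep G N ` carrier G"
  by (simp add: quot_def image_group_carrier)

lemma coset_rep_eq:
  assumes "comm_group G" "subgroup N G" "x \<in> carrier G" "y \<in> carrier G"
  shows "coset_rep G N x = coset_rep G N y \<longleftrightarrow> x \<otimes>\<^bsub>G\<^esub> inv\<^bsub>G\<^esub> y \<in> N"
  unfolding coset_rep_def by (rule coset_representative[OF assms])

lemma coset_rep_one_iff:
  fixes G (structure)
  assumes G: "comm_group G" and N: "subgroup N G" and x: "x \<in> carrier G"
  shows "coset_rep G N x = \<one>\<^bsub>quot G N\<^esub> \<longleftrightarrow> x \<in> N"
proof -
  interpret comm_group G by fact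
  have "\<one>\<^bsub>quot G N\<^esub> = coset_rep G N \<one>" by (simp add: quot_def image_group_one)
  then show ?thesis using coset_rep_eq[OF G N x one_closed] x by simp
qed

lemma hom_eq_iff_one:
  assumes G: "comm_group G" and H: "comm_group H" and h: "h \<in> hom G H"
    and x: "x \<in> carrier G" and y: "y \<in> carrier G"
  shows "h x = h y \<longleftrightarrow> h (x \<otimes>\<^bsub>G\<^esub> inv\<^bsub>G\<^esub> y) = \<one>\<^bsub>H\<^esub>"
proof -
  interpret G: comm_group G by fact
  interpret H: comm_group H by fact
  interpret group_hom G H h using h by unfold_locales
  show ?thesis using x y by (metis G.inv_closed H.inv_closed H.inv_equality H.inv_inv
    H.r_inv hom_closed hom_inv hom_mult)
qed

section \<open>The category of abelian groups\<close>

lemma Obj_Ab: "G \<in> Obj Ab \<longleftrightarrow> comm_group G \<and> small (carrier G)"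
  by (simp add: Ab_def)

lemma quot_Obj_Ab:
  assumes "G \<in> Obj Ab" "subgroup N G"
  shows "quot G N \<in> Obj Ab"
  using assms quot_group(1)[OF _ assms(2)] unfolding Obj_Ab carrier_quot
  by (blast intro: small_image)

definition abhom :: "'u monoid \<Rightarrow> 'u monoid \<Rightarrow> ('u \<Rightarrow> 'u) \<Rightarrow> 'u ab_hom" where
  "abhom G H t = (G, H, restrict t (carrier G))"

lemma Hom_AbD:
  assumes "t \<in> Hom Ab G H"
  shows "G \<in> Obj Ab" "H \<in> Obj Ab" "map_of_ab t \<in> hom G H" "t = abhom G H (map_of_ab t)"
    "comm_group G" "comm_group H" "group G" "group H"
  using assms by (auto simp: Hom_def Ab_def map_of_ab_def abhom_def extensional_restrict
      comm_group.axioms)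

lemma Hom_AbI:
  assumes "G \<in> Obj Ab" "H \<in> Obj Ab" "t \<in> hom G H"
  shows "abhom G H t \<in> Hom Ab G H"
proof -
  have "restrict t (carrier G) \<in> hom G H"
    using assms(3) assms(1) by (auto simp: hom_def Obj_Ab comm_group_def group_def monoid.m_closed
        Pi_iff)
  then show ?thesis using assms by (auto simp: Hom_def Ab_def abhom_def)
qed

lemma map_abhom [simp]: "x \<in> carrier G \<Longrightarrow> map_of_ab (abhom G H t) x = t x"
  by (simp add: map_of_ab_def abhom_def)

lemma map_closed: "t \<in> Hom Ab G H \<Longrightarrow> x \<in> carrier G \<Longrightarrow> map_of_ab t x \<in> carrier H"
  by (meson Hom_AbD(3) hom_in_carrier)

lemma map_mult: "t \<in> Hom Ab G H \<Longrightarrow> x \<in> carrier G \<Longrightarrow> y \<in> carrier G \<Longrightarrow>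
   map_of_ab t (x \<otimes>\<^bsub>G\<^esub> y) = map_of_ab t x \<otimes>\<^bsub>H\<^esub> map_of_ab t y"
  by (meson Hom_AbD(3) hom_mult)

lemma map_one:
  assumes "t \<in> Hom Ab G H"
  shows "map_of_ab t \<one>\<^bsub>G\<^esub> = \<one>\<^bsub>H\<^esub>"
  by (rule hom_one[OF Hom_AbD(3)[OF assms] Hom_AbD(7)[OF assms] Hom_AbD(8)[OF assms]])

lemma map_eq_iff:
  assumes "t \<in> Hom Ab G H" "x \<in> carrier G" "y \<in> carrier G"
  shows "map_of_ab t x = map_of_ab t y \<longleftrightarrow> map_of_ab t (x \<otimes>\<^bsub>G\<^esub> inv\<^bsub>G\<^esub> y) = \<one>\<^bsub>H\<^esub>"
  by (rule hom_eq_iff_one[OF Hom_AbD(5)[OF assms(1)] Hom_AbD(6)[OF assms(1)] Hom_AbD(3)[OF assms(1)] assms(2,3)])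

lemma Ab_eqI:
  assumes "s \<in> Hom Ab G H" "t \<in> Hom Ab G H" "\<And>x. x \<in> carrier G \<Longrightarrow> map_of_ab s x = map_of_ab t x"
  shows "s = t"
proof -
  have "abhom G H (map_of_ab s) = abhom G H (map_of_ab t)"
    unfolding abhom_def using assms(3) by (auto intro: restrict_ext)
  then show ?thesis using Hom_AbD(4)[OF assms(1)] Hom_AbD(4)[OF assms(2)] by simp
qed

lemma map_Comp_Ab:
  assumes "s \<in> Hom Ab G H" "x \<in> carrier G"
  shows "map_of_ab (t \<cdot>\<^bsub>Ab\<^esub> s) x = map_of_ab t (map_of_ab s x)"
  using assms by (auto simp: Hom_def Ab_def map_of_ab_def split: prod.splits)

lemma map_Ident_Ab: "x \<in> carrier G \<Longrightarrow> map_of_ab (Ident Ab G) x = x"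
  by (simp add: Ab_def map_of_ab_def)

lemma map_Add_Ab:
  assumes "s \<in> Hom Ab G H" "t \<in> Hom Ab G H" "x \<in> carrier G"
  shows "map_of_ab (s \<^bold>+\<^bsub>Ab\<^esub> t) x = map_of_ab s x \<otimes>\<^bsub>H\<^esub> map_of_ab t x"
  using assms by (auto simp: Hom_def Ab_def map_of_ab_def split: prod.splits)

lemma Comp_Ab_closed:
  assumes "s \<in> Hom Ab G H" "t \<in> Hom Ab H K"
  shows "t \<cdot>\<^bsub>Ab\<^esub> s \<in> Hom Ab G K"
proof -
  have "t \<cdot>\<^bsub>Ab\<^esub> s = abhom G K (map_of_ab t \<circ> map_of_ab s)"
    using assms by (auto simp: Hom_def Ab_def map_of_ab_def abhom_def split: prod.splits)
  moreover have "map_of_ab t \<circ> map_of_ab s \<in> hom G K"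
    using Hom_AbD(3)[OF assms(1)] Hom_AbD(3)[OF assms(2)] Group.hom_compose by blast
  ultimately show ?thesis using Hom_AbI[OF Hom_AbD(1)[OF assms(1)] Hom_AbD(2)[OF assms(2)]] by simp
qed

lemma Ident_Ab_closed: "G \<in> Obj Ab \<Longrightarrow> Ident Ab G \<in> Hom Ab G G"
proof -
  assume G: "G \<in> Obj Ab"
  have "Ident Ab G = abhom G G (\<lambda>x. x)" by (simp add: Ab_def abhom_def)
  moreover have "(\<lambda>x. x) \<in> hom G G" by (simp add: hom_def)
  ultimately show ?thesis using Hom_AbI G by metis
qed


section \<open>Directed colimits of abelian groups\<close>

lemma (in category) Hom_Obj:
  assumes "f \<in> Hom C A B"
  shows "A \<in> Obj C" "B \<in> Obj C"
  using assms Dom_in_Obj Cod_in_Obj by (auto simp: Hom_def)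

lemma directed_category: "directed J \<Longrightarrow> category J"
  by (simp add: directed_def small_category_def)

lemma directed_thin:
  assumes "directed J" "u \<in> Hom J i j" "v \<in> Hom J i j"
  shows "u = v"
proof -
  interpret category J using assms(1) by (rule directed_category)
  show ?thesis using assms Hom_Obj[OF assms(2)] unfolding directed_def by blast
qed

lemma directed_upper_bound:
  assumes "directed J" "i \<in> Obj J" "j \<in> Obj J"
  obtains k u v where "k \<in> Obj J" "u \<in> Hom J i k" "v \<in> Hom J j k"
  using assms unfolding directed_def by (metis all_not_in_conv)

lemma is_functor_Hom:
  assumes "is_functor C D F" "category C" "f \<in> Hom C X Y"
  shows "FA F f \<in> Hom D (FO F X) (FO F Y)"
proof -
  interpret category C by fact
  show ?thesis using assms(1,3) Hom_Obj[OF assms(3)] unfolding is_functor_def by blast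
qed

lemma is_functor_Comp:
  assumes "is_functor C D F" "category C" "f \<in> Hom C X Y" "g \<in> Hom C Y Z"
  shows "FA F (g \<cdot>\<^bsub>C\<^esub> f) = FA F g \<cdot>\<^bsub>D\<^esub> FA F f"
proof -
  interpret category C by fact
  show ?thesis using assms(1,3,4) Hom_Obj[OF assms(3)] Hom_Obj[OF assms(4)]
    unfolding is_functor_def by blast
qed

lemma cocone_component: "is_cocone J C G L c \<Longrightarrow> i \<in> Obj J \<Longrightarrow> c i \<in> Hom C (FO G i) L"
  by (simp add: is_cocone_def)

lemma cocone_functor: "is_cocone J C G L c \<Longrightarrow> is_functor J C G"
  by (simp add: is_cocone_def)

lemma cocone_Comp:
  assumes "is_cocone J C G L c" "category J" "u \<in> Hom J i j"
  shows "c j \<cdot>\<^bsub>C\<^esub> FA G u = c i"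
proof -
  interpret category J by fact
  show ?thesis using assms(1,3) Hom_Obj[OF assms(3)] unfolding is_cocone_def by blast
qed

lemma cocone_map:
  assumes "is_cocone J Ab G L c" "category J" "u \<in> Hom J i j" "x \<in> carrier (FO G i)"
  shows "map_of_ab (c j) (map_of_ab (FA G u) x) = map_of_ab (c i) x"
  using map_Comp_Ab[OF is_functor_Hom[OF cocone_functor[OF assms(1)] assms(2,3)] assms(4)]
    cocone_Comp[OF assms(1-3)] by metis

lemma colimit_cocone: "is_colimit J C G L c \<Longrightarrow> is_cocone J C G L c"
  by (simp add: is_colimit_def)

lemma colimit_induced:
  assumes "is_colimit J C G L c" "is_cocone J C G M d"
  obtains h where "h \<in> Hom C L M" "\<And>i. i \<in> Obj J \<Longrightarrow> h \<cdot>\<^bsub>C\<^esub> c i = d i"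
  using assms unfolding is_colimit_def by metis

lemma colimit_unique:
  assumes "is_colimit J C G L c" "is_cocone J C G M d"
    "h \<in> Hom C L M" "\<And>i. i \<in> Obj J \<Longrightarrow> h \<cdot>\<^bsub>C\<^esub> c i = d i"
    "h' \<in> Hom C L M" "\<And>i. i \<in> Obj J \<Longrightarrow> h' \<cdot>\<^bsub>C\<^esub> c i = d i"
  shows "h = h'"
  using assms unfolding is_colimit_def by metis

lemma trivial_hom: "comm_group G \<Longrightarrow> comm_group H \<Longrightarrow> (\<lambda>_. \<one>\<^bsub>H\<^esub>) \<in> hom G H"
  by (simp add: hom_def comm_group_def group_def monoid.one_closed Pi_iff)

text \<open>
  A cocone over a directed system of abelian groups is a colimit if and only if every element of
  its tip comes from some stage and every element of a stage that vanishes in the tip vanishes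
  already at a later stage. Everything below about direct limits goes through these two conditions.
\<close>

definition exhausted :: "('u, 'u) category \<Rightarrow> ('u, 'u, 'u monoid, 'u ab_hom) func \<Rightarrow>
    'u monoid \<Rightarrow> ('u \<Rightarrow> 'u ab_hom) \<Rightarrow> bool" where
  "exhausted J G L c \<longleftrightarrow>
     (\<forall>y\<in>carrier L. \<exists>i\<in>Obj J. \<exists>x\<in>carrier (FO G i). map_of_ab (c i) x = y)"

definition dies_early :: "('u, 'u) category \<Rightarrow> ('u, 'u, 'u monoid, 'u ab_hom) func \<Rightarrow>
    'u monoid \<Rightarrow> ('u \<Rightarrow> 'u ab_hom) \<Rightarrow> bool" where
  "dies_early J G L c \<longleftrightarrow>
     (\<forall>i\<in>Obj J. \<forall>x\<in>carrier (FO G i). map_of_ab (c i) x = \<one>\<^bsub>L\<^esub> \<longrightarrow>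
        (\<exists>j\<in>Obj J. \<exists>u\<in>Hom J i j. map_of_ab (FA G u) x = \<one>\<^bsub>FO G j\<^esub>))"

text \<open>
  The elements coming from the stages form a subgroup \<open>H\<close>. The projection modulo \<open>H\<close> and the
  trivial map agree on all stages, so they are equal, and \<open>H\<close> is everything.
\<close>

lemma directed_colimit_exhausted:
  fixes J :: "('u, 'u) category"
  assumes J: "directed J" and colim: "is_colimit J Ab G L c"
  shows "exhausted J G L c"
  unfolding exhausted_def
proof
  fix y assume y: "y \<in> carrier L"
  interpret J: category J using J by (rule directed_category)
  note cJ = directed_category[OF J]
  note cocone = colimit_cocone[OF colim]
  note c = cocone_component[OF cocone]
  note FG = is_functor_Hom[OF cocone_functor[OF cocone] cJ]
  have LO: "L \<in> Obj Ab" using cocone by (simp add: is_cocone_def)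
  then have L: "comm_group L" by (simp add: Obj_Ab)
  interpret L: comm_group L by fact
  define H where "H = {map_of_ab (c i) x | i x. i \<in> Obj J \<and> x \<in> carrier (FO G i)}"
  have GO: "FO G i \<in> Obj Ab" if "i \<in> Obj J" for i
    using cocone that by (simp add: is_cocone_def is_functor_def)
  then have Gg: "group (FO G i)" if "i \<in> Obj J" for i
    using that by (simp add: Obj_Ab comm_group.axioms)
  have H: "subgroup H L"
  proof (rule L.subgroupI)
    show "H \<subseteq> carrier L" unfolding H_def using map_closed[OF c] by blast
    obtain i where "i \<in> Obj J" using J by (auto simp: directed_def)
    then show "H \<noteq> {}" unfolding H_def using group.is_monoid[OF Gg] monoid.one_closed by blast
    show "inv\<^bsub>L\<^esub> a \<in> H" if "a \<in> H" for a
    proof -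
      from that obtain i x where ix: "i \<in> Obj J" "x \<in> carrier (FO G i)" "a = map_of_ab (c i) x"
        unfolding H_def by blast
      interpret group_hom "FO G i" L "map_of_ab (c i)"
        using Hom_AbD(3,7,8)[OF c[OF ix(1)]] by (simp add: group_hom_def group_hom_axioms_def)
      have "inv\<^bsub>L\<^esub> a = map_of_ab (c i) (inv\<^bsub>FO G i\<^esub> x)" using ix by simp
      then show ?thesis unfolding H_def using ix G.inv_closed by blast
    qed
    show "a \<otimes>\<^bsub>L\<^esub> b \<in> H" if "a \<in> H" "b \<in> H" for a b
    proof -
      from that obtain i x j y where ix: "i \<in> Obj J" "x \<in> carrier (FO G i)" "a = map_of_ab (c i) x"
        and jy: "j \<in> Obj J" "y \<in> carrier (FO G j)" "b = map_of_ab (c j) y"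
        unfolding H_def by blast
      obtain k u v where k: "k \<in> Obj J" "u \<in> Hom J i k" "v \<in> Hom J j k"
        using directed_upper_bound[OF J ix(1) jy(1)] .
      have cl: "map_of_ab (FA G u) x \<in> carrier (FO G k)" "map_of_ab (FA G v) y \<in> carrier (FO G k)"
        using map_closed[OF FG[OF k(2)] ix(2)] map_closed[OF FG[OF k(3)] jy(2)] .
      then have "a \<otimes>\<^bsub>L\<^esub> b
          = map_of_ab (c k) (map_of_ab (FA G u) x \<otimes>\<^bsub>FO G k\<^esub> map_of_ab (FA G v) y)"
        using map_mult[OF c[OF k(1)] cl] cocone_map[OF cocone cJ k(2) ix(2)]
          cocone_map[OF cocone cJ k(3) jy(2)] ix jy by simp
      then show ?thesis unfolding H_def
        using k(1) monoid.m_closed[OF group.is_monoid[OF Gg[OF k(1)]] cl] by blast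
    qed
  qed
  define Q where "Q = quot L H"
  have QO: "Q \<in> Obj Ab" unfolding Q_def by (rule quot_Obj_Ab[OF LO H])
  then have Q: "comm_group Q" by (simp add: Obj_Ab)
  define d where "d = (\<lambda>i. abhom (FO G i) Q (\<lambda>_. \<one>\<^bsub>Q\<^esub>))"
  have d: "d i \<in> Hom Ab (FO G i) Q" if "i \<in> Obj J" for i
    unfolding d_def using GO[OF that] QO by (intro Hom_AbI trivial_hom) (auto simp: Obj_Ab)
  have dc: "is_cocone J Ab G Q d"
    unfolding is_cocone_def
  proof (intro conjI ballI cocone_functor[OF cocone] QO d)
    fix i j u assume i: "i \<in> Obj J" and j: "j \<in> Obj J" and u: "u \<in> Hom J i j"
    show "d j \<cdot>\<^bsub>Ab\<^esub> FA G u = d i"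
      by (rule Ab_eqI[OF Comp_Ab_closed[OF FG[OF u] d[OF j]] d[OF i]])
        (simp add: map_Comp_Ab[OF FG[OF u]] d_def map_closed[OF FG[OF u]])
  qed
  define q where "q = abhom L Q (coset_rep L H)"
  define z where "z = abhom L Q (\<lambda>_. \<one>\<^bsub>Q\<^esub>)"
  have q: "q \<in> Hom Ab L Q" unfolding q_def Q_def
    using LO QO quot_group(2)[OF L H] unfolding Q_def by (intro Hom_AbI) auto
  have z: "z \<in> Hom Ab L Q" unfolding z_def by (intro Hom_AbI LO QO trivial_hom L Q)
  have "q = z"
  proof (rule colimit_unique[OF colim dc q _ z])
    fix i assume i: "i \<in> Obj J"
    show "q \<cdot>\<^bsub>Ab\<^esub> c i = d i"
    proof (rule Ab_eqI[OF Comp_Ab_closed[OF c[OF i] q] d[OF i]])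
      fix x assume x: "x \<in> carrier (FO G i)"
      have "map_of_ab (c i) x \<in> H" unfolding H_def using i x by blast
      then show "map_of_ab (q \<cdot>\<^bsub>Ab\<^esub> c i) x = map_of_ab (d i) x"
        using x coset_rep_one_iff[OF L H] map_closed[OF c[OF i] x]
        by (simp add: map_Comp_Ab[OF c[OF i]] q_def d_def Q_def)
    qed
    show "z \<cdot>\<^bsub>Ab\<^esub> c i = d i"
      by (rule Ab_eqI[OF Comp_Ab_closed[OF c[OF i] z] d[OF i]])
        (simp add: map_Comp_Ab[OF c[OF i]] z_def d_def map_closed[OF c[OF i]])
  qed
  then have "map_of_ab q y = map_of_ab z y" by simp
  then have "coset_rep L H y = \<one>\<^bsub>Q\<^esub>" using y by (simp add: q_def z_def)
  then have "y \<in> H" using coset_rep_one_iff[OF L H y] unfolding Q_def by simp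
  then show "\<exists>i\<in>Obj J. \<exists>x\<in>carrier (FO G i). map_of_ab (c i) x = y"
    unfolding H_def by blast
qed

text \<open>
  The stages map into the group of germs, that is the product of all stages modulo the families
  that are trivial from some stage on, by sending an element to the family of its images at the
  later stages. A germ is trivial exactly if the element dies at a later stage.
\<close>

lemma directed_colimit_dies_early:
  fixes J :: "('u, 'u) category"
  assumes U: "universe TYPE('u)" and J: "directed J" and colim: "is_colimit J Ab G L c"
  shows "dies_early J G L c"
  unfolding dies_early_def
proof (intro ballI impI)
  fix i0 x0 assume i0: "i0 \<in> Obj J" and x0: "x0 \<in> carrier (FO G i0)"
    and dead: "map_of_ab (c i0) x0 = \<one>\<^bsub>L\<^esub>"
  interpret J: category J using J by (rule directed_category)
  note cJ = directed_category[OF J]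
  note cocone = colimit_cocone[OF colim]
  note c = cocone_component[OF cocone]
  note Gfun = cocone_functor[OF cocone]
  note FG = is_functor_Hom[OF Gfun cJ]
  have GO: "FO G i \<in> Obj Ab" if "i \<in> Obj J" for i
    using cocone that by (simp add: is_cocone_def is_functor_def)
  then have Gc: "comm_group (FO G i)" if "i \<in> Obj J" for i
    using that by (simp add: Obj_Ab)
  then have Gg: "group (FO G i)" if "i \<in> Obj J" for i
    using that by (simp add: comm_group.axioms)
  have Gm: "monoid (FO G i)" if "i \<in> Obj J" for i using Gg that by (simp add: group.is_monoid)
  define P where "P = product_group (Obj J) (FO G)"
  have carP: "carrier P = Pi\<^sub>E (Obj J) (\<lambda>i. carrier (FO G i))" by (simp add: P_def)
  have Pg: "group P" unfolding P_def using Gg by simp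
  have Pc: "comm_group P"
  proof (rule group.group_comm_groupI[OF Pg])
    fix s t assume s: "s \<in> carrier P" and t: "t \<in> carrier P"
    show "s \<otimes>\<^bsub>P\<^esub> t = t \<otimes>\<^bsub>P\<^esub> s"
      using s t unfolding P_def
      by (auto intro!: restrict_ext comm_monoid.m_comm[OF comm_group.axioms(1)[OF Gc]])
  qed
  interpret P: comm_group P by fact
  define N where "N = {s \<in> carrier P. \<exists>k\<in>Obj J. \<forall>j\<in>Obj J. Hom J k j \<noteq> {} \<longrightarrow> s j = \<one>\<^bsub>FO G j\<^esub>}"
  have le_trans: "Hom J i k \<noteq> {}" if "Hom J i j \<noteq> {}" "Hom J j k \<noteq> {}" for i j k
    using that J.Comp_in_Hom by blast
  have N: "subgroup N P"
  proof (rule P.subgroupI)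
    show "N \<subseteq> carrier P" unfolding N_def by blast
    have "\<one>\<^bsub>P\<^esub> \<in> N" unfolding N_def using i0 P.one_closed by (auto simp: P_def)
    then show "N \<noteq> {}" by blast
    show "inv\<^bsub>P\<^esub> s \<in> N" if s: "s \<in> N" for s
    proof -
      from s obtain k where k: "k \<in> Obj J" "\<And>j. j \<in> Obj J \<Longrightarrow> Hom J k j \<noteq> {} \<Longrightarrow> s j = \<one>\<^bsub>FO G j\<^esub>"
        and sP: "s \<in> carrier P" unfolding N_def by blast
      have "inv\<^bsub>P\<^esub> s = (\<lambda>i\<in>Obj J. inv\<^bsub>FO G i\<^esub> s i)"
        unfolding P_def by (rule inv_product_group) (use sP carP Gg in auto)
      then have "(inv\<^bsub>P\<^esub> s) j = \<one>\<^bsub>FO G j\<^esub>" if "j \<in> Obj J" "Hom J k j \<noteq> {}" for j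
        using that k(2) group.is_monoid[OF Gg] by (simp add: monoid.inv_one)
      then show ?thesis unfolding N_def using k(1) P.inv_closed[OF sP] by blast
    qed
    show "s \<otimes>\<^bsub>P\<^esub> t \<in> N" if st: "s \<in> N" "t \<in> N" for s t
    proof -
      from st obtain k l where k: "k \<in> Obj J" "\<And>j. j \<in> Obj J \<Longrightarrow> Hom J k j \<noteq> {} \<Longrightarrow> s j = \<one>\<^bsub>FO G j\<^esub>"
        and l: "l \<in> Obj J" "\<And>j. j \<in> Obj J \<Longrightarrow> Hom J l j \<noteq> {} \<Longrightarrow> t j = \<one>\<^bsub>FO G j\<^esub>"
        and cl: "s \<in> carrier P" "t \<in> carrier P" unfolding N_def by blast
      obtain m u v where m: "m \<in> Obj J" "u \<in> Hom J k m" "v \<in> Hom J l m"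
        using directed_upper_bound[OF J k(1) l(1)] .
      have "(s \<otimes>\<^bsub>P\<^esub> t) j = \<one>\<^bsub>FO G j\<^esub>" if j: "j \<in> Obj J" "Hom J m j \<noteq> {}" for j
      proof -
        have "Hom J k j \<noteq> {}" "Hom J l j \<noteq> {}" using le_trans m j(2) by blast+
        then show ?thesis using k(2) l(2) j(1) by (simp add: P_def monoid.r_one Gm monoid.one_closed)
      qed
      then show ?thesis unfolding N_def using m(1) P.m_closed[OF cl] by blast
    qed
  qed
  obtain e :: "('u \<Rightarrow> 'u) \<Rightarrow> 'u" where e: "inj_on e (carrier P)" and sm: "small (e ` carrier P)"
  proof (rule small_PiE[OF U, of "Obj J" "\<lambda>i. carrier (FO G i)"])
    show "small (Obj J)" using J by (simp add: directed_def small_category_def)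
    show "small (carrier (FO G i))" if "i \<in> Obj J" for i using GO[OF that] by (simp add: Obj_Ab)
  qed (use that carP in auto)
  define r where "r = e \<circ> coset_rep P N"
  have r_eq: "r s = r t \<longleftrightarrow> s \<otimes>\<^bsub>P\<^esub> inv\<^bsub>P\<^esub> t \<in> N" if "s \<in> carrier P" "t \<in> carrier P" for s t
    using coset_rep_eq[OF Pc N that] coset_representative(2)[OF Pc N that]
      coset_representative(2)[OF Pc N that(2,1)] e
    unfolding r_def coset_rep_def comp_def by (metis inj_onD)
  define Q where "Q = image_group r P"
  have Qc: "comm_group Q" and rhom: "r \<in> hom P Q"
    unfolding Q_def using image_group_quotient[OF Pc N] r_eq by blast+
  have "carrier Q \<subseteq> e ` carrier P"
    using coset_representative(2)[OF Pc N] unfolding Q_def image_group_carrier r_def coset_rep_def by auto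
  then have QO: "Q \<in> Obj Ab" using Qc small_subset[OF sm] by (simp add: Obj_Ab)
  have r_one: "\<one>\<^bsub>Q\<^esub> = r \<one>\<^bsub>P\<^esub>" by (simp add: Q_def image_group_one)
  have r_one_iff: "r s = \<one>\<^bsub>Q\<^esub> \<longleftrightarrow> s \<in> N" if "s \<in> carrier P" for s
    using r_eq[OF that P.one_closed] that r_one by simp
  \<comment> \<open>The value at the indices that are not above \<open>i\<close> does not affect the germ.\<close>
  define germ where "germ = (\<lambda>i x. \<lambda>j\<in>Obj J. if Hom J i j \<noteq> {}
      then map_of_ab (FA G (SOME u. u \<in> Hom J i j)) x else \<one>\<^bsub>FO G j\<^esub>)"
  have germ_at: "germ i x j = map_of_ab (FA G u) x" if "u \<in> Hom J i j" for i j x u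
  proof -
    have "(SOME u. u \<in> Hom J i j) = u" using that directed_thin[OF J] by blast
    then show ?thesis using that J.Hom_Obj[OF that] by (auto simp: germ_def)
  qed
  have germP: "germ i x \<in> carrier P" if x: "x \<in> carrier (FO G i)" for i x
    unfolding carP
  proof (rule PiE_I)
    fix j assume j: "j \<in> Obj J"
    show "germ i x j \<in> carrier (FO G j)"
    proof (cases "Hom J i j = {}")
      case True then show ?thesis using j by (simp add: germ_def monoid.one_closed[OF Gm])
    next
      case False
      then obtain u where u: "u \<in> Hom J i j" by blast
      then show ?thesis using germ_at[OF u] map_closed[OF FG[OF u] x] by simp
    qed
  qed (simp add: germ_def)
  have germ_hom: "germ i \<in> hom (FO G i) P" if i: "i \<in> Obj J" for i
  proof (rule homI)
    fix x y assume x: "x \<in> carrier (FO G i)" and y: "y \<in> carrier (FO G i)"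
    show "germ i (x \<otimes>\<^bsub>FO G i\<^esub> y) = germ i x \<otimes>\<^bsub>P\<^esub> germ i y"
    proof (rule PiE_ext)
      show "germ i (x \<otimes>\<^bsub>FO G i\<^esub> y) \<in> Pi\<^sub>E (Obj J) (\<lambda>i. carrier (FO G i))"
        using germP[OF monoid.m_closed[OF Gm[OF i] x y]] carP by simp
      show "germ i x \<otimes>\<^bsub>P\<^esub> germ i y \<in> Pi\<^sub>E (Obj J) (\<lambda>i. carrier (FO G i))"
        using P.m_closed[OF germP[OF x] germP[OF y]] carP by simp
      fix j assume j: "j \<in> Obj J"
      have *: "(germ i x \<otimes>\<^bsub>P\<^esub> germ i y) j = germ i x j \<otimes>\<^bsub>FO G j\<^esub> germ i y j"
        using j by (simp add: P_def)
      show "germ i (x \<otimes>\<^bsub>FO G i\<^esub> y) j = (germ i x \<otimes>\<^bsub>P\<^esub> germ i y) j"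
      proof (cases "Hom J i j = {}")
        case True
        then show ?thesis unfolding *
          using j by (simp add: germ_def monoid.one_closed[OF Gm] monoid.l_one[OF Gm])
      next
        case False
        then obtain u where u: "u \<in> Hom J i j" by blast
        show ?thesis unfolding * germ_at[OF u] by (rule map_mult[OF FG[OF u] x y])
      qed
    qed
  qed (rule germP)
  define d where "d = (\<lambda>i. abhom (FO G i) Q (r \<circ> germ i))"
  have d: "d i \<in> Hom Ab (FO G i) Q" if "i \<in> Obj J" for i
    unfolding d_def by (intro Hom_AbI GO that QO Group.hom_compose[OF germ_hom rhom])
  have dc: "is_cocone J Ab G Q d"
    unfolding is_cocone_def
  proof (intro conjI ballI Gfun QO d)
    fix i j u assume i: "i \<in> Obj J" and j: "j \<in> Obj J" and u: "u \<in> Hom J i j"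
    show "d j \<cdot>\<^bsub>Ab\<^esub> FA G u = d i"
    proof (rule Ab_eqI[OF Comp_Ab_closed[OF FG[OF u] d[OF j]] d[OF i]])
      fix x assume x: "x \<in> carrier (FO G i)"
      define y where "y = map_of_ab (FA G u) x"
      have y: "y \<in> carrier (FO G j)" unfolding y_def by (rule map_closed[OF FG[OF u] x])
      have "germ j y \<otimes>\<^bsub>P\<^esub> inv\<^bsub>P\<^esub> germ i x \<in> N"
        unfolding N_def
      proof (intro CollectI conjI bexI[OF _ j] ballI impI)
        show "germ j y \<otimes>\<^bsub>P\<^esub> inv\<^bsub>P\<^esub> germ i x \<in> carrier P"
          using germP x y by simp
        fix k assume k: "k \<in> Obj J" "Hom J j k \<noteq> {}"
        then obtain v where v: "v \<in> Hom J j k" by blast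
        have "germ j y k = map_of_ab (FA G v \<cdot>\<^bsub>Ab\<^esub> FA G u) x"
          unfolding germ_at[OF v] y_def map_Comp_Ab[OF FG[OF u] x] ..
        also have "\<dots> = germ i x k"
          using germ_at[OF J.Comp_in_Hom[OF u v]] is_functor_Comp[OF Gfun cJ u v] by simp
        finally have eq: "germ j y k = germ i x k" .
        have inv: "inv\<^bsub>P\<^esub> germ i x = (\<lambda>i'\<in>Obj J. inv\<^bsub>FO G i'\<^esub> germ i x i')"
          unfolding P_def by (rule inv_product_group) (use germP[OF x] carP Gg in auto)
        have "germ i x k \<in> carrier (FO G k)" using germP[OF x] k carP by (auto simp: PiE_iff)
        then show "(germ j y \<otimes>\<^bsub>P\<^esub> inv\<^bsub>P\<^esub> germ i x) k = \<one>\<^bsub>FO G k\<^esub>"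
          using eq inv k group.r_inv[OF Gg] by (simp add: P_def)
      qed
      then have "r (germ j y) = r (germ i x)" using r_eq[OF germP[OF y] germP[OF x]] by simp
      then show "map_of_ab (d j \<cdot>\<^bsub>Ab\<^esub> FA G u) x = map_of_ab (d i) x"
        unfolding map_Comp_Ab[OF FG[OF u] x] y_def[symmetric] using x y by (simp add: d_def)
    qed
  qed
  obtain h where h: "h \<in> Hom Ab L Q" "\<And>i. i \<in> Obj J \<Longrightarrow> h \<cdot>\<^bsub>Ab\<^esub> c i = d i"
    using colimit_induced[OF colim dc] by metis
  have "r (germ i0 x0) = map_of_ab (h \<cdot>\<^bsub>Ab\<^esub> c i0) x0"
    unfolding h(2)[OF i0] using x0 by (simp add: d_def)
  also have "\<dots> = \<one>\<^bsub>Q\<^esub>" unfolding map_Comp_Ab[OF c[OF i0] x0] dead by (rule map_one[OF h(1)])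
  finally have "germ i0 x0 \<in> N" using r_one_iff[OF germP[OF x0]] by simp
  then obtain k where k: "k \<in> Obj J" "\<And>j. j \<in> Obj J \<Longrightarrow> Hom J k j \<noteq> {} \<Longrightarrow> germ i0 x0 j = \<one>\<^bsub>FO G j\<^esub>"
    unfolding N_def by blast
  obtain j u v where j: "j \<in> Obj J" "u \<in> Hom J i0 j" "v \<in> Hom J k j"
    using directed_upper_bound[OF J i0 k(1)] .
  then have "map_of_ab (FA G u) x0 = \<one>\<^bsub>FO G j\<^esub>" using k(2) germ_at[OF j(2)] by (metis empty_iff)
  then show "\<exists>j\<in>Obj J. \<exists>u\<in>Hom J i0 j. map_of_ab (FA G u) x0 = \<one>\<^bsub>FO G j\<^esub>" using j by blast
qed

text \<open>
  A cocone induces a map on the tip by evaluating it on any representative at any stage; two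
  representatives become equal at a common later stage.
\<close>

lemma directed_colimit_AbI:
  fixes J :: "('u, 'u) category"
  assumes J: "directed J" and cocone: "is_cocone J Ab G L c"
    and ex: "exhausted J G L c" and de: "dies_early J G L c"
  shows "is_colimit J Ab G L c"
  unfolding is_colimit_def
proof (intro conjI allI impI cocone)
  fix M d assume dc: "is_cocone J Ab G M d"
  interpret J: category J using J by (rule directed_category)
  note cJ = directed_category[OF J]
  note c = cocone_component[OF cocone]
  note d = cocone_component[OF dc]
  note FG = is_functor_Hom[OF cocone_functor[OF cocone] cJ]
  have LO: "L \<in> Obj Ab" and MO: "M \<in> Obj Ab" using cocone dc by (auto simp: is_cocone_def)
  have GO: "FO G i \<in> Obj Ab" if "i \<in> Obj J" for i
    using cocone that by (simp add: is_cocone_def is_functor_def)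
  have wd1: "map_of_ab (d i) a = map_of_ab (d i) b"
    if i: "i \<in> Obj J" and a: "a \<in> carrier (FO G i)" and b: "b \<in> carrier (FO G i)"
      and eq: "map_of_ab (c i) a = map_of_ab (c i) b" for i a b
  proof -
    interpret Gi: comm_group "FO G i" using GO[OF i] by (simp add: Obj_Ab)
    have ab: "a \<otimes>\<^bsub>FO G i\<^esub> inv\<^bsub>FO G i\<^esub> b \<in> carrier (FO G i)" using a b by simp
    have "map_of_ab (c i) (a \<otimes>\<^bsub>FO G i\<^esub> inv\<^bsub>FO G i\<^esub> b) = \<one>\<^bsub>L\<^esub>"
      using map_eq_iff[OF c[OF i] a b] eq by simp
    then obtain j u where j: "j \<in> Obj J" "u \<in> Hom J i j"
      and "map_of_ab (FA G u) (a \<otimes>\<^bsub>FO G i\<^esub> inv\<^bsub>FO G i\<^esub> b) = \<one>\<^bsub>FO G j\<^esub>"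
      using de i ab unfolding dies_early_def by blast
    then have "map_of_ab (d i) (a \<otimes>\<^bsub>FO G i\<^esub> inv\<^bsub>FO G i\<^esub> b) = \<one>\<^bsub>M\<^esub>"
      using cocone_map[OF dc cJ j(2) ab] map_one[OF d[OF j(1)]] by simp
    then show ?thesis using map_eq_iff[OF d[OF i] a b] by simp
  qed
  have wd: "map_of_ab (d i) a = map_of_ab (d j) b"
    if i: "i \<in> Obj J" and a: "a \<in> carrier (FO G i)" and j: "j \<in> Obj J" and b: "b \<in> carrier (FO G j)"
      and eq: "map_of_ab (c i) a = map_of_ab (c j) b" for i j a b
  proof -
    obtain k u v where k: "k \<in> Obj J" "u \<in> Hom J i k" "v \<in> Hom J j k"
      using directed_upper_bound[OF J i j] .
    show ?thesis
      using wd1[OF k(1) map_closed[OF FG[OF k(2)] a] map_closed[OF FG[OF k(3)] b]] eq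
        cocone_map[OF cocone cJ k(2) a] cocone_map[OF cocone cJ k(3) b]
        cocone_map[OF dc cJ k(2) a] cocone_map[OF dc cJ k(3) b] by simp
  qed
  define h where "h = (\<lambda>y. SOME z. \<exists>i\<in>Obj J. \<exists>x\<in>carrier (FO G i). map_of_ab (c i) x = y \<and> map_of_ab (d i) x = z)"
  have h_at: "h (map_of_ab (c i) x) = map_of_ab (d i) x"
    if i: "i \<in> Obj J" and x: "x \<in> carrier (FO G i)" for i x
    unfolding h_def
  proof (rule some_equality)
    show "\<exists>j\<in>Obj J. \<exists>b\<in>carrier (FO G j). map_of_ab (c j) b = map_of_ab (c i) x \<and> map_of_ab (d j) b = map_of_ab (d i) x"
      using i x by blast
    fix z assume "\<exists>j\<in>Obj J. \<exists>b\<in>carrier (FO G j). map_of_ab (c j) b = map_of_ab (c i) x \<and> map_of_ab (d j) b = z"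
    then show "z = map_of_ab (d i) x" using wd i x by blast
  qed
  have hhom: "h \<in> hom L M"
  proof (rule homI)
    fix y assume "y \<in> carrier L"
    then show "h y \<in> carrier M" using ex h_at map_closed[OF d] unfolding exhausted_def by metis
  next
    fix y z assume y: "y \<in> carrier L" and z: "z \<in> carrier L"
    obtain i a where i: "i \<in> Obj J" "a \<in> carrier (FO G i)" "map_of_ab (c i) a = y"
      using ex y unfolding exhausted_def by blast
    obtain j b where j: "j \<in> Obj J" "b \<in> carrier (FO G j)" "map_of_ab (c j) b = z"
      using ex z unfolding exhausted_def by blast
    obtain k u v where k: "k \<in> Obj J" "u \<in> Hom J i k" "v \<in> Hom J j k"
      using directed_upper_bound[OF J i(1) j(1)] .
    define a' where "a' = map_of_ab (FA G u) a"
    define b' where "b' = map_of_ab (FA G v) b"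
    have a': "a' \<in> carrier (FO G k)" "map_of_ab (c k) a' = y"
      unfolding a'_def using map_closed[OF FG[OF k(2)] i(2)] cocone_map[OF cocone cJ k(2) i(2)] i(3) by simp_all
    have b': "b' \<in> carrier (FO G k)" "map_of_ab (c k) b' = z"
      unfolding b'_def using map_closed[OF FG[OF k(3)] j(2)] cocone_map[OF cocone cJ k(3) j(2)] j(3) by simp_all
    interpret Gk: comm_group "FO G k" using GO[OF k(1)] by (simp add: Obj_Ab)
    have "h (y \<otimes>\<^bsub>L\<^esub> z) = h (map_of_ab (c k) (a' \<otimes>\<^bsub>FO G k\<^esub> b'))"
      using map_mult[OF c[OF k(1)] a'(1) b'(1)] a' b' by simp
    also have "\<dots> = map_of_ab (d k) (a' \<otimes>\<^bsub>FO G k\<^esub> b')"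
      by (rule h_at[OF k(1)]) (use a' b' in simp)
    also have "\<dots> = map_of_ab (d k) a' \<otimes>\<^bsub>M\<^esub> map_of_ab (d k) b'"
      by (rule map_mult[OF d[OF k(1)] a'(1) b'(1)])
    also have "\<dots> = h y \<otimes>\<^bsub>M\<^esub> h z"
      using h_at[OF k(1) a'(1)] h_at[OF k(1) b'(1)] a' b' by simp
    finally show "h (y \<otimes>\<^bsub>L\<^esub> z) = h y \<otimes>\<^bsub>M\<^esub> h z" .
  qed
  show "\<exists>!h. h \<in> Hom Ab L M \<and> (\<forall>i\<in>Obj J. h \<cdot>\<^bsub>Ab\<^esub> c i = d i)"
  proof (rule ex1I[of _ "abhom L M h"])
    have H: "abhom L M h \<in> Hom Ab L M" by (rule Hom_AbI[OF LO MO hhom])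
    moreover have "abhom L M h \<cdot>\<^bsub>Ab\<^esub> c i = d i" if i: "i \<in> Obj J" for i
      by (rule Ab_eqI[OF Comp_Ab_closed[OF c[OF i] H] d[OF i]])
        (simp add: map_Comp_Ab[OF c[OF i]] map_closed[OF c[OF i]] h_at[OF i])
    ultimately show "abhom L M h \<in> Hom Ab L M \<and> (\<forall>i\<in>Obj J. abhom L M h \<cdot>\<^bsub>Ab\<^esub> c i = d i)" by blast
    fix g assume g: "g \<in> Hom Ab L M \<and> (\<forall>i\<in>Obj J. g \<cdot>\<^bsub>Ab\<^esub> c i = d i)"
    show "g = abhom L M h"
    proof (rule Ab_eqI[OF _ H])
      show "g \<in> Hom Ab L M" using g by blast
      fix y assume y: "y \<in> carrier L"
      then obtain i x where i: "i \<in> Obj J" "x \<in> carrier (FO G i)" "map_of_ab (c i) x = y"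
        using ex unfolding exhausted_def by blast
      have "map_of_ab g y = map_of_ab (g \<cdot>\<^bsub>Ab\<^esub> c i) x" using map_Comp_Ab[OF c[OF i(1)] i(2)] i(3) by simp
      also have "\<dots> = h y" using g i(1) h_at[OF i(1,2)] i(3) by simp
      finally show "map_of_ab g y = map_of_ab (abhom L M h) y" using y by simp
    qed
  qed
qed


section \<open>Functors to abelian groups\<close>

abbreviation Fun where "Fun K \<equiv> additive_functor_category K Ab"

abbreviation act where "act F f \<equiv> map_of_ab (FA F f)"

abbreviation app where "app \<tau> X \<equiv> map_of_ab (components \<tau> X)"

lemma Obj_Fun: "F \<in> Obj (Fun K) \<longleftrightarrow> additive_functor K Ab F"
  by (simp add: additive_functor_category_def)

definition transform ::
  "('o, 'a, 'x) category_scheme \<Rightarrow> ('o, 'a, 'u monoid, 'u ab_hom) func \<Rightarrow>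
   ('o, 'a, 'u monoid, 'u ab_hom) func \<Rightarrow> ('o \<Rightarrow> 'u \<Rightarrow> 'u) \<Rightarrow> ('o, 'a, 'u monoid, 'u ab_hom) transf"
  where "transform K F G t = (F, G, \<lambda>X\<in>Obj K. abhom (FO F X) (FO G X) (t X))"

definition zero_trans where
  "zero_trans K F G = transform K F G (\<lambda>X _. \<one>\<^bsub>FO G X\<^esub>)"

context preadditive_category
begin

lemma Hom_Add:
  assumes "f \<in> Hom C X Y" "g \<in> Hom C X Y"
  shows "f \<^bold>+ g \<in> Hom C X Y"
proof -
  interpret comm_group "hom_group C X Y" by (rule hom_comm_group[OF Hom_Obj[OF assms(1)]])
  show ?thesis using m_closed assms by (simp add: hom_group_def)
qed

lemma functor_Obj_Ab: "additive_functor C Ab F \<Longrightarrow> X \<in> Obj C \<Longrightarrow> FO F X \<in> Obj Ab"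
  by (simp add: additive_functor_def is_functor_def)

lemma functor_comm_group: "additive_functor C Ab F \<Longrightarrow> X \<in> Obj C \<Longrightarrow> comm_group (FO F X)"
  using functor_Obj_Ab by (auto simp: Obj_Ab)

lemma functor_Hom_Ab:
  "additive_functor C Ab F \<Longrightarrow> f \<in> Hom C X Y \<Longrightarrow> FA F f \<in> Hom Ab (FO F X) (FO F Y)"
  unfolding additive_functor_def by (blast intro: is_functor_Hom[OF _ category_axioms])

lemma act_Ident:
  assumes "additive_functor C Ab F" "X \<in> Obj C" "x \<in> carrier (FO F X)"
  shows "act F (Ident C X) x = x"
  using assms by (simp add: additive_functor_def is_functor_def map_Ident_Ab)

lemma act_Comp:
  assumes "additive_functor C Ab F" "f \<in> Hom C X Y" "g \<in> Hom C Y Z" "x \<in> carrier (FO F X)"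
  shows "act F (g \<cdot> f) x = act F g (act F f x)"
  using is_functor_Comp[OF _ category_axioms assms(2,3)] map_Comp_Ab[OF functor_Hom_Ab[OF assms(1,2)] assms(4)]
    assms(1) unfolding additive_functor_def by metis

lemma act_closed:
  assumes "additive_functor C Ab F" "f \<in> Hom C X Y" "x \<in> carrier (FO F X)"
  shows "act F f x \<in> carrier (FO F Y)"
  using map_closed[OF functor_Hom_Ab[OF assms(1,2)] assms(3)] .

lemma act_Add:
  assumes F: "additive_functor C Ab F" and f: "f \<in> Hom C X Y" and g: "g \<in> Hom C X Y" and x: "x \<in> carrier (FO F X)"
  shows "act F (f \<^bold>+ g) x = act F f x \<otimes>\<^bsub>FO F Y\<^esub> act F g x"
proof -
  have "FA F (f \<^bold>+ g) = FA F f \<^bold>+\<^bsub>Ab\<^esub> FA F g"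
    using F f g Hom_Obj[OF f] unfolding additive_functor_def by blast
  then show ?thesis using map_Add_Ab[OF functor_Hom_Ab[OF F f] functor_Hom_Ab[OF F g] x] by simp
qed

lemma additive_functor_AbI:
  assumes obj: "\<And>X. X \<in> Obj C \<Longrightarrow> FO F X \<in> Obj Ab"
    and hom: "\<And>f X Y. f \<in> Hom C X Y \<Longrightarrow> FA F f \<in> Hom Ab (FO F X) (FO F Y)"
    and id: "\<And>X x. X \<in> Obj C \<Longrightarrow> x \<in> carrier (FO F X) \<Longrightarrow> act F (Ident C X) x = x"
    and comp: "\<And>f g X Y Z x. f \<in> Hom C X Y \<Longrightarrow> g \<in> Hom C Y Z \<Longrightarrow> x \<in> carrier (FO F X) \<Longrightarrow>
       act F (g \<cdot> f) x = act F g (act F f x)"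
    and add: "\<And>f g X Y x. f \<in> Hom C X Y \<Longrightarrow> g \<in> Hom C X Y \<Longrightarrow> x \<in> carrier (FO F X) \<Longrightarrow>
       act F (f \<^bold>+ g) x = act F f x \<otimes>\<^bsub>FO F Y\<^esub> act F g x"
  shows "additive_functor C Ab F"
  unfolding additive_functor_def is_functor_def
proof (intro conjI ballI obj hom)
  fix X assume X: "X \<in> Obj C"
  show "FA F (Ident C X) = Ident Ab (FO F X)"
    by (rule Ab_eqI[OF hom[OF Ident_in_Hom[OF X]] Ident_Ab_closed[OF obj[OF X]]])
      (simp add: id[OF X] map_Ident_Ab)
next
  fix X Y Z f g assume f: "f \<in> Hom C X Y" and g: "g \<in> Hom C Y Z"
  show "FA F (g \<cdot> f) = FA F g \<cdot>\<^bsub>Ab\<^esub> FA F f"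
    by (rule Ab_eqI[OF hom[OF Comp_in_Hom[OF f g]] Comp_Ab_closed[OF hom[OF f] hom[OF g]]])
      (simp add: map_Comp_Ab[OF hom[OF f]] comp[OF f g])
next
  fix X Y f g assume f: "f \<in> Hom C X Y" and g: "g \<in> Hom C X Y"
  have s: "FA F f \<^bold>+\<^bsub>Ab\<^esub> FA F g = abhom (FO F X) (FO F Y) (\<lambda>x. act F f x \<otimes>\<^bsub>FO F Y\<^esub> act F g x)"
    using hom[OF f] hom[OF g] by (auto simp: Hom_def Ab_def abhom_def map_of_ab_def)
  have "FA F (f \<^bold>+ g) = abhom (FO F X) (FO F Y) (act F (f \<^bold>+ g))"
    using Hom_AbD(4)[OF hom[OF Hom_Add[OF f g]]] .
  also have "\<dots> = FA F f \<^bold>+\<^bsub>Ab\<^esub> FA F g"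
    unfolding s abhom_def using add[OF f g] by (simp cong: restrict_cong)
  finally show "FA F (f \<^bold>+ g) = FA F f \<^bold>+\<^bsub>Ab\<^esub> FA F g" .
qed auto

lemma Hom_FunD:
  assumes "\<tau> \<in> Hom (Fun C) F G"
  shows "additive_functor C Ab F" "additive_functor C Ab G"
    "X \<in> Obj C \<Longrightarrow> components \<tau> X \<in> Hom Ab (FO F X) (FO G X)"
    "\<tau> = (F, G, components \<tau>)" "components \<tau> \<in> extensional (Obj C)"
    "nat_trans C Ab F G (components \<tau>)"
  using assms by (auto simp: Hom_def additive_functor_category_def components_def nat_trans_def)

lemma app_closed:
  "\<tau> \<in> Hom (Fun C) F G \<Longrightarrow> X \<in> Obj C \<Longrightarrow> x \<in> carrier (FO F X) \<Longrightarrow> app \<tau> X x \<in> carrier (FO G X)"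
  by (rule map_closed[OF Hom_FunD(3)])

lemma app_mult:
  "\<tau> \<in> Hom (Fun C) F G \<Longrightarrow> X \<in> Obj C \<Longrightarrow> x \<in> carrier (FO F X) \<Longrightarrow> y \<in> carrier (FO F X) \<Longrightarrow>
   app \<tau> X (x \<otimes>\<^bsub>FO F X\<^esub> y) = app \<tau> X x \<otimes>\<^bsub>FO G X\<^esub> app \<tau> X y"
  by (rule map_mult[OF Hom_FunD(3)])

lemma app_one:
  "\<tau> \<in> Hom (Fun C) F G \<Longrightarrow> X \<in> Obj C \<Longrightarrow> app \<tau> X \<one>\<^bsub>FO F X\<^esub> = \<one>\<^bsub>FO G X\<^esub>"
  by (rule map_one[OF Hom_FunD(3)])

lemma app_hom:
  "\<tau> \<in> Hom (Fun C) F G \<Longrightarrow> X \<in> Obj C \<Longrightarrow> app \<tau> X \<in> hom (FO F X) (FO G X)"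
  by (rule Hom_AbD(3)[OF Hom_FunD(3)])

lemma app_natural:
  assumes t: "\<tau> \<in> Hom (Fun C) F G" and f: "f \<in> Hom C X Y" and x: "x \<in> carrier (FO F X)"
  shows "app \<tau> Y (act F f x) = act G f (app \<tau> X x)"
proof -
  note o = Hom_Obj[OF f]
  have "components \<tau> Y \<cdot>\<^bsub>Ab\<^esub> FA F f = FA G f \<cdot>\<^bsub>Ab\<^esub> components \<tau> X"
    using Hom_FunD(6)[OF t] f o unfolding nat_trans_def by blast
  then show ?thesis
    using map_Comp_Ab[OF functor_Hom_Ab[OF Hom_FunD(1)[OF t] f] x]
      map_Comp_Ab[OF Hom_FunD(3)[OF t o(1)] x] by metis
qed

lemma Fun_eqI:
  assumes s: "\<sigma> \<in> Hom (Fun C) F G" and t: "\<tau> \<in> Hom (Fun C) F G"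
    and eq: "\<And>X x. X \<in> Obj C \<Longrightarrow> x \<in> carrier (FO F X) \<Longrightarrow> app \<sigma> X x = app \<tau> X x"
  shows "\<sigma> = \<tau>"
proof -
  have "components \<sigma> = components \<tau>"
  proof (rule extensionalityI[OF Hom_FunD(5)[OF s] Hom_FunD(5)[OF t]])
    fix X assume X: "X \<in> Obj C"
    show "components \<sigma> X = components \<tau> X"
      by (rule Ab_eqI[OF Hom_FunD(3)[OF s X] Hom_FunD(3)[OF t X]]) (rule eq[OF X])
  qed
  then show ?thesis using Hom_FunD(4)[OF s] Hom_FunD(4)[OF t] by simp
qed

lemma components_transform: "X \<in> Obj C \<Longrightarrow> components (transform C F G t) X = abhom (FO F X) (FO G X) (t X)"
  by (simp add: transform_def components_def)

lemma app_transform: "X \<in> Obj C \<Longrightarrow> x \<in> carrier (FO F X) \<Longrightarrow> app (transform C F G t) X x = t X x"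
  by (simp add: components_transform)

lemma transform_Hom:
  assumes F: "additive_functor C Ab F" and G: "additive_functor C Ab G"
    and hom: "\<And>X. X \<in> Obj C \<Longrightarrow> t X \<in> hom (FO F X) (FO G X)"
    and nat: "\<And>X Y f x. f \<in> Hom C X Y \<Longrightarrow> x \<in> carrier (FO F X) \<Longrightarrow> t Y (act F f x) = act G f (t X x)"
  shows "transform C F G t \<in> Hom (Fun C) F G"
proof -
  have comp: "abhom (FO F X) (FO G X) (t X) \<in> Hom Ab (FO F X) (FO G X)" if "X \<in> Obj C" for X
    by (intro Hom_AbI functor_Obj_Ab[OF F] functor_Obj_Ab[OF G] hom that)
  have "abhom (FO F Y) (FO G Y) (t Y) \<cdot>\<^bsub>Ab\<^esub> FA F f = FA G f \<cdot>\<^bsub>Ab\<^esub> abhom (FO F X) (FO G X) (t X)"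
    if f: "f \<in> Hom C X Y" for X Y f
  proof (rule Ab_eqI[OF Comp_Ab_closed[OF functor_Hom_Ab[OF F f] comp] Comp_Ab_closed[OF comp functor_Hom_Ab[OF G f]]])
    note o = Hom_Obj[OF f]
    show "Y \<in> Obj C" "X \<in> Obj C" by fact+
    fix x assume x: "x \<in> carrier (FO F X)"
    show "map_of_ab (abhom (FO F Y) (FO G Y) (t Y) \<cdot>\<^bsub>Ab\<^esub> FA F f) x =
          map_of_ab (FA G f \<cdot>\<^bsub>Ab\<^esub> abhom (FO F X) (FO G X) (t X)) x"
      unfolding map_Comp_Ab[OF functor_Hom_Ab[OF F f] x] map_Comp_Ab[OF comp[OF o(1)] x]
      using x act_closed[OF F f x] nat[OF f x] by simp
  qed
  then have "nat_trans C Ab F G (\<lambda>X\<in>Obj C. abhom (FO F X) (FO G X) (t X))"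
    unfolding nat_trans_def using comp by auto
  then show ?thesis using F G
    by (simp add: transform_def Hom_def additive_functor_category_def)
qed

lemma components_Comp:
  assumes "\<sigma> \<in> Hom (Fun C) F G" "\<tau> \<in> Hom (Fun C) G H" "X \<in> Obj C"
  shows "components (\<tau> \<cdot>\<^bsub>Fun C\<^esub> \<sigma>) X = components \<tau> X \<cdot>\<^bsub>Ab\<^esub> components \<sigma> X"
  using assms by (auto simp: Hom_def additive_functor_category_def components_def)

lemma app_Comp:
  assumes "\<sigma> \<in> Hom (Fun C) F G" "\<tau> \<in> Hom (Fun C) G H" "X \<in> Obj C" "x \<in> carrier (FO F X)"
  shows "app (\<tau> \<cdot>\<^bsub>Fun C\<^esub> \<sigma>) X x = app \<tau> X (app \<sigma> X x)"
  unfolding components_Comp[OF assms(1-3)] by (rule map_Comp_Ab[OF Hom_FunD(3)[OF assms(1,3)] assms(4)])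

lemma Comp_Fun_closed:
  assumes s: "\<sigma> \<in> Hom (Fun C) F G" and t: "\<tau> \<in> Hom (Fun C) G H"
  shows "\<tau> \<cdot>\<^bsub>Fun C\<^esub> \<sigma> \<in> Hom (Fun C) F H"
proof -
  have "\<tau> \<cdot>\<^bsub>Fun C\<^esub> \<sigma> = (F, H, \<lambda>X\<in>Obj C. components \<tau> X \<cdot>\<^bsub>Ab\<^esub> components \<sigma> X)"
    using s t by (auto simp: Hom_def additive_functor_category_def components_def)
  also have "\<dots> = transform C F H (\<lambda>X x. app \<tau> X (app \<sigma> X x))"
    unfolding transform_def
  proof (intro arg_cong[of _ _ "\<lambda>z. (F, H, z)"] restrict_ext)
    fix X assume X: "X \<in> Obj C"
    note sX = Hom_FunD(3)[OF s X] and tX = Hom_FunD(3)[OF t X]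
    have "components \<tau> X \<cdot>\<^bsub>Ab\<^esub> components \<sigma> X = abhom (FO F X) (FO H X) (map_of_ab (components \<tau> X \<cdot>\<^bsub>Ab\<^esub> components \<sigma> X))"
      by (rule Hom_AbD(4)[OF Comp_Ab_closed[OF sX tX]])
    also have "\<dots> = abhom (FO F X) (FO H X) (\<lambda>x. app \<tau> X (app \<sigma> X x))"
      unfolding abhom_def using map_Comp_Ab[OF sX, of _ "components \<tau> X"] by (simp cong: restrict_cong)
    finally show "components \<tau> X \<cdot>\<^bsub>Ab\<^esub> components \<sigma> X = abhom (FO F X) (FO H X) (\<lambda>x. app \<tau> X (app \<sigma> X x))" .
  qed
  also have "\<dots> \<in> Hom (Fun C) F H"
  proof (rule transform_Hom[OF Hom_FunD(1)[OF s] Hom_FunD(2)[OF t]])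
    fix X assume X: "X \<in> Obj C"
    show "(\<lambda>x. app \<tau> X (app \<sigma> X x)) \<in> hom (FO F X) (FO H X)"
      using Group.hom_compose[OF app_hom[OF s X] app_hom[OF t X]] by (simp add: comp_def)
  next
    fix X Y f x assume f: "f \<in> Hom C X Y" and x: "x \<in> carrier (FO F X)"
    show "app \<tau> Y (app \<sigma> Y (act F f x)) = act H f (app \<tau> X (app \<sigma> X x))"
      unfolding app_natural[OF s f x] by (rule app_natural[OF t f app_closed[OF s Hom_Obj(1)[OF f] x]])
  qed
  finally show ?thesis .
qed

lemma Ident_Fun: "Ident (Fun C) F = transform C F F (\<lambda>X x. x)"
  by (auto simp: additive_functor_category_def transform_def Ab_def abhom_def)

lemma Ident_Fun_closed: "additive_functor C Ab F \<Longrightarrow> Ident (Fun C) F \<in> Hom (Fun C) F F"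
  unfolding Ident_Fun by (rule transform_Hom) (auto simp: hom_def)

lemma app_Ident: "X \<in> Obj C \<Longrightarrow> x \<in> carrier (FO F X) \<Longrightarrow> app (Ident (Fun C) F) X x = x"
  by (simp add: Ident_Fun app_transform)

lemma category_Fun: "category (Fun C)"
proof
  show "Dom (Fun C) f \<in> Obj (Fun C)" if "f \<in> Arr (Fun C)" for f
    using that by (auto simp: additive_functor_category_def)
  show "Cod (Fun C) f \<in> Obj (Fun C)" if "f \<in> Arr (Fun C)" for f
    using that by (auto simp: additive_functor_category_def)
  show "Ident (Fun C) A \<in> Hom (Fun C) A A" if "A \<in> Obj (Fun C)" for A
    using that Ident_Fun_closed by (simp add: Obj_Fun)
  show "g \<cdot>\<^bsub>Fun C\<^esub> f \<in> Hom (Fun C) X Z" if "f \<in> Hom (Fun C) X Y" "g \<in> Hom (Fun C) Y Z" for f g X Y Z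
    using Comp_Fun_closed that .
  show "f \<cdot>\<^bsub>Fun C\<^esub> Ident (Fun C) X = f" if f: "f \<in> Hom (Fun C) X Y" for f X Y
  proof -
    note i = Ident_Fun_closed[OF Hom_FunD(1)[OF f]]
    show ?thesis by (rule Fun_eqI[OF Comp_Fun_closed[OF i f] f]) (simp add: app_Comp[OF i f] app_Ident)
  qed
  show "Ident (Fun C) Y \<cdot>\<^bsub>Fun C\<^esub> f = f" if f: "f \<in> Hom (Fun C) X Y" for f X Y
  proof -
    note i = Ident_Fun_closed[OF Hom_FunD(2)[OF f]]
    show ?thesis by (rule Fun_eqI[OF Comp_Fun_closed[OF f i] f])
      (simp add: app_Comp[OF f i] app_Ident app_closed[OF f])
  qed
  show "(h \<cdot>\<^bsub>Fun C\<^esub> g) \<cdot>\<^bsub>Fun C\<^esub> f = h \<cdot>\<^bsub>Fun C\<^esub> (g \<cdot>\<^bsub>Fun C\<^esub> f)"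
    if f: "f \<in> Hom (Fun C) W X" and g: "g \<in> Hom (Fun C) X Y" and h: "h \<in> Hom (Fun C) Y Z"
    for f g h W X Y Z
    by (rule Fun_eqI[OF Comp_Fun_closed[OF f Comp_Fun_closed[OF g h]] Comp_Fun_closed[OF Comp_Fun_closed[OF f g] h]])
      (simp add: app_Comp[OF f Comp_Fun_closed[OF g h]] app_Comp[OF f g] app_Comp[OF g h]
        app_Comp[OF Comp_Fun_closed[OF f g] h] app_closed[OF f])
qed

lemma zero_trans_Hom:
  assumes F: "additive_functor C Ab F" and G: "additive_functor C Ab G"
  shows "zero_trans C F G \<in> Hom (Fun C) F G"
  unfolding zero_trans_def
proof (rule transform_Hom[OF F G])
  show "(\<lambda>_. \<one>\<^bsub>FO G X\<^esub>) \<in> hom (FO F X) (FO G X)" if "X \<in> Obj C" for X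
    by (intro trivial_hom functor_comm_group F G that)
  show "\<one>\<^bsub>FO G Y\<^esub> = act G f \<one>\<^bsub>FO G X\<^esub>" if "f \<in> Hom C X Y" for X Y f
    using map_one[OF functor_Hom_Ab[OF G that]] by simp
qed

lemma app_zero_trans: "X \<in> Obj C \<Longrightarrow> x \<in> carrier (FO F X) \<Longrightarrow> app (zero_trans C F G) X x = \<one>\<^bsub>FO G X\<^esub>"
  by (simp add: zero_trans_def app_transform)

lemma app_Add:
  assumes s: "\<sigma> \<in> Hom (Fun C) F G" and t: "\<tau> \<in> Hom (Fun C) F G" and X: "X \<in> Obj C" and x: "x \<in> carrier (FO F X)"
  shows "app (\<sigma> \<^bold>+\<^bsub>Fun C\<^esub> \<tau>) X x = app \<sigma> X x \<otimes>\<^bsub>FO G X\<^esub> app \<tau> X x"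
proof -
  have "components (\<sigma> \<^bold>+\<^bsub>Fun C\<^esub> \<tau>) X = components \<sigma> X \<^bold>+\<^bsub>Ab\<^esub> components \<tau> X"
    using s t X by (auto simp: Hom_def additive_functor_category_def components_def)
  then show ?thesis using map_Add_Ab[OF Hom_FunD(3)[OF s X] Hom_FunD(3)[OF t X] x] by simp
qed

lemma zero_trans_Add:
  assumes F: "additive_functor C Ab F" and G: "additive_functor C Ab G"
  shows "zero_trans C F G \<^bold>+\<^bsub>Fun C\<^esub> zero_trans C F G = zero_trans C F G"
proof -
  have "\<one>\<^bsub>FO G X\<^esub> \<otimes>\<^bsub>FO G X\<^esub> \<one>\<^bsub>FO G X\<^esub> = \<one>\<^bsub>FO G X\<^esub>" if "X \<in> Obj C" for X
    using functor_comm_group[OF G that]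
    by (simp add: comm_group_def group_def monoid.l_one monoid.one_closed)
  then show ?thesis
    by (auto simp: zero_trans_def transform_def additive_functor_category_def Ab_def abhom_def
        intro!: restrict_ext)
qed

text \<open>
  Since \<open>0 + 0 = 0\<close>, anything additive sends zero to a transformation \<open>\<sigma>\<close> with \<open>\<sigma> + \<sigma> = \<sigma>\<close>.
\<close>

lemma app_idempotent_Add:
  assumes s: "\<sigma> \<in> Hom (Fun C) F G" and eq: "\<sigma> \<^bold>+\<^bsub>Fun C\<^esub> \<sigma> = \<sigma>"
  shows "\<sigma> = zero_trans C F G"
proof (rule Fun_eqI[OF s zero_trans_Hom[OF Hom_FunD(1,2)[OF s]]])
  fix X x assume X: "X \<in> Obj C" and x: "x \<in> carrier (FO F X)"
  interpret G: comm_group "FO G X" by (rule functor_comm_group[OF Hom_FunD(2)[OF s] X])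
  have "app \<sigma> X x \<otimes>\<^bsub>FO G X\<^esub> app \<sigma> X x = app \<sigma> X x" using app_Add[OF s s X x] eq by simp
  then show "app \<sigma> X x = app (zero_trans C F G) X x"
    using app_closed[OF s X x] X x by (simp add: app_zero_trans G.r_cancel_one')
qed

end

section \<open>Quotient functors\<close>

text \<open>
  An arrow acts on an element of the quotient through any preimage in \<open>F\<close>; the result depends
  only on the element when the subgroups \<open>N\<close> are stable under the action.
\<close>

definition quot_functor :: "('o, 'a, 'x) category_scheme \<Rightarrow> ('o, 'a, 'u monoid, 'u ab_hom) func \<Rightarrow>
    ('o \<Rightarrow> 'u set) \<Rightarrow> ('o, 'a, 'u monoid, 'u ab_hom) func" where
  "quot_functor K F N =
    \<lparr>FO = (\<lambda>X. quot (FO F X) (N X)),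
     FA = (\<lambda>f. abhom (quot (FO F (Dom K f)) (N (Dom K f))) (quot (FO F (Cod K f)) (N (Cod K f)))
            (\<lambda>z. coset_rep (FO F (Cod K f)) (N (Cod K f))
                   (act F f (SOME x. x \<in> carrier (FO F (Dom K f)) \<and>
                                     coset_rep (FO F (Dom K f)) (N (Dom K f)) x = z))))\<rparr>"

definition quot_proj where
  "quot_proj K F N = transform K F (quot_functor K F N) (\<lambda>X. coset_rep (FO F X) (N X))"

locale subfunctor = preadditive_category C
  for C :: "('o, 'a, 'x) ab_category_scheme" (structure)
    and F :: "('o, 'a, 'u monoid, 'u ab_hom) func" and N :: "'o \<Rightarrow> 'u set" +
  assumes F: "additive_functor C Ab F"
    and N: "X \<in> Obj C \<Longrightarrow> subgroup (N X) (FO F X)"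
    and act_N: "f \<in> Hom C X Y \<Longrightarrow> x \<in> N X \<Longrightarrow> act F f x \<in> N Y"
begin

lemma act_coset:
  assumes f: "f \<in> Hom C X Y" and x: "x \<in> carrier (FO F X)"
  shows "act (quot_functor C F N) f (coset_rep (FO F X) (N X) x) = coset_rep (FO F Y) (N Y) (act F f x)"
proof -
  note o = Hom_Obj[OF f]
  have dc: "Dom C f = X" "Cod C f = Y" using f by (auto simp: Hom_def)
  note G = functor_comm_group[OF F o(1)] and H = functor_comm_group[OF F o(2)]
  interpret G: comm_group "FO F X" by fact
  define x' where "x' = (SOME x'. x' \<in> carrier (FO F X) \<and> coset_rep (FO F X) (N X) x' = coset_rep (FO F X) (N X) x)"
  have x': "x' \<in> carrier (FO F X)" "coset_rep (FO F X) (N X) x' = coset_rep (FO F X) (N X) x"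
    using someI_ex[of "\<lambda>x'. x' \<in> carrier (FO F X) \<and> coset_rep (FO F X) (N X) x' = coset_rep (FO F X) (N X) x"] x
    unfolding x'_def by blast+
  have "act (quot_functor C F N) f (coset_rep (FO F X) (N X) x) = coset_rep (FO F Y) (N Y) (act F f x')"
    using x unfolding quot_functor_def x'_def by (simp add: dc carrier_quot)
  also have "\<dots> = coset_rep (FO F Y) (N Y) (act F f x)"
  proof -
    interpret h: group_hom "FO F X" "FO F Y" "act F f"
      using functor_Hom_Ab[OF F f] by (simp add: group_hom_def group_hom_axioms_def Hom_AbD)
    have "x' \<otimes>\<^bsub>FO F X\<^esub> inv\<^bsub>FO F X\<^esub> x \<in> N X" using coset_rep_eq[OF G N[OF o(1)] x'(1) x] x'(2) by simp
    then have "act F f (x' \<otimes>\<^bsub>FO F X\<^esub> inv\<^bsub>FO F X\<^esub> x) \<in> N Y" by (rule act_N[OF f])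
    then have "act F f x' \<otimes>\<^bsub>FO F Y\<^esub> inv\<^bsub>FO F Y\<^esub> act F f x \<in> N Y" using x x' by simp
    then show ?thesis using coset_rep_eq[OF H N[OF o(2)] act_closed[OF F f x'(1)] act_closed[OF F f x]] by simp
  qed
  finally show ?thesis .
qed

lemma quot_functor_additive: "additive_functor C Ab (quot_functor C F N)"
proof (rule additive_functor_AbI)
  let ?Q = "quot_functor C F N"
  have QO: "FO ?Q X = quot (FO F X) (N X)" for X by (simp add: quot_functor_def)
  show obj: "FO ?Q X \<in> Obj Ab" if X: "X \<in> Obj C" for X
    unfolding QO by (rule quot_Obj_Ab[OF functor_Obj_Ab[OF F X] N[OF X]])
  have rep: "\<exists>x\<in>carrier (FO F X). z = coset_rep (FO F X) (N X) x" if "z \<in> carrier (FO ?Q X)" for X z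
    using that unfolding QO carrier_quot by blast
  show "FA ?Q f \<in> Hom Ab (FO ?Q X) (FO ?Q Y)" if f: "f \<in> Hom C X Y" for f X Y
  proof -
    note o = Hom_Obj[OF f]
    have dc: "Dom C f = X" "Cod C f = Y" using f by (auto simp: Hom_def)
    have "FA ?Q f = abhom (FO ?Q X) (FO ?Q Y) (act ?Q f)"
      by (auto simp: quot_functor_def dc abhom_def map_of_ab_def)
    moreover have "act ?Q f \<in> hom (FO ?Q X) (FO ?Q Y)"
    proof (rule homI)
      fix z assume "z \<in> carrier (FO ?Q X)"
      then obtain x where x: "x \<in> carrier (FO F X)" "z = coset_rep (FO F X) (N X) x" using rep by blast
      then show "act ?Q f z \<in> carrier (FO ?Q Y)"
        using act_coset[OF f x(1)] act_closed[OF F f x(1)] unfolding QO carrier_quot by simp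
    next
      fix z w assume "z \<in> carrier (FO ?Q X)" "w \<in> carrier (FO ?Q X)"
      then obtain x y where x: "x \<in> carrier (FO F X)" "z = coset_rep (FO F X) (N X) x"
        and y: "y \<in> carrier (FO F X)" "w = coset_rep (FO F X) (N X) y" using rep by blast
      interpret G: comm_group "FO F X" by (rule functor_comm_group[OF F o(1)])
      note hX = quot_group(2)[OF functor_comm_group[OF F o(1)] N[OF o(1)]]
      note hY = quot_group(2)[OF functor_comm_group[OF F o(2)] N[OF o(2)]]
      have "z \<otimes>\<^bsub>FO ?Q X\<^esub> w = coset_rep (FO F X) (N X) (x \<otimes>\<^bsub>FO F X\<^esub> y)"
        unfolding QO x(2) y(2) using hom_mult[OF hX x(1) y(1)] by simp
      then have "act ?Q f (z \<otimes>\<^bsub>FO ?Q X\<^esub> w) = coset_rep (FO F Y) (N Y) (act F f (x \<otimes>\<^bsub>FO F X\<^esub> y))"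
        using act_coset[OF f] x y by simp
      also have "\<dots> = coset_rep (FO F Y) (N Y) (act F f x \<otimes>\<^bsub>FO F Y\<^esub> act F f y)"
        using map_mult[OF functor_Hom_Ab[OF F f] x(1) y(1)] by simp
      also have "\<dots> = act ?Q f z \<otimes>\<^bsub>FO ?Q Y\<^esub> act ?Q f w"
        unfolding QO x(2) y(2) act_coset[OF f x(1)] act_coset[OF f y(1)]
        by (rule hom_mult[OF hY act_closed[OF F f x(1)] act_closed[OF F f y(1)]])
      finally show "act ?Q f (z \<otimes>\<^bsub>FO ?Q X\<^esub> w) = act ?Q f z \<otimes>\<^bsub>FO ?Q Y\<^esub> act ?Q f w" .
    qed
    ultimately show ?thesis using Hom_AbI[OF obj[OF o(1)] obj[OF o(2)]] by metis
  qed
  show "act ?Q (Ident C X) z = z" if X: "X \<in> Obj C" and z: "z \<in> carrier (FO ?Q X)" for X z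
  proof -
    obtain x where x: "x \<in> carrier (FO F X)" "z = coset_rep (FO F X) (N X) x" using rep[OF z] by blast
    then show ?thesis using act_coset[OF Ident_in_Hom[OF X] x(1)] act_Ident[OF F X x(1)] by simp
  qed
  show "act ?Q (g \<cdot> f) z = act ?Q g (act ?Q f z)"
    if f: "f \<in> Hom C X Y" and g: "g \<in> Hom C Y Z" and z: "z \<in> carrier (FO ?Q X)" for f g X Y Z z
  proof -
    obtain x where x: "x \<in> carrier (FO F X)" "z = coset_rep (FO F X) (N X) x" using rep[OF z] by blast
    then show ?thesis
      using act_coset[OF f x(1)] act_coset[OF g act_closed[OF F f x(1)]] act_coset[OF Comp_in_Hom[OF f g] x(1)]
        act_Comp[OF F f g x(1)] by simp
  qed
  show "act ?Q (f \<^bold>+ g) z = act ?Q f z \<otimes>\<^bsub>FO ?Q Y\<^esub> act ?Q g z"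
    if f: "f \<in> Hom C X Y" and g: "g \<in> Hom C X Y" and z: "z \<in> carrier (FO ?Q X)" for f g X Y z
  proof -
    note o = Hom_Obj[OF f]
    obtain x where x: "x \<in> carrier (FO F X)" "z = coset_rep (FO F X) (N X) x" using rep[OF z] by blast
    note hY = quot_group(2)[OF functor_comm_group[OF F o(2)] N[OF o(2)]]
    show ?thesis
      unfolding QO x(2) act_coset[OF f x(1)] act_coset[OF g x(1)] act_coset[OF Hom_Add[OF f g] x(1)] act_Add[OF F f g x(1)]
      using hom_mult[OF hY act_closed[OF F f x(1)] act_closed[OF F g x(1)]] by simp
  qed
qed

lemma quot_proj_Hom: "quot_proj C F N \<in> Hom (Fun C) F (quot_functor C F N)"
  unfolding quot_proj_def
proof (rule transform_Hom[OF F quot_functor_additive])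
  show "coset_rep (FO F X) (N X) \<in> hom (FO F X) (FO (quot_functor C F N) X)" if X: "X \<in> Obj C" for X
    using quot_group(2)[OF functor_comm_group[OF F X] N[OF X]] by (simp add: quot_functor_def)
  show "coset_rep (FO F Y) (N Y) (act F f x) = act (quot_functor C F N) f (coset_rep (FO F X) (N X) x)"
    if "f \<in> Hom C X Y" "x \<in> carrier (FO F X)" for X Y f x
    using act_coset[OF that] by simp
qed

lemma quot_proj_surj:
  assumes X: "X \<in> Obj C"
  shows "app (quot_proj C F N) X ` carrier (FO F X) = carrier (FO (quot_functor C F N) X)"
proof -
  have "app (quot_proj C F N) X ` carrier (FO F X) = coset_rep (FO F X) (N X) ` carrier (FO F X)"
    unfolding quot_proj_def by (intro image_cong refl app_transform[OF X])
  then show ?thesis by (simp add: quot_functor_def carrier_quot)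
qed

lemma quot_proj_one_iff:
  assumes X: "X \<in> Obj C" and x: "x \<in> carrier (FO F X)"
  shows "app (quot_proj C F N) X x = \<one>\<^bsub>FO (quot_functor C F N) X\<^esub> \<longleftrightarrow> x \<in> N X"
  using app_transform[OF X x] coset_rep_one_iff[OF functor_comm_group[OF F X] N[OF X] x]
  unfolding quot_proj_def by (simp add: quot_functor_def)

end


section \<open>Coequalizers and exact sequences of functors\<close>

definition is_coequalizer :: "('o, 'a, 'x) category_scheme \<Rightarrow> 'a \<Rightarrow> 'a \<Rightarrow> 'o \<Rightarrow> 'o \<Rightarrow> 'a \<Rightarrow> bool" where
  "is_coequalizer A \<psi> \<zeta> Q R \<pi> \<longleftrightarrow> \<pi> \<in> Hom A Q R \<and> \<pi> \<cdot>\<^bsub>A\<^esub> \<psi> = \<pi> \<cdot>\<^bsub>A\<^esub> \<zeta> \<and>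
     (\<forall>M d. d \<in> Hom A Q M \<and> d \<cdot>\<^bsub>A\<^esub> \<psi> = d \<cdot>\<^bsub>A\<^esub> \<zeta> \<longrightarrow> (\<exists>!h. h \<in> Hom A R M \<and> h \<cdot>\<^bsub>A\<^esub> \<pi> = d))"

text \<open>
  Two parallel arrows \<open>f1\<close> and \<open>f2\<close> from \<open>o1\<close> to \<open>o2\<close>; the identities are named like the objects.
\<close>

locale parallel_pair =
  fixes o1 o2 f1 f2 :: 'u
  assumes distinct: "distinct [o1, o2, f1, f2]"
begin

definition shape :: "('u, 'u) category" where
  "shape = \<lparr>Obj = {o1, o2}, Arr = {o1, o2, f1, f2}, Dom = (\<lambda>x. if x = o2 then o2 else o1),
            Cod = (\<lambda>x. if x = o1 then o1 else o2), Ident = (\<lambda>x. x),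
            Comp = (\<lambda>g f. if f \<in> {o1, o2} then g else f)\<rparr>"

definition diagram :: "('p, 'b, 'y) category_scheme \<Rightarrow> 'b \<Rightarrow> 'b \<Rightarrow> 'p \<Rightarrow> 'p \<Rightarrow> ('u, 'u, 'p, 'b) func" where
  "diagram A \<psi> \<zeta> P Q =
     \<lparr>FO = (\<lambda>x. if x = o1 then P else Q),
      FA = (\<lambda>x. if x = o1 then Ident A P else if x = o2 then Ident A Q
                else if x = f1 then \<psi> else \<zeta>)\<rparr>"

lemma Hom_shape:
  "Hom shape o1 o1 = {o1}" "Hom shape o2 o2 = {o2}" "Hom shape o1 o2 = {f1, f2}" "Hom shape o2 o1 = {}"
  using distinct by (auto simp: Hom_def shape_def)

lemma Obj_shape: "Obj shape = {o1, o2}"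
  by (simp add: shape_def)

lemma category_shape: "category shape"
  by unfold_locales (use distinct in \<open>auto simp: Hom_def shape_def split: if_splits\<close>)

lemma small_category_shape:
  assumes "universe TYPE('u)"
  shows "small_category shape"
proof -
  have "small A" if "finite A" for A :: "'u set"
    using that universe_infinite[OF assms] unfolding small_def by (simp add: finite_lesspoll_infinite)
  then show ?thesis unfolding small_category_def using category_shape by (simp add: shape_def)
qed

lemma functor_diagram:
  assumes A: "category A" and psi: "\<psi> \<in> Hom A P Q" and zeta: "\<zeta> \<in> Hom A P Q"
  shows "is_functor shape A (diagram A \<psi> \<zeta> P Q)"
proof -
  interpret category A by fact
  note o = Hom_Obj[OF psi]
  have d: "o1 \<noteq> o2" "o1 \<noteq> f1" "o1 \<noteq> f2" "o2 \<noteq> f1" "o2 \<noteq> f2" "f1 \<noteq> f2" using distinct by auto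
  note dne = d d[symmetric]
  let ?D = "diagram A \<psi> \<zeta> P Q"
  have FOD: "FO ?D o1 = P" "FO ?D o2 = Q" using dne by (simp_all add: diagram_def)
  have FAD: "FA ?D o1 = Ident A P" "FA ?D o2 = Ident A Q" "FA ?D f1 = \<psi>" "FA ?D f2 = \<zeta>"
    using dne by (simp_all add: diagram_def)
  have cs: "o1 \<cdot>\<^bsub>shape\<^esub> o1 = o1" "o2 \<cdot>\<^bsub>shape\<^esub> o2 = o2" "f1 \<cdot>\<^bsub>shape\<^esub> o1 = f1" "f2 \<cdot>\<^bsub>shape\<^esub> o1 = f2"
    "o2 \<cdot>\<^bsub>shape\<^esub> f1 = f1" "o2 \<cdot>\<^bsub>shape\<^esub> f2 = f2" "Ident shape o1 = o1" "Ident shape o2 = o2"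
    using dne by (simp_all add: shape_def)
  note facts = psi zeta o Ident_in_Hom[OF o(1)] Ident_in_Hom[OF o(2)]
      Comp_Ident[OF psi] Comp_Ident[OF zeta] Ident_Comp[OF psi] Ident_Comp[OF zeta]
      Ident_Comp[OF Ident_in_Hom[OF o(1)]] Ident_Comp[OF Ident_in_Hom[OF o(2)]]
  show ?thesis
    unfolding is_functor_def Obj_shape
    by (simp only: Hom_shape ball_simps FOD FAD cs facts simp_thms)
qed

lemma cocone_diagram_iff:
  assumes A: "category A" and psi: "\<psi> \<in> Hom A P Q" and zeta: "\<zeta> \<in> Hom A P Q"
  shows "is_cocone shape A (diagram A \<psi> \<zeta> P Q) R c \<longleftrightarrow>
    c o2 \<in> Hom A Q R \<and> c o1 = c o2 \<cdot>\<^bsub>A\<^esub> \<psi> \<and> c o1 = c o2 \<cdot>\<^bsub>A\<^esub> \<zeta>"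
proof -
  interpret category A by fact
  note o = Hom_Obj[OF psi]
  have d: "o1 \<noteq> o2" "o1 \<noteq> f1" "o1 \<noteq> f2" "o2 \<noteq> f1" "o2 \<noteq> f2" "f1 \<noteq> f2" using distinct by auto
  note [simp] = d d[symmetric]
  have 1: "is_cocone shape A (diagram A \<psi> \<zeta> P Q) R c \<longleftrightarrow> R \<in> Obj A \<and> c o1 \<in> Hom A P R \<and> c o2 \<in> Hom A Q R \<and>
    c o1 \<cdot>\<^bsub>A\<^esub> Ident A P = c o1 \<and> c o2 \<cdot>\<^bsub>A\<^esub> Ident A Q = c o2 \<and> c o2 \<cdot>\<^bsub>A\<^esub> \<psi> = c o1 \<and> c o2 \<cdot>\<^bsub>A\<^esub> \<zeta> = c o1"
    unfolding is_cocone_def Obj_shape using functor_diagram[OF assms]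
    by (simp only: Hom_shape ball_simps simp_thms) (auto simp: diagram_def)
  show ?thesis
  proof
    assume "c o2 \<in> Hom A Q R \<and> c o1 = c o2 \<cdot>\<^bsub>A\<^esub> \<psi> \<and> c o1 = c o2 \<cdot>\<^bsub>A\<^esub> \<zeta>"
    then have c: "c o2 \<in> Hom A Q R" "c o1 = c o2 \<cdot>\<^bsub>A\<^esub> \<psi>" "c o1 = c o2 \<cdot>\<^bsub>A\<^esub> \<zeta>" by auto
    have c1: "c o1 \<in> Hom A P R" using Comp_in_Hom[OF psi c(1)] c(2) by simp
    show "is_cocone shape A (diagram A \<psi> \<zeta> P Q) R c"
      unfolding 1 using c c1 Hom_Obj[OF c(1)] Comp_Ident[OF c(1)] Comp_Ident[OF c1] by auto
  qed (use 1 in auto)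
qed

lemma colimit_diagram_iff:
  assumes A: "category A" and psi: "\<psi> \<in> Hom A P Q" and zeta: "\<zeta> \<in> Hom A P Q"
  shows "is_colimit shape A (diagram A \<psi> \<zeta> P Q) R c \<longleftrightarrow>
    is_coequalizer A \<psi> \<zeta> Q R (c o2) \<and> c o1 = c o2 \<cdot>\<^bsub>A\<^esub> \<psi>"
proof -
  interpret category A by fact
  have ne: "o1 \<noteq> o2" using distinct by auto
  have fac: "h \<cdot>\<^bsub>A\<^esub> c o1 = d o1"
    if "c o2 \<in> Hom A Q R" "c o1 = c o2 \<cdot>\<^bsub>A\<^esub> \<psi>" "h \<in> Hom A R M" "h \<cdot>\<^bsub>A\<^esub> c o2 = d o2" "d o1 = d o2 \<cdot>\<^bsub>A\<^esub> \<psi>" for h M d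
    using Comp_assoc[OF psi that(1,3)] that by simp
  show ?thesis
  proof
    assume L: "is_colimit shape A (diagram A \<psi> \<zeta> P Q) R c"
    then have c: "c o2 \<in> Hom A Q R" "c o1 = c o2 \<cdot>\<^bsub>A\<^esub> \<psi>" "c o1 = c o2 \<cdot>\<^bsub>A\<^esub> \<zeta>"
      unfolding is_colimit_def cocone_diagram_iff[OF assms] by auto
    show "is_coequalizer A \<psi> \<zeta> Q R (c o2) \<and> c o1 = c o2 \<cdot>\<^bsub>A\<^esub> \<psi>"
      unfolding is_coequalizer_def
    proof (intro conjI allI impI c)
      show "c o2 \<cdot>\<^bsub>A\<^esub> \<psi> = c o2 \<cdot>\<^bsub>A\<^esub> \<zeta>" using c by simp
      fix M d assume d: "d \<in> Hom A Q M \<and> d \<cdot>\<^bsub>A\<^esub> \<psi> = d \<cdot>\<^bsub>A\<^esub> \<zeta>"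
      define d' where "d' = (\<lambda>x. if x = o2 then d else d \<cdot>\<^bsub>A\<^esub> \<psi>)"
      have d'2: "d' o2 = d" "d' o1 = d \<cdot>\<^bsub>A\<^esub> \<psi>" using ne by (auto simp: d'_def)
      have "is_cocone shape A (diagram A \<psi> \<zeta> P Q) M d'"
        unfolding cocone_diagram_iff[OF assms] d'2 using d by auto
      then have "\<exists>!h. h \<in> Hom A R M \<and> (\<forall>i\<in>Obj shape. h \<cdot>\<^bsub>A\<^esub> c i = d' i)"
        using L unfolding is_colimit_def by blast
      moreover have "h \<in> Hom A R M \<and> (\<forall>i\<in>Obj shape. h \<cdot>\<^bsub>A\<^esub> c i = d' i) \<longleftrightarrow> h \<in> Hom A R M \<and> h \<cdot>\<^bsub>A\<^esub> c o2 = d" for h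
        unfolding Obj_shape using d'2 fac[OF c(1,2), of h M d'] by auto
      ultimately show "\<exists>!h. h \<in> Hom A R M \<and> h \<cdot>\<^bsub>A\<^esub> c o2 = d" by simp
    qed
  next
    assume L: "is_coequalizer A \<psi> \<zeta> Q R (c o2) \<and> c o1 = c o2 \<cdot>\<^bsub>A\<^esub> \<psi>"
    then have c: "c o2 \<in> Hom A Q R" "c o1 = c o2 \<cdot>\<^bsub>A\<^esub> \<psi>" "c o1 = c o2 \<cdot>\<^bsub>A\<^esub> \<zeta>"
      unfolding is_coequalizer_def by auto
    show "is_colimit shape A (diagram A \<psi> \<zeta> P Q) R c"
      unfolding is_colimit_def cocone_diagram_iff[OF assms]
    proof (intro conjI allI impI c)
      fix M d assume d: "d o2 \<in> Hom A Q M \<and> d o1 = d o2 \<cdot>\<^bsub>A\<^esub> \<psi> \<and> d o1 = d o2 \<cdot>\<^bsub>A\<^esub> \<zeta>"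
      have deq: "d o2 \<cdot>\<^bsub>A\<^esub> \<psi> = d o2 \<cdot>\<^bsub>A\<^esub> \<zeta>" using d by metis
      have "\<forall>M d. d \<in> Hom A Q M \<and> d \<cdot>\<^bsub>A\<^esub> \<psi> = d \<cdot>\<^bsub>A\<^esub> \<zeta> \<longrightarrow> (\<exists>!h. h \<in> Hom A R M \<and> h \<cdot>\<^bsub>A\<^esub> c o2 = d)"
        using L unfolding is_coequalizer_def by blast
      then have "\<exists>!h. h \<in> Hom A R M \<and> h \<cdot>\<^bsub>A\<^esub> c o2 = d o2" using deq d by blast
      moreover have "h \<in> Hom A R M \<and> (\<forall>i\<in>Obj shape. h \<cdot>\<^bsub>A\<^esub> c i = d i) \<longleftrightarrow> h \<in> Hom A R M \<and> h \<cdot>\<^bsub>A\<^esub> c o2 = d o2" for h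
        unfolding Obj_shape using d fac[OF c(1,2), of h M d] by auto
      ultimately show "\<exists>!h. h \<in> Hom A R M \<and> (\<forall>i\<in>Obj shape. h \<cdot>\<^bsub>A\<^esub> c i = d i)" by simp
    qed
  qed
qed

lemma functor_coequalizer:
  assumes A: "category A" and B: "category B" and Phi: "is_functor A B \<Phi>"
    and pres: "preserves_colimits_of_shape shape A B \<Phi>"
    and psi: "\<psi> \<in> Hom A P Q" and zeta: "\<zeta> \<in> Hom A P Q" and co: "is_coequalizer A \<psi> \<zeta> Q R \<pi>"
  shows "is_coequalizer B (FA \<Phi> \<psi>) (FA \<Phi> \<zeta>) (FO \<Phi> Q) (FO \<Phi> R) (FA \<Phi> \<pi>)"
proof -
  interpret A: category A by fact
  note o = A.Hom_Obj[OF psi]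
  have ne: "o1 \<noteq> o2" using distinct by auto
  define c where "c = (\<lambda>x. if x = o2 then \<pi> else \<pi> \<cdot>\<^bsub>A\<^esub> \<psi>)"
  have "is_colimit shape A (diagram A \<psi> \<zeta> P Q) R c"
    unfolding colimit_diagram_iff[OF A psi zeta] using co ne by (simp add: c_def)
  then have "is_colimit shape B (comp_functor \<Phi> (diagram A \<psi> \<zeta> P Q)) (FO \<Phi> R) (\<lambda>i. FA \<Phi> (c i))"
    using pres unfolding preserves_colimits_of_shape_def by blast
  moreover have "comp_functor \<Phi> (diagram A \<psi> \<zeta> P Q) = diagram B (FA \<Phi> \<psi>) (FA \<Phi> \<zeta>) (FO \<Phi> P) (FO \<Phi> Q)"
    using Phi o unfolding comp_functor_def diagram_def is_functor_def by auto
  ultimately show ?thesis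
    using colimit_diagram_iff[OF B is_functor_Hom[OF Phi A psi] is_functor_Hom[OF Phi A zeta]]
    by (simp add: c_def)
qed

end

lemma coequalizer_isomorphic:
  assumes A: "category A" and 1: "is_coequalizer A \<psi> \<zeta> Q R \<pi>" and 2: "is_coequalizer A \<psi> \<zeta> Q R' \<pi>'"
  shows "isomorphic A R R'"
proof -
  interpret category A by fact
  have p: "\<pi> \<in> Hom A Q R" "\<pi> \<cdot>\<^bsub>A\<^esub> \<psi> = \<pi> \<cdot>\<^bsub>A\<^esub> \<zeta>" and p': "\<pi>' \<in> Hom A Q R'" "\<pi>' \<cdot>\<^bsub>A\<^esub> \<psi> = \<pi>' \<cdot>\<^bsub>A\<^esub> \<zeta>"
    using 1 2 unfolding is_coequalizer_def by auto
  obtain h where h: "h \<in> Hom A R R'" "h \<cdot>\<^bsub>A\<^esub> \<pi> = \<pi>'" using 1 p' unfolding is_coequalizer_def by metis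
  obtain g where g: "g \<in> Hom A R' R" "g \<cdot>\<^bsub>A\<^esub> \<pi>' = \<pi>" using 2 p unfolding is_coequalizer_def by metis
  have u: "k = k'" if "k \<in> Hom A R R" "k' \<in> Hom A R R" "k \<cdot>\<^bsub>A\<^esub> \<pi> = \<pi>" "k' \<cdot>\<^bsub>A\<^esub> \<pi> = \<pi>" for k k'
    using 1 p that unfolding is_coequalizer_def by blast
  have u': "k = k'" if "k \<in> Hom A R' R'" "k' \<in> Hom A R' R'" "k \<cdot>\<^bsub>A\<^esub> \<pi>' = \<pi>'" "k' \<cdot>\<^bsub>A\<^esub> \<pi>' = \<pi>'" for k k'
    using 2 p' that unfolding is_coequalizer_def by blast
  have "g \<cdot>\<^bsub>A\<^esub> h = Ident A R"
    by (rule u) (use h g p Hom_Obj[OF p(1)] Ident_in_Hom Ident_Comp[OF p(1)] Comp_assoc[OF p(1) h(1) g(1)]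
        Comp_in_Hom[OF h(1) g(1)] in auto)
  moreover have "h \<cdot>\<^bsub>A\<^esub> g = Ident A R'"
    by (rule u') (use h g p' Hom_Obj[OF p'(1)] Ident_in_Hom Ident_Comp[OF p'(1)] Comp_assoc[OF p'(1) g(1) h(1)]
        Comp_in_Hom[OF g(1) h(1)] in auto)
  ultimately show ?thesis unfolding isomorphic_def iso_arrow_def using h g by blast
qed

definition exact where
  "exact K \<psi> \<pi> P Q R \<longleftrightarrow> (\<forall>X\<in>Obj K. app \<pi> X ` carrier (FO Q X) = carrier (FO R X) \<and>
     (\<forall>x\<in>carrier (FO Q X). app \<pi> X x = \<one>\<^bsub>FO R X\<^esub> \<longleftrightarrow> x \<in> app \<psi> X ` carrier (FO P X)))"

context preadditive_category
begin

lemma app_image_subfunctor: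
  assumes s: "\<sigma> \<in> Hom (Fun C) P Q"
  shows "subfunctor C Q (\<lambda>X. app \<sigma> X ` carrier (FO P X))"
proof (intro subfunctor.intro subfunctor_axioms.intro)
  show "preadditive_category C" ..
  show "additive_functor C Ab Q" by (rule Hom_FunD(2)[OF s])
  show "subgroup (app \<sigma> X ` carrier (FO P X)) (FO Q X)" if X: "X \<in> Obj C" for X
  proof -
    interpret group_hom "FO P X" "FO Q X" "app \<sigma> X"
      using Hom_FunD(3)[OF s X] by (simp add: group_hom_def group_hom_axioms_def Hom_AbD)
    show ?thesis by (rule img_is_subgroup)
  qed
  show "act Q f x \<in> app \<sigma> Y ` carrier (FO P Y)" if f: "f \<in> Hom C X Y" and x: "x \<in> app \<sigma> X ` carrier (FO P X)" for f X Y x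
    using x app_natural[OF s f] act_closed[OF Hom_FunD(1)[OF s] f] by force
qed

text \<open>
  A coequalizer of \<open>\<psi>\<close> and zero is epic, hence surjective, since it equalises zero and the
  projection onto the quotient by its image; and its kernel is no larger than the image of
  \<open>\<psi>\<close>, since the projection onto the quotient by this image factors through it.
\<close>

lemma coequalizer_exact:
  assumes psi: "\<psi> \<in> Hom (Fun C) P Q"
    and co: "is_coequalizer (Fun C) \<psi> (zero_trans C P Q) Q R \<pi>"
  shows "exact C \<psi> \<pi> P Q R"
  unfolding exact_def
proof (intro ballI conjI)
  fix X assume X: "X \<in> Obj C"
  have pi: "\<pi> \<in> Hom (Fun C) Q R" and eq: "\<pi> \<cdot>\<^bsub>Fun C\<^esub> \<psi> = \<pi> \<cdot>\<^bsub>Fun C\<^esub> zero_trans C P Q"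
    using co by (auto simp: is_coequalizer_def)
  note P = Hom_FunD(1)[OF psi] and Q = Hom_FunD(1)[OF pi] and R = Hom_FunD(2)[OF pi]
  note z = zero_trans_Hom[OF P Q]
  interpret cat: category "Fun C" by (rule category_Fun)
  interpret I: subfunctor C R "\<lambda>X. app \<pi> X ` carrier (FO Q X)" by (rule app_image_subfunctor[OF pi])
  define S where "S = quot_functor C R (\<lambda>X. app \<pi> X ` carrier (FO Q X))"
  define q where "q = quot_proj C R (\<lambda>X. app \<pi> X ` carrier (FO Q X))"
  have q: "q \<in> Hom (Fun C) R S" unfolding q_def S_def by (rule I.quot_proj_Hom)
  note S = Hom_FunD(2)[OF q]
  have q\<pi>: "q \<cdot>\<^bsub>Fun C\<^esub> \<pi> = zero_trans C Q S"
  proof (rule Fun_eqI[OF Comp_Fun_closed[OF pi q] zero_trans_Hom[OF Q S]])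
    fix X x assume X: "X \<in> Obj C" and x: "x \<in> carrier (FO Q X)"
    show "app (q \<cdot>\<^bsub>Fun C\<^esub> \<pi>) X x = app (zero_trans C Q S) X x"
      unfolding app_Comp[OF pi q X x] app_zero_trans[OF X x]
      unfolding q_def S_def using I.quot_proj_one_iff[OF X app_closed[OF pi X x]] x by simp
  qed
  have z\<pi>: "zero_trans C R S \<cdot>\<^bsub>Fun C\<^esub> \<pi> = zero_trans C Q S"
    by (rule Fun_eqI[OF Comp_Fun_closed[OF pi zero_trans_Hom[OF R S]] zero_trans_Hom[OF Q S]])
      (simp add: app_Comp[OF pi zero_trans_Hom[OF R S]] app_zero_trans app_closed[OF pi])
  have zz: "zero_trans C Q S \<cdot>\<^bsub>Fun C\<^esub> \<psi> = zero_trans C Q S \<cdot>\<^bsub>Fun C\<^esub> zero_trans C P Q"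
    by (rule Fun_eqI[OF Comp_Fun_closed[OF psi zero_trans_Hom[OF Q S]] Comp_Fun_closed[OF z zero_trans_Hom[OF Q S]]])
      (simp add: app_Comp[OF psi zero_trans_Hom[OF Q S]] app_Comp[OF z zero_trans_Hom[OF Q S]]
        app_zero_trans app_closed[OF psi] app_one[OF zero_trans_Hom[OF Q S]])
  have "\<exists>!h. h \<in> Hom (Fun C) R S \<and> h \<cdot>\<^bsub>Fun C\<^esub> \<pi> = zero_trans C Q S"
    using co zero_trans_Hom[OF Q S] zz unfolding is_coequalizer_def by blast
  then have qz: "q = zero_trans C R S" using q q\<pi> z\<pi> zero_trans_Hom[OF R S] by blast
  show "app \<pi> X ` carrier (FO Q X) = carrier (FO R X)"
  proof (intro equalityI subsetI)
    fix y assume y: "y \<in> carrier (FO R X)"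
    have "app q X y = \<one>\<^bsub>FO S X\<^esub>" unfolding qz by (rule app_zero_trans[OF X y])
    then show "y \<in> app \<pi> X ` carrier (FO Q X)" using I.quot_proj_one_iff[OF X y] by (simp add: q_def S_def)
  qed (use app_closed[OF pi X] in blast)
  fix x assume x: "x \<in> carrier (FO Q X)"
  show "app \<pi> X x = \<one>\<^bsub>FO R X\<^esub> \<longleftrightarrow> x \<in> app \<psi> X ` carrier (FO P X)"
  proof
    assume "x \<in> app \<psi> X ` carrier (FO P X)"
    then obtain p where p: "p \<in> carrier (FO P X)" "x = app \<psi> X p" by blast
    have "app \<pi> X x = app (\<pi> \<cdot>\<^bsub>Fun C\<^esub> zero_trans C P Q) X p"
      unfolding p(2) eq[symmetric] app_Comp[OF psi pi X p(1)] ..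
    then show "app \<pi> X x = \<one>\<^bsub>FO R X\<^esub>"
      by (simp add: app_Comp[OF z pi X p(1)] app_zero_trans[OF X p(1)] app_one[OF pi X])
  next
    assume dead: "app \<pi> X x = \<one>\<^bsub>FO R X\<^esub>"
    interpret K: subfunctor C Q "\<lambda>X. app \<psi> X ` carrier (FO P X)" by (rule app_image_subfunctor[OF psi])
    define T where "T = quot_functor C Q (\<lambda>X. app \<psi> X ` carrier (FO P X))"
    define t where "t = quot_proj C Q (\<lambda>X. app \<psi> X ` carrier (FO P X))"
    have t: "t \<in> Hom (Fun C) Q T" unfolding t_def T_def by (rule K.quot_proj_Hom)
    have "t \<cdot>\<^bsub>Fun C\<^esub> \<psi> = t \<cdot>\<^bsub>Fun C\<^esub> zero_trans C P Q"
    proof (rule Fun_eqI[OF Comp_Fun_closed[OF psi t] Comp_Fun_closed[OF z t]])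
      fix X p assume X: "X \<in> Obj C" and p: "p \<in> carrier (FO P X)"
      show "app (t \<cdot>\<^bsub>Fun C\<^esub> \<psi>) X p = app (t \<cdot>\<^bsub>Fun C\<^esub> zero_trans C P Q) X p"
        unfolding app_Comp[OF psi t X p] app_Comp[OF z t X p] app_zero_trans[OF X p] app_one[OF t X]
        using K.quot_proj_one_iff[OF X app_closed[OF psi X p]] p by (simp add: t_def T_def)
    qed
    then obtain h where h: "h \<in> Hom (Fun C) R T" "h \<cdot>\<^bsub>Fun C\<^esub> \<pi> = t"
      using co t unfolding is_coequalizer_def by metis
    have "app t X x = \<one>\<^bsub>FO T X\<^esub>"
      unfolding h(2)[symmetric] app_Comp[OF pi h(1) X x] dead by (rule app_one[OF h(1) X])
    then show "x \<in> app \<psi> X ` carrier (FO P X)" using K.quot_proj_one_iff[OF X x] by (simp add: t_def T_def)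
  qed
qed

text \<open>
  A transformation that kills the image of \<open>\<psi>\<close> is constant on the fibres of the surjection \<open>\<pi>\<close>,
  and so descends along it.
\<close>

lemma exact_coequalizer:
  assumes psi: "\<psi> \<in> Hom (Fun C) P Q" and pi: "\<pi> \<in> Hom (Fun C) Q R" and ex: "exact C \<psi> \<pi> P Q R"
  shows "is_coequalizer (Fun C) \<psi> (zero_trans C P Q) Q R \<pi>"
  unfolding is_coequalizer_def
proof (intro conjI allI impI pi)
  note P = Hom_FunD(1)[OF psi] and Q = Hom_FunD(1)[OF pi] and R = Hom_FunD(2)[OF pi]
  note z = zero_trans_Hom[OF P Q]
  show "\<pi> \<cdot>\<^bsub>Fun C\<^esub> \<psi> = \<pi> \<cdot>\<^bsub>Fun C\<^esub> zero_trans C P Q"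
  proof (rule Fun_eqI[OF Comp_Fun_closed[OF psi pi] Comp_Fun_closed[OF z pi]])
    fix X p assume X: "X \<in> Obj C" and p: "p \<in> carrier (FO P X)"
    show "app (\<pi> \<cdot>\<^bsub>Fun C\<^esub> \<psi>) X p = app (\<pi> \<cdot>\<^bsub>Fun C\<^esub> zero_trans C P Q) X p"
      using ex X p app_closed[OF psi X p] app_one[OF pi X] unfolding exact_def
      by (simp add: app_Comp[OF psi pi X p] app_Comp[OF z pi X p] app_zero_trans[OF X p])
  qed
  fix M d assume "d \<in> Hom (Fun C) Q M \<and> d \<cdot>\<^bsub>Fun C\<^esub> \<psi> = d \<cdot>\<^bsub>Fun C\<^esub> zero_trans C P Q"
  then have d: "d \<in> Hom (Fun C) Q M" and deq: "d \<cdot>\<^bsub>Fun C\<^esub> \<psi> = d \<cdot>\<^bsub>Fun C\<^esub> zero_trans C P Q" by auto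
  note M = Hom_FunD(2)[OF d]
  have dkill: "app d X x = \<one>\<^bsub>FO M X\<^esub>" if X: "X \<in> Obj C" and x: "x \<in> carrier (FO Q X)" and "app \<pi> X x = \<one>\<^bsub>FO R X\<^esub>" for X x
  proof -
    have "x \<in> app \<psi> X ` carrier (FO P X)" using ex that unfolding exact_def by metis
    then obtain p where p: "p \<in> carrier (FO P X)" "x = app \<psi> X p" by blast
    have "app d X x = app (d \<cdot>\<^bsub>Fun C\<^esub> zero_trans C P Q) X p"
      unfolding p(2) deq[symmetric] app_Comp[OF psi d X p(1)] ..
    then show ?thesis by (simp add: app_Comp[OF z d X p(1)] app_zero_trans[OF X p(1)] app_one[OF d X])
  qed
  have wd: "app d X x = app d X y"
    if X: "X \<in> Obj C" and x: "x \<in> carrier (FO Q X)" and y: "y \<in> carrier (FO Q X)" and eq: "app \<pi> X x = app \<pi> X y" for X x y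
  proof -
    interpret G: comm_group "FO Q X" by (rule functor_comm_group[OF Q X])
    have xy: "x \<otimes>\<^bsub>FO Q X\<^esub> inv\<^bsub>FO Q X\<^esub> y \<in> carrier (FO Q X)" using x y by simp
    show ?thesis
      using dkill[OF X xy] map_eq_iff[OF Hom_FunD(3)[OF pi X] x y] map_eq_iff[OF Hom_FunD(3)[OF d X] x y] eq by simp
  qed
  define t where "t = (\<lambda>X y. app d X (SOME x. x \<in> carrier (FO Q X) \<and> app \<pi> X x = y))"
  have t_at: "t X (app \<pi> X x) = app d X x" if X: "X \<in> Obj C" and x: "x \<in> carrier (FO Q X)" for X x
  proof -
    have "(SOME x'. x' \<in> carrier (FO Q X) \<and> app \<pi> X x' = app \<pi> X x) \<in> carrier (FO Q X) \<and>
      app \<pi> X (SOME x'. x' \<in> carrier (FO Q X) \<and> app \<pi> X x' = app \<pi> X x) = app \<pi> X x"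
      by (rule someI[of _ x]) (use x in simp)
    then show ?thesis unfolding t_def using wd[OF X _ x] by blast
  qed
  have surj: "\<exists>x\<in>carrier (FO Q X). y = app \<pi> X x" if "X \<in> Obj C" "y \<in> carrier (FO R X)" for X y
  proof -
    have "y \<in> app \<pi> X ` carrier (FO Q X)" using ex that unfolding exact_def by metis
    then show ?thesis by blast
  qed
  have H: "transform C R M t \<in> Hom (Fun C) R M"
  proof (rule transform_Hom[OF R M])
    fix X assume X: "X \<in> Obj C"
    show "t X \<in> hom (FO R X) (FO M X)"
    proof (rule homI)
      fix y assume "y \<in> carrier (FO R X)"
      then show "t X y \<in> carrier (FO M X)" using surj[OF X] t_at[OF X] app_closed[OF d X] by metis
    next
      fix y y' assume "y \<in> carrier (FO R X)" "y' \<in> carrier (FO R X)"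
      then obtain x x' where x: "x \<in> carrier (FO Q X)" "y = app \<pi> X x" and x': "x' \<in> carrier (FO Q X)" "y' = app \<pi> X x'"
        using surj[OF X] by blast
      interpret G: comm_group "FO Q X" by (rule functor_comm_group[OF Q X])
      show "t X (y \<otimes>\<^bsub>FO R X\<^esub> y') = t X y \<otimes>\<^bsub>FO M X\<^esub> t X y'"
        using t_at[OF X x(1)] t_at[OF X x'(1)] t_at[OF X G.m_closed[OF x(1) x'(1)]]
          app_mult[OF d X x(1) x'(1)] app_mult[OF pi X x(1) x'(1)] x x' by simp
    qed
  next
    fix X Y f y assume f: "f \<in> Hom C X Y" and y: "y \<in> carrier (FO R X)"
    note o = Hom_Obj[OF f]
    obtain x where x: "x \<in> carrier (FO Q X)" "y = app \<pi> X x" using surj[OF o(1) y] by blast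
    show "t Y (act R f y) = act M f (t X y)"
      using app_natural[OF pi f x(1)] app_natural[OF d f x(1)] t_at[OF o(1) x(1)]
        t_at[OF o(2) act_closed[OF Q f x(1)]] x(2) by simp
  qed
  show "\<exists>!h. h \<in> Hom (Fun C) R M \<and> h \<cdot>\<^bsub>Fun C\<^esub> \<pi> = d"
  proof (rule ex1I[of _ "transform C R M t"], intro conjI H)
    show "transform C R M t \<cdot>\<^bsub>Fun C\<^esub> \<pi> = d"
      by (rule Fun_eqI[OF Comp_Fun_closed[OF pi H] d])
        (simp add: app_Comp[OF pi H] app_transform app_closed[OF pi] t_at)
    fix h assume h: "h \<in> Hom (Fun C) R M \<and> h \<cdot>\<^bsub>Fun C\<^esub> \<pi> = d"
    show "h = transform C R M t"
    proof (rule Fun_eqI[OF _ H])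
      show h1: "h \<in> Hom (Fun C) R M" using h by simp
      fix X y assume X: "X \<in> Obj C" and y: "y \<in> carrier (FO R X)"
      obtain x where x: "x \<in> carrier (FO Q X)" "y = app \<pi> X x" using surj[OF X y] by blast
      show "app h X y = app (transform C R M t) X y"
        using h app_Comp[OF pi h1 X x(1)] t_at[OF X x(1)] x(2) app_transform[OF X y] by simp
    qed
  qed
qed

end

section \<open>Representable functors\<close>

lemma hom_group_simps [simp]:
  "carrier (hom_group C A X) = Hom C A X" "mult (hom_group C A X) = Add C" "one (hom_group C A X) = Zero C A X"
  by (simp_all add: hom_group_def)

lemma FO_rep [simp]: "FO (rep C A) X = hom_group C A X"
  by (simp add: rep_def)

lemma act_rep: "f \<in> Hom C X Y \<Longrightarrow> g \<in> Hom C A X \<Longrightarrow> act (rep C A) f g = f \<cdot>\<^bsub>C\<^esub> g"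
  by (auto simp: rep_def map_of_ab_def Hom_def)

lemma app_rep_arrow:
  assumes "f \<in> Hom C A B" "X \<in> Obj C" "g \<in> Hom C B X"
  shows "app (rep_arrow C f) X g = g \<cdot>\<^bsub>C\<^esub> f"
  using assms by (auto simp: rep_arrow_def map_of_ab_def components_def Hom_def)

locale small_preadditive_category = preadditive_category C
  for C :: "('o, 'u, 'x) ab_category_scheme" (structure) +
  assumes locally_small: "locally_small C"
begin

lemma rep_additive:
  assumes A: "A \<in> Obj C"
  shows "additive_functor C Ab (rep C A)"
proof (rule additive_functor_AbI)
  show obj: "FO (rep C A) X \<in> Obj Ab" if "X \<in> Obj C" for X
    using hom_comm_group[OF A that] locally_small A that by (simp add: Obj_Ab locally_small_def)
  show "FA (rep C A) f \<in> Hom Ab (FO (rep C A) X) (FO (rep C A) Y)" if f: "f \<in> Hom C X Y" for f X Y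
  proof -
    have dc: "Dom C f = X" "Cod C f = Y" using f by (auto simp: Hom_def)
    have "FA (rep C A) f = abhom (hom_group C A X) (hom_group C A Y) (\<lambda>g. f \<cdot> g)"
      by (simp add: rep_def abhom_def dc)
    moreover have "(\<lambda>g. f \<cdot> g) \<in> hom (hom_group C A X) (hom_group C A Y)"
      using Comp_in_Hom[OF _ f] Comp_Add[OF _ _ f] by (auto simp: hom_def)
    ultimately show ?thesis using Hom_AbI[OF obj[OF Hom_Obj(1)[OF f]] obj[OF Hom_Obj(2)[OF f]]] by simp
  qed
  show "act (rep C A) (Ident C X) x = x" if "X \<in> Obj C" "x \<in> carrier (FO (rep C A) X)" for X x
    using that act_rep[OF Ident_in_Hom] Ident_Comp by simp
  show "act (rep C A) (g \<cdot> f) x = act (rep C A) g (act (rep C A) f x)"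
    if f: "f \<in> Hom C X Y" and g: "g \<in> Hom C Y Z" and "x \<in> carrier (FO (rep C A) X)" for f g X Y Z x
  proof -
    have x: "x \<in> Hom C A X" using that by simp
    show ?thesis using act_rep[OF f x] act_rep[OF g Comp_in_Hom[OF x f]] act_rep[OF Comp_in_Hom[OF f g] x]
        Comp_assoc[OF x f g] by simp
  qed
  show "act (rep C A) (f \<^bold>+ g) x = act (rep C A) f x \<otimes>\<^bsub>FO (rep C A) Y\<^esub> act (rep C A) g x"
    if f: "f \<in> Hom C X Y" and g: "g \<in> Hom C X Y" and "x \<in> carrier (FO (rep C A) X)" for f g X Y x
    using act_rep[OF f] act_rep[OF g] act_rep[OF Hom_Add[OF f g]] Add_Comp[OF _ f g] that by simp
qed

lemma rep_arrow_Hom: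
  assumes f: "f \<in> Hom C A B"
  shows "rep_arrow C f \<in> Hom (Fun C) (rep C B) (rep C A)"
proof -
  note o = Hom_Obj[OF f]
  have dc: "Dom C f = A" "Cod C f = B" using f by (auto simp: Hom_def)
  have "rep_arrow C f = transform C (rep C B) (rep C A) (\<lambda>X g. g \<cdot> f)"
    by (auto simp: rep_arrow_def transform_def dc abhom_def)
  also have "\<dots> \<in> Hom (Fun C) (rep C B) (rep C A)"
  proof (rule transform_Hom[OF rep_additive[OF o(2)] rep_additive[OF o(1)]])
    show "(\<lambda>g. g \<cdot> f) \<in> hom (FO (rep C B) X) (FO (rep C A) X)" for X
      using Comp_in_Hom[OF f] Add_Comp[OF f] by (auto simp: hom_def)
    show "act (rep C B) g x \<cdot> f = act (rep C A) g (x \<cdot> f)"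
      if g: "g \<in> Hom C X Y" and "x \<in> carrier (FO (rep C B) X)" for X Y g x
    proof -
      have x: "x \<in> Hom C B X" using that by simp
      show ?thesis using act_rep[OF g x] act_rep[OF g Comp_in_Hom[OF f x]] Comp_assoc[OF f x g] by simp
    qed
  qed
  finally show ?thesis .
qed

lemma Yoneda:
  assumes t: "\<tau> \<in> Hom (Fun C) (rep C B) (rep C A)" and B: "B \<in> Obj C"
  obtains f where "f \<in> Hom C A B" "\<tau> = rep_arrow C f"
proof -
  define f where "f = app \<tau> B (Ident C B)"
  have id: "Ident C B \<in> carrier (FO (rep C B) B)" using Ident_in_Hom[OF B] by simp
  have f: "f \<in> Hom C A B" using app_closed[OF t B id] by (simp add: f_def)
  have "\<tau> = rep_arrow C f"
  proof (rule Fun_eqI[OF t rep_arrow_Hom[OF f]])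
    fix X x assume X: "X \<in> Obj C" and "x \<in> carrier (FO (rep C B) X)"
    then have x: "x \<in> Hom C B X" by simp
    show "app \<tau> X x = app (rep_arrow C f) X x"
      using app_natural[OF t x id] act_rep[OF x Ident_in_Hom[OF B]] act_rep[OF x f] Comp_Ident[OF x]
        app_rep_arrow[OF f X x] by (simp add: f_def)
  qed
  then show thesis using that f by blast
qed

lemma Zero_Hom: "A \<in> Obj C \<Longrightarrow> X \<in> Obj C \<Longrightarrow> Zero C A X \<in> Hom C A X"
  using hom_comm_group[of A X] unfolding comm_group_def group_def
  by (metis hom_group_simps(1,3) monoid.one_closed)

lemma Comp_Zero:
  assumes A: "A \<in> Obj C" and f: "f \<in> Hom C X Y"
  shows "f \<cdot> Zero C A X = Zero C A Y"
  using map_one[OF functor_Hom_Ab[OF rep_additive[OF A] f]]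
  by (simp add: act_rep[OF f Zero_Hom[OF A Hom_Obj(1)[OF f]]])

lemma Zero_Comp:
  assumes X: "X \<in> Obj C" and f: "f \<in> Hom C A B"
  shows "Zero C B X \<cdot> f = Zero C A X"
  using app_one[OF rep_arrow_Hom[OF f] X]
  by (simp add: app_rep_arrow[OF f X Zero_Hom[OF Hom_Obj(2)[OF f] X]])

end


section \<open>Functors preserving direct limits\<close>

lemma comp_functor_simps [simp]:
  "FO (comp_functor F G) i = FO F (FO G i)" "FA (comp_functor F G) u = FA F (FA G u)"
  by (simp_all add: comp_functor_def)

context small_preadditive_category
begin

lemma functor_cocone:
  assumes E: "additive_functor C Ab E" and J: "category J" and co: "is_cocone J C G L c"
  shows "is_cocone J Ab (comp_functor E G) (FO E L) (\<lambda>i. FA E (c i))"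
proof -
  interpret J: category J by fact
  note G = cocone_functor[OF co]
  have E': "is_functor C Ab E" using E by (simp add: additive_functor_def)
  have GO: "FO G i \<in> Obj C" if "i \<in> Obj J" for i using G that by (simp add: is_functor_def)
  have L: "L \<in> Obj C" using co by (simp add: is_cocone_def)
  have "is_functor J Ab (comp_functor E G)"
    unfolding is_functor_def
  proof (intro conjI ballI)
    fix X Y Z f g assume f: "f \<in> Hom J X Y" and g: "g \<in> Hom J Y Z"
    show "FA (comp_functor E G) (g \<cdot>\<^bsub>J\<^esub> f) = FA (comp_functor E G) g \<cdot>\<^bsub>Ab\<^esub> FA (comp_functor E G) f"
      using is_functor_Comp[OF E' category_axioms is_functor_Hom[OF G J f] is_functor_Hom[OF G J g]]
      by (simp add: is_functor_Comp[OF G J f g])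
  qed (use G E' GO functor_Hom_Ab[OF E is_functor_Hom[OF G J]] in \<open>auto simp: is_functor_def\<close>)
  moreover have "FA E (c j) \<cdot>\<^bsub>Ab\<^esub> FA E (FA G u) = FA E (c i)" if "u \<in> Hom J i j" for i j u
    using is_functor_Comp[OF E' category_axioms is_functor_Hom[OF G J that] cocone_component[OF co J.Hom_Obj(2)[OF that]]]
      cocone_Comp[OF co J that] by simp
  ultimately show ?thesis
    unfolding is_cocone_def using functor_Obj_Ab[OF E L] functor_Hom_Ab[OF E cocone_component[OF co]] by auto
qed

lemma preserves_direct_limits_factor:
  fixes J :: "('u, 'u) category"
  assumes E: "preserves_direct_limits C E" and J: "directed J" and co: "is_colimit J C G L c"
    and y: "y \<in> carrier (FO E L)"
  obtains i x where "i \<in> Obj J" "x \<in> carrier (FO E (FO G i))" "act E (c i) x = y"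
proof -
  have "is_colimit J Ab (comp_functor E G) (FO E L) (\<lambda>i. FA E (c i))"
    using E J co unfolding preserves_direct_limits_def preserves_colimits_of_shape_def by blast
  from directed_colimit_exhausted[OF J this] y that show thesis
    unfolding exhausted_def by auto
qed

lemma preserves_direct_limits_dies:
  fixes J :: "('u, 'u) category"
  assumes U: "universe TYPE('u)" and E: "preserves_direct_limits C E"
    and J: "directed J" and co: "is_colimit J C G L c"
    and x: "i \<in> Obj J" "x \<in> carrier (FO E (FO G i))" "act E (c i) x = \<one>\<^bsub>FO E L\<^esub>"
  obtains j u where "j \<in> Obj J" "u \<in> Hom J i j" "act E (FA G u) x = \<one>\<^bsub>FO E (FO G j)\<^esub>"
proof -
  have "is_colimit J Ab (comp_functor E G) (FO E L) (\<lambda>i. FA E (c i))"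
    using E J co unfolding preserves_direct_limits_def preserves_colimits_of_shape_def by blast
  from directed_colimit_dies_early[OF U J this] x that show thesis
    unfolding dies_early_def by auto
qed

lemma preserves_direct_limitsI:
  assumes E: "additive_functor C Ab E"
    and ex: "\<And>(J :: ('u, 'u) category) G L c y. directed J \<Longrightarrow> is_colimit J C G L c \<Longrightarrow> y \<in> carrier (FO E L) \<Longrightarrow>
        \<exists>i\<in>Obj J. \<exists>x\<in>carrier (FO E (FO G i)). act E (c i) x = y"
    and de: "\<And>(J :: ('u, 'u) category) G L c i x. directed J \<Longrightarrow> is_colimit J C G L c \<Longrightarrow> i \<in> Obj J \<Longrightarrow>
        x \<in> carrier (FO E (FO G i)) \<Longrightarrow> act E (c i) x = \<one>\<^bsub>FO E L\<^esub> \<Longrightarrow>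
        \<exists>j\<in>Obj J. \<exists>u\<in>Hom J i j. act E (FA G u) x = \<one>\<^bsub>FO E (FO G j)\<^esub>"
  shows "preserves_direct_limits C E"
  unfolding preserves_direct_limits_def preserves_colimits_of_shape_def
proof (intro allI impI)
  fix J :: "('u, 'u) category" and G L c
  assume J: "directed J" and co: "is_colimit J C G L c"
  show "is_colimit J Ab (comp_functor E G) (FO E L) (\<lambda>i. FA E (c i))"
    by (rule directed_colimit_AbI[OF J functor_cocone[OF E directed_category[OF J] colimit_cocone[OF co]]])
      (use ex[OF J co] de[OF J co] in \<open>auto simp: exhausted_def dies_early_def\<close>)
qed

lemma fp_Obj: "A \<in> fp C \<Longrightarrow> A \<in> Obj C"
  by (simp add: fp_def)

lemma diagram_Hom:
  assumes "directed J" "is_colimit J C G L c" "u \<in> Hom J i j"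
  shows "FA G u \<in> Hom C (FO G i) (FO G j)"
  using is_functor_Hom[OF cocone_functor[OF colimit_cocone[OF assms(2)]] directed_category[OF assms(1)] assms(3)] .

lemma colimit_component: "is_colimit J C G L c \<Longrightarrow> i \<in> Obj J \<Longrightarrow> c i \<in> Hom C (FO G i) L"
  by (rule cocone_component[OF colimit_cocone])

lemma colimit_Comp:
  "is_colimit J C G L c \<Longrightarrow> directed J \<Longrightarrow> u \<in> Hom J i j \<Longrightarrow> c j \<cdot> FA G u = c i"
  by (rule cocone_Comp[OF colimit_cocone directed_category])

lemma colimit_stage:
  assumes "is_colimit J C G L c" "directed J" "u \<in> Hom J i j" "a \<in> Hom C A (FO G i)"
  shows "FA G u \<cdot> a \<in> Hom C A (FO G j)" "c j \<cdot> (FA G u \<cdot> a) = c i \<cdot> a"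
proof -
  interpret J: category J using assms(2) by (rule directed_category)
  note Gu = diagram_Hom[OF assms(2,1,3)]
  show "FA G u \<cdot> a \<in> Hom C A (FO G j)" by (rule Comp_in_Hom[OF assms(4) Gu])
  show "c j \<cdot> (FA G u \<cdot> a) = c i \<cdot> a"
    using Comp_assoc[OF assms(4) Gu colimit_component[OF assms(1) J.Hom_Obj(2)[OF assms(3)]]]
      colimit_Comp[OF assms(1-3)] by simp
qed

lemma fp_factor:
  fixes J :: "('u, 'u) category"
  assumes A: "A \<in> fp C" and J: "directed J" and co: "is_colimit J C G L c" and h: "h \<in> Hom C A L"
  obtains i a where "i \<in> Obj J" "a \<in> Hom C A (FO G i)" "c i \<cdot> a = h"
proof -
  have "preserves_direct_limits C (rep C A)" using A by (simp add: fp_def)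
  then obtain i x where ix: "i \<in> Obj J" "x \<in> carrier (FO (rep C A) (FO G i))" "act (rep C A) (c i) x = h"
    using preserves_direct_limits_factor[OF _ J co] h by (metis FO_rep hom_group_simps(1))
  then show thesis using that act_rep[OF colimit_component[OF co ix(1)]] by simp
qed

lemma fp_merge:
  fixes J :: "('u, 'u) category"
  assumes U: "universe TYPE('u)" and A: "A \<in> fp C" and J: "directed J" and co: "is_colimit J C G L c"
    and i: "i \<in> Obj J" and a: "a \<in> Hom C A (FO G i)" and b: "b \<in> Hom C A (FO G i)" and eq: "c i \<cdot> a = c i \<cdot> b"
  obtains j u where "j \<in> Obj J" "u \<in> Hom J i j" "FA G u \<cdot> a = FA G u \<cdot> b"
proof -
  have E: "preserves_direct_limits C (rep C A)" using A by (simp add: fp_def)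
  note AO = fp_Obj[OF A]
  note rA = rep_additive[OF AO]
  note ci = colimit_component[OF co i]
  interpret H: comm_group "hom_group C A (FO G i)" by (rule hom_comm_group[OF AO Hom_Obj(1)[OF ci]])
  let ?d = "a \<otimes>\<^bsub>hom_group C A (FO G i)\<^esub> inv\<^bsub>hom_group C A (FO G i)\<^esub> b"
  have ab: "a \<in> carrier (FO (rep C A) (FO G i))" "b \<in> carrier (FO (rep C A) (FO G i))" using a b by auto
  then have d: "?d \<in> carrier (FO (rep C A) (FO G i))" using H.m_closed[OF _ H.inv_closed] by simp
  have "act (rep C A) (c i) ?d = \<one>\<^bsub>FO (rep C A) L\<^esub>"
    using map_eq_iff[OF functor_Hom_Ab[OF rA ci] ab] eq act_rep[OF ci a] act_rep[OF ci b] by simp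
  then obtain j u where ju: "j \<in> Obj J" "u \<in> Hom J i j" "act (rep C A) (FA G u) ?d = \<one>\<^bsub>FO (rep C A) (FO G j)\<^esub>"
    using preserves_direct_limits_dies[OF U E J co i d] by blast
  note Gu = diagram_Hom[OF J co ju(2)]
  have "FA G u \<cdot> a = FA G u \<cdot> b"
    using map_eq_iff[OF functor_Hom_Ab[OF rA Gu] ab] ju(3) act_rep[OF Gu a] act_rep[OF Gu b] by simp
  then show thesis using that ju by blast
qed

lemma fp_factor2:
  fixes J :: "('u, 'u) category"
  assumes A: "A \<in> fp C" and B: "B \<in> fp C" and J: "directed J" and co: "is_colimit J C G L c"
    and h: "h \<in> Hom C A L" and h': "h' \<in> Hom C B L"
  obtains i a b where "i \<in> Obj J" "a \<in> Hom C A (FO G i)" "b \<in> Hom C B (FO G i)" "c i \<cdot> a = h" "c i \<cdot> b = h'"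
proof -
  obtain i a where i: "i \<in> Obj J" "a \<in> Hom C A (FO G i)" "c i \<cdot> a = h" using fp_factor[OF A J co h] .
  obtain j b where j: "j \<in> Obj J" "b \<in> Hom C B (FO G j)" "c j \<cdot> b = h'" using fp_factor[OF B J co h'] .
  obtain k u v where k: "k \<in> Obj J" "u \<in> Hom J i k" "v \<in> Hom J j k" using directed_upper_bound[OF J i(1) j(1)] .
  show thesis
    using that[OF k(1) colimit_stage(1)[OF co J k(2) i(2)] colimit_stage(1)[OF co J k(3) j(2)]]
      colimit_stage(2)[OF co J k(2) i(2)] colimit_stage(2)[OF co J k(3) j(2)] i(3) j(3) by simp
qed

text \<open>
  If \<open>c\<^sub>i a\<close> extends along \<open>f : A \<rightarrow> B\<close>, then already the image of \<open>a\<close> at a later stage does: the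
  extension is defined at some stage because \<open>B\<close> is finitely presented, and it restricts to the
  image of \<open>a\<close> at a later one because \<open>A\<close> is.
\<close>

lemma fp_extension_at_stage:
  fixes J :: "('u, 'u) category"
  assumes U: "universe TYPE('u)" and A: "A \<in> fp C" and B: "B \<in> fp C" and f: "f \<in> Hom C A B"
    and J: "directed J" and co: "is_colimit J C G L c" and i: "i \<in> Obj J" and a: "a \<in> Hom C A (FO G i)"
    and k: "k \<in> Hom C B L" and eq: "k \<cdot> f = c i \<cdot> a"
  obtains n t k' where "n \<in> Obj J" "t \<in> Hom J i n" "k' \<in> Hom C B (FO G n)" "FA G t \<cdot> a = k' \<cdot> f"
proof -
  interpret J: category J using J by (rule directed_category)
  obtain l b where l: "l \<in> Obj J" "b \<in> Hom C B (FO G l)" "c l \<cdot> b = k" using fp_factor[OF B J co k] .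
  obtain m u v where m: "m \<in> Obj J" "u \<in> Hom J i m" "v \<in> Hom J l m" using directed_upper_bound[OF J i l(1)] .
  note a' = colimit_stage[OF co J m(2) a] and b' = colimit_stage[OF co J m(3) l(2)]
  have "c m \<cdot> (FA G u \<cdot> a) = c m \<cdot> ((FA G v \<cdot> b) \<cdot> f)"
    using a'(2) b'(2) eq l(3) Comp_assoc[OF f b'(1) colimit_component[OF co m(1)]] by simp
  then obtain n w where n: "n \<in> Obj J" "w \<in> Hom J m n" "FA G w \<cdot> (FA G u \<cdot> a) = FA G w \<cdot> ((FA G v \<cdot> b) \<cdot> f)"
    using fp_merge[OF U A J co m(1) a'(1) Comp_in_Hom[OF f b'(1)]] by blast
  note Gw = diagram_Hom[OF J co n(2)]
  have "FA G (w \<cdot>\<^bsub>J\<^esub> u) \<cdot> a = (FA G w \<cdot> (FA G v \<cdot> b)) \<cdot> f"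
    using is_functor_Comp[OF cocone_functor[OF colimit_cocone[OF co]] J.category_axioms m(2) n(2)] n(3)
      Comp_assoc[OF a diagram_Hom[OF J co m(2)] Gw] Comp_assoc[OF f b'(1) Gw] by simp
  then show thesis using that n(1) J.Comp_in_Hom[OF m(2) n(2)] Comp_in_Hom[OF b'(1) Gw] by blast
qed

lemma fpI:
  assumes A: "A \<in> Obj C"
    and ex: "\<And>(J :: ('u, 'u) category) G L c h. directed J \<Longrightarrow> is_colimit J C G L c \<Longrightarrow> h \<in> Hom C A L \<Longrightarrow>
        \<exists>i\<in>Obj J. \<exists>a\<in>Hom C A (FO G i). c i \<cdot> a = h"
    and de: "\<And>(J :: ('u, 'u) category) G L c i a. directed J \<Longrightarrow> is_colimit J C G L c \<Longrightarrow> i \<in> Obj J \<Longrightarrow>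
        a \<in> Hom C A (FO G i) \<Longrightarrow> c i \<cdot> a = Zero C A L \<Longrightarrow>
        \<exists>j\<in>Obj J. \<exists>u\<in>Hom J i j. FA G u \<cdot> a = Zero C A (FO G j)"
  shows "A \<in> fp C"
proof -
  have "preserves_direct_limits C (rep C A)"
  proof (rule preserves_direct_limitsI[OF rep_additive[OF A]])
    fix J :: "('u, 'u) category" and G L c y
    assume J: "directed J" and co: "is_colimit J C G L c" and y: "y \<in> carrier (FO (rep C A) L)"
    then obtain i a where i: "i \<in> Obj J" "a \<in> Hom C A (FO G i)" "c i \<cdot> a = y" using ex by (metis FO_rep hom_group_simps(1))
    then have "act (rep C A) (c i) a = y" using act_rep[OF colimit_component[OF co i(1)]] by simp
    then show "\<exists>i\<in>Obj J. \<exists>x\<in>carrier (FO (rep C A) (FO G i)). act (rep C A) (c i) x = y" using i by auto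
  next
    fix J :: "('u, 'u) category" and G L c i x
    assume J: "directed J" and co: "is_colimit J C G L c" and i: "i \<in> Obj J" and "x \<in> carrier (FO (rep C A) (FO G i))"
      and x1: "act (rep C A) (c i) x = \<one>\<^bsub>FO (rep C A) L\<^esub>"
    then have x: "x \<in> Hom C A (FO G i)" by simp
    have "c i \<cdot> x = Zero C A L" using x1 act_rep[OF colimit_component[OF co i] x] by simp
    from de[OF J co i x this] obtain j u where u: "j \<in> Obj J" "u \<in> Hom J i j" "FA G u \<cdot> x = Zero C A (FO G j)" by blast
    then show "\<exists>j\<in>Obj J. \<exists>u\<in>Hom J i j. act (rep C A) (FA G u) x = \<one>\<^bsub>FO (rep C A) (FO G j)\<^esub>"
      using act_rep[OF diagram_Hom[OF J co u(2)] x] by auto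
  qed
  then show ?thesis using A by (simp add: fp_def)
qed

text \<open>
  The cokernel \<open>E\<close> of \<open>(f,-)\<close> on all of \<open>\<C>\<close> inherits the preservation of direct limits from \<open>(A,-)\<close>
  and \<open>(B,-)\<close>: an element of \<open>E(X)\<close> is represented by an arrow \<open>A \<rightarrow> X\<close>, which extends
  along \<open>f\<close> exactly if the element is trivial.
\<close>

lemma exact_preserves_direct_limits:
  assumes U: "universe TYPE('u)" and A: "A \<in> fp C" and B: "B \<in> fp C" and f: "f \<in> Hom C A B"
    and pi: "\<pi> \<in> Hom (Fun C) (rep C A) E" and ex: "exact C (rep_arrow C f) \<pi> (rep C B) (rep C A) E"
  shows "preserves_direct_limits C E"
proof -
  note E = Hom_FunD(2)[OF pi]
  have surj: "\<exists>a\<in>Hom C A X. y = app \<pi> X a" if "X \<in> Obj C" "y \<in> carrier (FO E X)" for X y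
  proof -
    have "y \<in> app \<pi> X ` carrier (FO (rep C A) X)" using ex that unfolding exact_def by metis
    then show ?thesis by auto
  qed
  have ker: "app \<pi> X a = \<one>\<^bsub>FO E X\<^esub> \<longleftrightarrow> (\<exists>k\<in>Hom C B X. a = k \<cdot> f)" if X: "X \<in> Obj C" and a: "a \<in> Hom C A X" for X a
  proof -
    have "app \<pi> X a = \<one>\<^bsub>FO E X\<^esub> \<longleftrightarrow> a \<in> app (rep_arrow C f) X ` Hom C B X"
      using ex X a unfolding exact_def by simp
    also have "\<dots> \<longleftrightarrow> (\<exists>k\<in>Hom C B X. a = k \<cdot> f)" using app_rep_arrow[OF f X] by auto
    finally show ?thesis .
  qed
  have nat: "app \<pi> Y (g \<cdot> a) = act E g (app \<pi> X a)" if "g \<in> Hom C X Y" "a \<in> Hom C A X" for X Y g a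
    using app_natural[OF pi that(1), of a] that(2) act_rep[OF that] by simp
  show ?thesis
  proof (rule preserves_direct_limitsI[OF E])
    fix J :: "('u, 'u) category" and G L c y
    assume J: "directed J" and co: "is_colimit J C G L c" and y: "y \<in> carrier (FO E L)"
    have L: "L \<in> Obj C" using colimit_cocone[OF co] by (simp add: is_cocone_def)
    obtain h where h: "h \<in> Hom C A L" "y = app \<pi> L h" using surj[OF L y] by blast
    obtain i a where i: "i \<in> Obj J" "a \<in> Hom C A (FO G i)" "c i \<cdot> a = h" using fp_factor[OF A J co h(1)] .
    note ci = colimit_component[OF co i(1)]
    have "act E (c i) (app \<pi> (FO G i) a) = y" using nat[OF ci i(2)] i(3) h(2) by simp
    then show "\<exists>i\<in>Obj J. \<exists>x\<in>carrier (FO E (FO G i)). act E (c i) x = y"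
      using i app_closed[OF pi Hom_Obj(1)[OF ci]] by force
  next
    fix J :: "('u, 'u) category" and G L c i x
    assume J: "directed J" and co: "is_colimit J C G L c" and i: "i \<in> Obj J" and x: "x \<in> carrier (FO E (FO G i))"
      and x1: "act E (c i) x = \<one>\<^bsub>FO E L\<^esub>"
    interpret J: category J using J by (rule directed_category)
    note ci = colimit_component[OF co i]
    note o = Hom_Obj[OF ci]
    obtain a where a: "a \<in> Hom C A (FO G i)" "x = app \<pi> (FO G i) a" using surj[OF o(1) x] by blast
    have "app \<pi> L (c i \<cdot> a) = \<one>\<^bsub>FO E L\<^esub>" using nat[OF ci a(1)] x1 a(2) by simp
    then obtain k where k: "k \<in> Hom C B L" "c i \<cdot> a = k \<cdot> f"
      using ker[OF o(2) Comp_in_Hom[OF a(1) ci]] by blast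
    obtain n t k' where n: "n \<in> Obj J" and t: "t \<in> Hom J i n" and k': "k' \<in> Hom C B (FO G n)" "FA G t \<cdot> a = k' \<cdot> f"
      using fp_extension_at_stage[OF U A B f J co i a(1) k(1) k(2)[symmetric]] .
    note Gt = diagram_Hom[OF J co t]
    have "app \<pi> (FO G n) (FA G t \<cdot> a) = \<one>\<^bsub>FO E (FO G n)\<^esub>"
      using ker[OF Hom_Obj(2)[OF Gt] Comp_in_Hom[OF a(1) Gt]] k' by blast
    then have "act E (FA G t) x = \<one>\<^bsub>FO E (FO G n)\<^esub>" using nat[OF Gt a(1)] a(2) by simp
    then show "\<exists>j\<in>Obj J. \<exists>u\<in>Hom J i j. act E (FA G u) x = \<one>\<^bsub>FO E (FO G j)\<^esub>" using n t by blast
  qed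
qed

section \<open>Restriction to the finitely presented objects\<close>

lemma full_subcategory_simps [simp]:
  "Obj (full_subcategory C P) = P" "Ident (full_subcategory C P) = Ident C"
  "Comp (full_subcategory C P) = Comp C" "Add (full_subcategory C P) = Add C" "Zero (full_subcategory C P) = Zero C"
  "Dom (full_subcategory C P) = Dom C" "Cod (full_subcategory C P) = Cod C"
  by (simp_all add: full_subcategory_def)

lemma Hom_full_subcategory:
  "Hom (full_subcategory C P) X Y = (if X \<in> P \<and> Y \<in> P then Hom C X Y else {})"
  by (auto simp: Hom_def full_subcategory_def)

lemma full_subcategory_small_preadditive:
  assumes "P \<subseteq> Obj C"
  shows "small_preadditive_category (full_subcategory C P)"
proof -
  let ?P = "full_subcategory C P"
  have H: "f \<in> Hom C X Y \<and> X \<in> P \<and> Y \<in> P" if "f \<in> Hom ?P X Y" for f X Y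
    using that by (simp add: Hom_full_subcategory split: if_splits)
  have HI: "f \<in> Hom ?P X Y" if "f \<in> Hom C X Y" "X \<in> P" "Y \<in> P" for f X Y
    using that by (simp add: Hom_full_subcategory)
  interpret P: category ?P
  proof
    show "Dom ?P f \<in> Obj ?P" if "f \<in> Arr ?P" for f
      using that by (simp add: full_subcategory_def)
    show "Cod ?P f \<in> Obj ?P" if "f \<in> Arr ?P" for f
      using that by (simp add: full_subcategory_def)
    show "Ident ?P A \<in> Hom ?P A A" if "A \<in> Obj ?P" for A
      using that HI[OF Ident_in_Hom[of A]] assms by auto
    show "g \<cdot>\<^bsub>?P\<^esub> f \<in> Hom ?P X Z" if "f \<in> Hom ?P X Y" "g \<in> Hom ?P Y Z" for f g X Y Z
      using H[OF that(1)] H[OF that(2)] HI[OF Comp_in_Hom[of f X Y g Z]] by simp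
    show "f \<cdot>\<^bsub>?P\<^esub> Ident ?P X = f" if "f \<in> Hom ?P X Y" for f X Y
      using H[OF that] Comp_Ident[of f X Y] by simp
    show "Ident ?P Y \<cdot>\<^bsub>?P\<^esub> f = f" if "f \<in> Hom ?P X Y" for f X Y
      using H[OF that] Ident_Comp[of f X Y] by simp
    show "(h \<cdot>\<^bsub>?P\<^esub> g) \<cdot>\<^bsub>?P\<^esub> f = h \<cdot>\<^bsub>?P\<^esub> (g \<cdot>\<^bsub>?P\<^esub> f)"
      if "f \<in> Hom ?P W X" "g \<in> Hom ?P X Y" "h \<in> Hom ?P Y Z" for f g h W X Y Z
      using H[OF that(1)] H[OF that(2)] H[OF that(3)] Comp_assoc[of f W X g Y h Z] by simp
  qed
  show ?thesis
  proof (intro small_preadditive_category.intro preadditive_category.intro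
      preadditive_category_axioms.intro small_preadditive_category_axioms.intro)
    show "category ?P" by (rule P.category_axioms)
    show "comm_group (hom_group ?P A B)" if "A \<in> Obj ?P" "B \<in> Obj ?P" for A B
    proof -
      have "hom_group ?P A B = hom_group C A B"
        using that by (simp add: hom_group_def Hom_full_subcategory)
      then show ?thesis using hom_comm_group[of A B] that assms by auto
    qed
    show "g \<cdot>\<^bsub>?P\<^esub> (f \<^bold>+\<^bsub>?P\<^esub> f') = g \<cdot>\<^bsub>?P\<^esub> f \<^bold>+\<^bsub>?P\<^esub> g \<cdot>\<^bsub>?P\<^esub> f'"
      if "f \<in> Hom ?P X Y" "f' \<in> Hom ?P X Y" "g \<in> Hom ?P Y Z" for f f' g X Y Z
      using H[OF that(1)] H[OF that(2)] H[OF that(3)] Comp_Add[of f X Y f' g Z] by simp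
    show "(g \<^bold>+\<^bsub>?P\<^esub> g') \<cdot>\<^bsub>?P\<^esub> f = g \<cdot>\<^bsub>?P\<^esub> f \<^bold>+\<^bsub>?P\<^esub> g' \<cdot>\<^bsub>?P\<^esub> f"
      if "f \<in> Hom ?P X Y" "g \<in> Hom ?P Y Z" "g' \<in> Hom ?P Y Z" for f g g' X Y Z
      using H[OF that(1)] H[OF that(2)] H[OF that(3)] Add_Comp[of f X Y g Z g'] by simp
    show "locally_small ?P"
      unfolding locally_small_def
    proof (intro ballI)
      fix A B assume "A \<in> Obj ?P" "B \<in> Obj ?P"
      then show "small (Hom ?P A B)"
        using locally_small assms unfolding locally_small_def by (auto simp: Hom_full_subcategory)
    qed
  qed
qed

end

section \<open>Finitely accessible categories\<close>

locale finitely_accessible_category = additive_category C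
  for C :: "('o, 'u, 'x) ab_category_scheme" (structure) +
  assumes universe: "universe TYPE('u)"
    and accessible: "finitely_accessible C"

sublocale finitely_accessible_category \<subseteq> small_preadditive_category
  by unfold_locales (use accessible in \<open>simp add: finitely_accessible_def\<close>)

sublocale finitely_accessible_category \<subseteq> Cfp: small_preadditive_category "Cfp C"
  by (rule full_subcategory_small_preadditive) (auto simp: fp_def)

context finitely_accessible_category
begin

definition generating :: "'o set \<Rightarrow> bool" where
  "generating \<G> \<longleftrightarrow> \<G> \<subseteq> fp C \<and> (\<forall>X\<in>Obj C. \<exists>(J :: ('u, 'u) category) G c.
     directed J \<and> FO G ` Obj J \<subseteq> \<G> \<and> is_colimit J C G X c)"

lemma generating_colimit:
  assumes "generating \<G>" "X \<in> Obj C"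
  obtains J :: "('u, 'u) category" and G c where "directed J" "\<And>i. i \<in> Obj J \<Longrightarrow> FO G i \<in> \<G>"
    "\<And>i. i \<in> Obj J \<Longrightarrow> FO G i \<in> fp C" "is_colimit J C G X c"
proof -
  obtain J :: "('u, 'u) category" and G c where J: "directed J" "FO G ` Obj J \<subseteq> \<G>" "is_colimit J C G X c"
    using assms unfolding generating_def by blast
  have "FO G i \<in> \<G>" if "i \<in> Obj J" for i using J(2) that by blast
  then show thesis using that[OF J(1) _ _ J(3)] assms(1) unfolding generating_def by blast
qed

text \<open>
  The objects of the generating family form the image of a small set, so only a small set of
  arrows leads from a given object to them.
\<close>

lemma generators:
  obtains \<G> where "generating \<G>" "\<And>A. A \<in> Obj C \<Longrightarrow> small {u \<in> Arr C. Dom C u = A \<and> Cod C u \<in> \<G>}"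
proof -
  obtain I :: "'u set" and P where I: "small I" "P ` I \<subseteq> fp C" and gen: "generating (P ` I)"
    using accessible unfolding finitely_accessible_def generating_def by auto
  show thesis
  proof (rule that[OF gen])
    fix A assume A: "A \<in> Obj C"
    have "small (\<Union>i\<in>I. Hom C A (P i))"
      using I locally_small A fp_Obj unfolding locally_small_def by (intro small_UN[OF universe]) auto
    then show "small {u \<in> Arr C. Dom C u = A \<and> Cod C u \<in> P ` I}"
      by (rule small_subset) (auto simp: Hom_def)
  qed
qed

end


section \<open>Presentations and extensions of finitely presented functors\<close>

definition presents where
  "presents C A B f \<pi> F \<longleftrightarrow> A \<in> fp C \<and> B \<in> fp C \<and> f \<in> Hom C A B \<and>
     \<pi> \<in> Hom (FpMod C) (rep (Cfp C) A) F \<and>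
     exact (Cfp C) (rep_arrow (Cfp C) f) \<pi> (rep (Cfp C) B) (rep (Cfp C) A) F"

definition extends_along :: "('o, 'a, 'x) category_scheme \<Rightarrow> 'o \<Rightarrow> 'o \<Rightarrow> 'a \<Rightarrow> 'o \<Rightarrow> bool" where
  "extends_along C A B f X \<longleftrightarrow> (\<forall>h\<in>Hom C A X. \<exists>k\<in>Hom C B X. k \<cdot>\<^bsub>C\<^esub> f = h)"

context finitely_accessible_category
begin

lemma Hom_Cfp: "A \<in> fp C \<Longrightarrow> B \<in> fp C \<Longrightarrow> Hom (Cfp C) A B = Hom C A B"
  by (simp add: Hom_full_subcategory)

lemma Hom_CfpD: "f \<in> Hom (Cfp C) A B \<Longrightarrow> f \<in> Hom C A B \<and> A \<in> fp C \<and> B \<in> fp C"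
  by (simp add: Hom_full_subcategory split: if_splits)

lemma exact_rep_Cfp_iff:
  assumes A: "A \<in> fp C" and B: "B \<in> fp C" and f: "f \<in> Hom C A B"
  shows "exact (Cfp C) (rep_arrow (Cfp C) f) \<pi> (rep (Cfp C) B) (rep (Cfp C) A) F \<longleftrightarrow>
    (\<forall>X\<in>fp C. app \<pi> X ` Hom C A X = carrier (FO F X) \<and>
      (\<forall>a\<in>Hom C A X. app \<pi> X a = \<one>\<^bsub>FO F X\<^esub> \<longleftrightarrow> (\<exists>k\<in>Hom C B X. a = k \<cdot> f)))"
proof -
  have "app (rep_arrow (Cfp C) f) X ` Hom C B X = (\<lambda>k. k \<cdot> f) ` Hom C B X" if X: "X \<in> fp C" for X
    using app_rep_arrow[of f "Cfp C" A B X] X A B f by (intro image_cong) (auto simp: Hom_Cfp)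
  then show ?thesis unfolding exact_def using A B by (auto simp: Hom_Cfp image_iff)
qed

lemma fp_mod_iff: "F \<in> fp_mod C \<longleftrightarrow> (\<exists>A B f \<pi>. presents C A B f \<pi> F)"
proof
  assume "F \<in> fp_mod C"
  then obtain A B \<phi> \<pi> where A: "A \<in> fp C" and B: "B \<in> fp C"
    and phi: "\<phi> \<in> Hom (FpMod C) (rep (Cfp C) B) (rep (Cfp C) A)"
    and pi: "\<pi> \<in> Hom (FpMod C) (rep (Cfp C) A) F"
    and ex: "\<And>X. X \<in> fp C \<Longrightarrow> app \<pi> X ` Hom C A X = carrier (FO F X) \<and>
         kernel (hom_group C A X) (FO F X) (app \<pi> X) = app \<phi> X ` Hom C B X"
    unfolding fp_mod_def by auto
  obtain f where "f \<in> Hom (Cfp C) A B" and phi_eq: "\<phi> = rep_arrow (Cfp C) f"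
    using Cfp.Yoneda[OF phi[unfolded FpMod_def]] B by auto
  then have f: "f \<in> Hom C A B" using Hom_CfpD by blast
  have "exact (Cfp C) (rep_arrow (Cfp C) f) \<pi> (rep (Cfp C) B) (rep (Cfp C) A) F"
    unfolding exact_def
  proof (intro ballI conjI)
    fix X assume "X \<in> Obj (Cfp C)"
    then have X: "X \<in> fp C" by simp
    show "app \<pi> X ` carrier (FO (rep (Cfp C) A) X) = carrier (FO F X)"
      using ex[OF X] A X by (simp add: Hom_Cfp)
    fix a assume "a \<in> carrier (FO (rep (Cfp C) A) X)"
    then have a: "a \<in> Hom C A X" using A X by (simp add: Hom_Cfp)
    have "app \<pi> X a = \<one>\<^bsub>FO F X\<^esub> \<longleftrightarrow> a \<in> kernel (hom_group C A X) (FO F X) (app \<pi> X)"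
      using a by (simp add: kernel_def)
    then show "app \<pi> X a = \<one>\<^bsub>FO F X\<^esub> \<longleftrightarrow> a \<in> app (rep_arrow (Cfp C) f) X ` carrier (FO (rep (Cfp C) B) X)"
      using ex[OF X] B X phi_eq by (simp add: Hom_Cfp)
  qed
  then show "\<exists>A B f \<pi>. presents C A B f \<pi> F" unfolding presents_def using A B f pi by blast
next
  assume "\<exists>A B f \<pi>. presents C A B f \<pi> F"
  then obtain A B f \<pi> where A: "A \<in> fp C" and B: "B \<in> fp C" and f: "f \<in> Hom C A B"
    and pi: "\<pi> \<in> Hom (FpMod C) (rep (Cfp C) A) F"
    and ex: "exact (Cfp C) (rep_arrow (Cfp C) f) \<pi> (rep (Cfp C) B) (rep (Cfp C) A) F"
    unfolding presents_def by blast
  have "F \<in> Obj (FpMod C)" using Cfp.Hom_FunD(2)[OF pi[unfolded FpMod_def]] by (simp add: FpMod_def Obj_Fun)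
  moreover have "rep_arrow (Cfp C) f \<in> Hom (FpMod C) (rep (Cfp C) B) (rep (Cfp C) A)"
    unfolding FpMod_def by (rule Cfp.rep_arrow_Hom) (simp add: Hom_Cfp A B f)
  moreover have "app \<pi> X ` Hom C A X = carrier (FO F X) \<and>
         kernel (hom_group C A X) (FO F X) (app \<pi> X) = app (rep_arrow (Cfp C) f) X ` Hom C B X"
    if X: "X \<in> fp C" for X
  proof -
    have *: "app \<pi> X ` Hom C A X = carrier (FO F X)"
      "\<And>a. a \<in> Hom C A X \<Longrightarrow> app \<pi> X a = \<one>\<^bsub>FO F X\<^esub> \<longleftrightarrow> a \<in> app (rep_arrow (Cfp C) f) X ` Hom C B X"
      using ex X A B unfolding exact_def by (simp_all add: Hom_Cfp)
    have "app (rep_arrow (Cfp C) f) X ` Hom C B X \<subseteq> Hom C A X"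
      using Cfp.app_closed[OF Cfp.rep_arrow_Hom, of f A B X] A B f X by (auto simp: Hom_Cfp)
    then show ?thesis using * by (auto simp: kernel_def)
  qed
  ultimately show "F \<in> fp_mod C" unfolding fp_mod_def using A B pi by blast
qed

lemma presentsD:
  assumes "presents C A B f \<pi> F"
  shows "A \<in> fp C" "B \<in> fp C" "f \<in> Hom C A B" "\<pi> \<in> Hom (Fun (Cfp C)) (rep (Cfp C) A) F"
    "exact (Cfp C) (rep_arrow (Cfp C) f) \<pi> (rep (Cfp C) B) (rep (Cfp C) A) F"
  using assms by (auto simp: presents_def FpMod_def)

lemma presents_surj:
  assumes "presents C A B f \<pi> F" "X \<in> fp C" "y \<in> carrier (FO F X)"
  obtains a where "a \<in> Hom C A X" "y = app \<pi> X a"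
proof -
  have "app \<pi> X ` Hom C A X = carrier (FO F X)"
    using exact_rep_Cfp_iff[OF presentsD(1-3)[OF assms(1)]] presentsD(5)[OF assms(1)] assms(2) by blast
  then show thesis using that assms(3) by blast
qed

lemma presents_kernel:
  assumes "presents C A B f \<pi> F" "X \<in> fp C" "a \<in> Hom C A X"
  shows "app \<pi> X a = \<one>\<^bsub>FO F X\<^esub> \<longleftrightarrow> (\<exists>k\<in>Hom C B X. a = k \<cdot> f)"
  using exact_rep_Cfp_iff[OF presentsD(1-3)[OF assms(1)]] presentsD(5)[OF assms(1)] assms(2,3) by blast

lemma presents_natural:
  assumes p: "presents C A B f \<pi> F" and X: "X \<in> fp C" and Y: "Y \<in> fp C" and g: "g \<in> Hom C X Y" and a: "a \<in> Hom C A X"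
  shows "app \<pi> Y (g \<cdot> a) = act F g (app \<pi> X a)"
proof -
  have g': "g \<in> Hom (Cfp C) X Y" and a': "a \<in> Hom (Cfp C) A X"
    using g a X Y presentsD(1)[OF p] by (simp_all add: Hom_Cfp)
  have "a \<in> carrier (FO (rep (Cfp C) A) X)" using a' by simp
  from Cfp.app_natural[OF presentsD(4)[OF p] g' this] show ?thesis by (simp add: act_rep[OF g' a'])
qed

lemma presents_closed:
  assumes p: "presents C A B f \<pi> F" and X: "X \<in> fp C" and a: "a \<in> Hom C A X"
  shows "app \<pi> X a \<in> carrier (FO F X)"
  using Cfp.app_closed[OF presentsD(4)[OF p], of X a] X a presentsD(1)[OF p] by (simp add: Hom_Cfp)

lemma restrict_additive_functor:
  assumes E: "additive_functor C Ab E"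
  shows "additive_functor (Cfp C) Ab E"
proof (rule Cfp.additive_functor_AbI)
  show "FO E X \<in> Obj Ab" if "X \<in> Obj (Cfp C)" for X
    using functor_Obj_Ab[OF E fp_Obj] that by simp
  show "FA E f \<in> Hom Ab (FO E X) (FO E Y)" if "f \<in> Hom (Cfp C) X Y" for f X Y
    using functor_Hom_Ab[OF E] Hom_CfpD[OF that] by blast
  show "act E (Ident (Cfp C) X) x = x" if "X \<in> Obj (Cfp C)" "x \<in> carrier (FO E X)" for X x
    using act_Ident[OF E fp_Obj] that by simp
  show "act E (g \<cdot>\<^bsub>Cfp C\<^esub> f) x = act E g (act E f x)"
    if "f \<in> Hom (Cfp C) X Y" "g \<in> Hom (Cfp C) Y Z" "x \<in> carrier (FO E X)" for f g X Y Z x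
    using act_Comp[OF E _ _ that(3), of f Y g Z] Hom_CfpD[OF that(1)] Hom_CfpD[OF that(2)] by simp
  show "act E (f \<^bold>+\<^bsub>Cfp C\<^esub> g) x = act E f x \<otimes>\<^bsub>FO E Y\<^esub> act E g x"
    if "f \<in> Hom (Cfp C) X Y" "g \<in> Hom (Cfp C) X Y" "x \<in> carrier (FO E X)" for f g X Y x
    using act_Add[OF E _ _ that(3), of f Y g] Hom_CfpD[OF that(1)] Hom_CfpD[OF that(2)] by simp
qed

text \<open>
  The cokernel of \<open>(f,-)\<close> taken on all of \<open>\<C>\<close> is an extension of the functor presented by \<open>f\<close>: its
  restriction to \<open>\<C>\<^sup>f\<^sup>p\<close> and this functor are cokernels of the same transformation.
\<close>

lemma extension_exists:
  assumes p: "presents C A B f \<pi> F"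
  shows "\<exists>E. direct_limit_extension C F E"
proof -
  note A = presentsD(1)[OF p] and B = presentsD(2)[OF p] and f = presentsD(3)[OF p]
  define N where "N = (\<lambda>X. app (rep_arrow C f) X ` carrier (FO (rep C B) X))"
  interpret N: subfunctor C "rep C A" N
    unfolding N_def by (rule app_image_subfunctor[OF rep_arrow_Hom[OF f]])
  define E where "E = quot_functor C (rep C A) N"
  define q where "q = quot_proj C (rep C A) N"
  have q: "q \<in> Hom (Fun C) (rep C A) E" unfolding q_def E_def by (rule N.quot_proj_Hom)
  have ex: "exact C (rep_arrow C f) q (rep C B) (rep C A) E"
    unfolding exact_def q_def E_def using N.quot_proj_surj N.quot_proj_one_iff unfolding N_def by blast
  note E = Hom_FunD(2)[OF q]
  have pres: "preserves_direct_limits C E"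
    by (rule exact_preserves_direct_limits[OF universe A B f q ex])
  define q' where "q' = transform (Cfp C) (rep (Cfp C) A) E (app q)"
  have AO: "A \<in> Obj (Cfp C)" and BO: "B \<in> Obj (Cfp C)" using A B by simp_all
  have f': "f \<in> Hom (Cfp C) A B" using A B f by (simp add: Hom_Cfp)
  have q': "q' \<in> Hom (Fun (Cfp C)) (rep (Cfp C) A) E"
    unfolding q'_def
  proof (rule Cfp.transform_Hom[OF Cfp.rep_additive[OF AO] restrict_additive_functor[OF E]])
    fix X assume "X \<in> Obj (Cfp C)"
    then have X: "X \<in> fp C" by simp
    then have "hom_group (Cfp C) A X = hom_group C A X" using A by (simp add: hom_group_def Hom_Cfp)
    then show "app q X \<in> hom (FO (rep (Cfp C) A) X) (FO E X)" using app_hom[OF q fp_Obj[OF X]] by simp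
  next
    fix X Y g x assume g: "g \<in> Hom (Cfp C) X Y" and "x \<in> carrier (FO (rep (Cfp C) A) X)"
    then have x: "x \<in> Hom (Cfp C) A X" by simp
    note g' = Hom_CfpD[OF g] and x' = Hom_CfpD[OF x]
    have "x \<in> carrier (FO (rep C A) X)" using x' by simp
    from app_natural[OF q _ this, of g Y] g'
    show "app q Y (act (rep (Cfp C) A) g x) = act E g (app q X x)"
      by (simp add: act_rep[OF g x] act_rep[of g C X Y x A] x')
  qed
  have q'_at: "app q' X a = app q X a" if "X \<in> fp C" "a \<in> Hom C A X" for X a
    unfolding q'_def by (rule Cfp.app_transform) (use that A in \<open>simp_all add: Hom_Cfp\<close>)
  have "exact (Cfp C) (rep_arrow (Cfp C) f) q' (rep (Cfp C) B) (rep (Cfp C) A) E"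
    unfolding exact_rep_Cfp_iff[OF A B f]
  proof (intro ballI conjI)
    fix X assume X: "X \<in> fp C"
    note XO = fp_Obj[OF X]
    have "app q' X ` Hom C A X = app q X ` Hom C A X" using q'_at[OF X] by (intro image_cong) auto
    then show "app q' X ` Hom C A X = carrier (FO E X)" using ex XO unfolding exact_def by simp
    fix a assume a: "a \<in> Hom C A X"
    have "app q X a = \<one>\<^bsub>FO E X\<^esub> \<longleftrightarrow> a \<in> app (rep_arrow C f) X ` Hom C B X"
      using ex XO a unfolding exact_def by simp
    then show "app q' X a = \<one>\<^bsub>FO E X\<^esub> \<longleftrightarrow> (\<exists>k\<in>Hom C B X. a = k \<cdot> f)"
      unfolding q'_at[OF X a] using app_rep_arrow[OF f XO] by auto
  qed
  then have "is_coequalizer (Fun (Cfp C)) (rep_arrow (Cfp C) f) (zero_trans (Cfp C) (rep (Cfp C) B) (rep (Cfp C) A)) (rep (Cfp C) A) E q'"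
    by (rule Cfp.exact_coequalizer[OF Cfp.rep_arrow_Hom[OF f'] q'])
  moreover have "is_coequalizer (Fun (Cfp C)) (rep_arrow (Cfp C) f) (zero_trans (Cfp C) (rep (Cfp C) B) (rep (Cfp C) A)) (rep (Cfp C) A) F \<pi>"
    by (rule Cfp.exact_coequalizer[OF Cfp.rep_arrow_Hom[OF f'] presentsD(4,5)[OF p]])
  ultimately have "isomorphic (FpMod C) E F"
    unfolding FpMod_def by (rule coequalizer_isomorphic[OF Cfp.category_Fun])
  then show ?thesis unfolding direct_limit_extension_def using E pres by blast
qed

text \<open>
  Let \<open>X\<close> be a direct limit of finitely presented objects \<open>X\<^sub>i\<close>. An arrow \<open>A \<rightarrow> X\<close> factors through
  some \<open>X\<^sub>i\<close> and represents an element of \<open>F(X\<^sub>i)\<close>, hence of the value of the extension at \<open>X\<close>; this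
  element dies at a later stage exactly if the arrow extends along \<open>f\<close> there.
\<close>

lemma extension_trivial_iff:
  assumes p: "presents C A B f \<pi> F" and ext: "direct_limit_extension C F E" and X: "X \<in> Obj C"
  shows "trivial_group (FO E X) \<longleftrightarrow> extends_along C A B f X"
proof -
  note A = presentsD(1)[OF p] and B = presentsD(2)[OF p] and f = presentsD(3)[OF p]
  have E: "additive_functor C Ab E" and pres: "preserves_direct_limits C E" and iso: "isomorphic (Fun (Cfp C)) E F"
    using ext by (auto simp: direct_limit_extension_def FpMod_def)
  obtain \<theta> \<gamma> where th: "\<theta> \<in> Hom (Fun (Cfp C)) E F" and ga: "\<gamma> \<in> Hom (Fun (Cfp C)) F E"
    and inv: "\<gamma> \<cdot>\<^bsub>Fun (Cfp C)\<^esub> \<theta> = Ident (Fun (Cfp C)) E" "\<theta> \<cdot>\<^bsub>Fun (Cfp C)\<^esub> \<gamma> = Ident (Fun (Cfp C)) F"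
    using iso unfolding isomorphic_def iso_arrow_def by blast
  have gt: "app \<gamma> X (app \<theta> X x) = x" if "X \<in> fp C" "x \<in> carrier (FO E X)" for X x
    using Cfp.app_Comp[OF th ga, of X x] inv(1) Cfp.app_Ident[of X x E] that by simp
  have tg: "app \<theta> X (app \<gamma> X y) = y" if "X \<in> fp C" "y \<in> carrier (FO F X)" for X y
    using Cfp.app_Comp[OF ga th, of X y] inv(2) Cfp.app_Ident[of X y F] that by simp
  have ga_one: "app \<gamma> X \<one>\<^bsub>FO F X\<^esub> = \<one>\<^bsub>FO E X\<^esub>" and th_one: "app \<theta> X \<one>\<^bsub>FO E X\<^esub> = \<one>\<^bsub>FO F X\<^esub>" if "X \<in> fp C" for X
    using Cfp.app_one[OF ga] Cfp.app_one[OF th] that by simp_all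
  have th_nat: "app \<theta> Y (act E g x) = act F g (app \<theta> X x)"
    if "X \<in> fp C" "Y \<in> fp C" "g \<in> Hom C X Y" "x \<in> carrier (FO E X)" for X Y g x
    using Cfp.app_natural[OF th _ that(4)] that by (simp add: Hom_Cfp)
  have th_cl: "app \<theta> X x \<in> carrier (FO F X)" if "X \<in> fp C" "x \<in> carrier (FO E X)" for X x
    using Cfp.app_closed[OF th] that by simp
  have ga_cl: "app \<gamma> X x \<in> carrier (FO E X)" if "X \<in> fp C" "x \<in> carrier (FO F X)" for X x
    using Cfp.app_closed[OF ga] that by simp
  obtain \<G> where gen: "generating \<G>" using generators by blast
  obtain J :: "('u, 'u) category" and G c where J: "directed J" and Gfp: "\<And>i. i \<in> Obj J \<Longrightarrow> FO G i \<in> fp C"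
    and co: "is_colimit J C G X c" by (rule generating_colimit[OF gen X]) (rule that)
  interpret EX: comm_group "FO E X" by (rule functor_comm_group[OF E X])
  show ?thesis
  proof
    assume triv: "trivial_group (FO E X)"
    show "extends_along C A B f X"
      unfolding extends_along_def
    proof
      fix h assume h: "h \<in> Hom C A X"
      obtain i a where i: "i \<in> Obj J" "a \<in> Hom C A (FO G i)" "c i \<cdot> a = h" using fp_factor[OF A J co h] .
      define y where "y = app \<gamma> (FO G i) (app \<pi> (FO G i) a)"
      note pa = presents_closed[OF p Gfp[OF i(1)] i(2)]
      have y: "y \<in> carrier (FO E (FO G i))" unfolding y_def by (rule ga_cl[OF Gfp[OF i(1)] pa])
      have "act E (c i) y = \<one>\<^bsub>FO E X\<^esub>"
        using triv act_closed[OF E colimit_component[OF co i(1)] y] by (auto simp: trivial_group_def)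
      then obtain j u where u: "j \<in> Obj J" "u \<in> Hom J i j" "act E (FA G u) y = \<one>\<^bsub>FO E (FO G j)\<^esub>"
        using preserves_direct_limits_dies[OF universe pres J co i(1) y] by blast
      note Gu = diagram_Hom[OF J co u(2)]
      have "app \<pi> (FO G j) (FA G u \<cdot> a) = act F (FA G u) (app \<theta> (FO G i) y)"
        using presents_natural[OF p Gfp[OF i(1)] Gfp[OF u(1)] Gu i(2)] tg[OF Gfp[OF i(1)] pa] by (simp add: y_def)
      also have "\<dots> = \<one>\<^bsub>FO F (FO G j)\<^esub>"
        using th_nat[OF Gfp[OF i(1)] Gfp[OF u(1)] Gu y] u(3) th_one[OF Gfp[OF u(1)]] by simp
      finally obtain k where k: "k \<in> Hom C B (FO G j)" "FA G u \<cdot> a = k \<cdot> f"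
        using presents_kernel[OF p Gfp[OF u(1)] Comp_in_Hom[OF i(2) Gu]] by blast
      note cj = colimit_component[OF co u(1)]
      have "(c j \<cdot> k) \<cdot> f = h"
        using colimit_stage(2)[OF co J u(2) i(2)] i(3) k(2) Comp_assoc[OF f k(1) cj] by simp
      then show "\<exists>k\<in>Hom C B X. k \<cdot> f = h" using Comp_in_Hom[OF k(1) cj] by blast
    qed
  next
    assume inj: "extends_along C A B f X"
    have "y = \<one>\<^bsub>FO E X\<^esub>" if y: "y \<in> carrier (FO E X)" for y
    proof -
      obtain i x where i: "i \<in> Obj J" "x \<in> carrier (FO E (FO G i))" "act E (c i) x = y"
        using preserves_direct_limits_factor[OF pres J co y] .
      note ci = colimit_component[OF co i(1)]
      obtain a where a: "a \<in> Hom C A (FO G i)" "app \<theta> (FO G i) x = app \<pi> (FO G i) a"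
        using presents_surj[OF p Gfp[OF i(1)] th_cl[OF Gfp[OF i(1)] i(2)]] .
      obtain k where k: "k \<in> Hom C B X" "k \<cdot> f = c i \<cdot> a"
        using inj Comp_in_Hom[OF a(1) ci] unfolding extends_along_def by blast
      obtain n t k' where n: "n \<in> Obj J" and t: "t \<in> Hom J i n" and k': "k' \<in> Hom C B (FO G n)" "FA G t \<cdot> a = k' \<cdot> f"
        using fp_extension_at_stage[OF universe A B f J co i(1) a(1) k] .
      note Gt = diagram_Hom[OF J co t] and Gn = Gfp[OF n] and Gi = Gfp[OF i(1)]
      define x' where "x' = act E (FA G t) x"
      have x': "x' \<in> carrier (FO E (FO G n))" unfolding x'_def by (rule act_closed[OF E Gt i(2)])
      have "app \<theta> (FO G n) x' = app \<pi> (FO G n) (FA G t \<cdot> a)"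
        using th_nat[OF Gi Gn Gt i(2)] presents_natural[OF p Gi Gn Gt a(1)] a(2) by (simp add: x'_def)
      also have "\<dots> = \<one>\<^bsub>FO F (FO G n)\<^esub>"
        using presents_kernel[OF p Gn Comp_in_Hom[OF a(1) Gt]] k' by blast
      finally have "x' = \<one>\<^bsub>FO E (FO G n)\<^esub>" using gt[OF Gn x'] ga_one[OF Gn] by simp
      then have "act E (c n) x' = \<one>\<^bsub>FO E X\<^esub>"
        using map_one[OF functor_Hom_Ab[OF E colimit_component[OF co n]]] by simp
      moreover have "act E (c n) x' = y"
        using act_Comp[OF E Gt colimit_component[OF co n] i(2)] colimit_Comp[OF co J t] i(3) by (simp add: x'_def)
      ultimately show ?thesis by simp
    qed
    then show "trivial_group (FO E X)"
      using EX.one_closed EX.is_group unfolding trivial_group_def by blast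
  qed
qed

end

(* The records have operations with the same base name as the extension of a functor; with these
   hidden, the name of the definition denotes the latter. *)
hide_fact bifunctor.extend_def monoidal.extend_def closed_monoidal.extend_def

context finitely_accessible_category
begin

lemma serre_of_iff:
  assumes p: "presents C A B f \<pi> F" and D: "D \<subseteq> Obj C"
  shows "F \<in> serre_of C D \<longleftrightarrow> (\<forall>X\<in>D. extends_along C A B f X)"
proof -
  have "direct_limit_extension C F (SOME E. direct_limit_extension C F E)"
    using someI_ex[OF extension_exists[OF p]] .
  moreover have "F \<in> fp_mod C" using p fp_mod_iff by blast
  ultimately show ?thesis
    using extension_trivial_iff[OF p] D unfolding serre_of_def Defs.extend_def by auto
qed

lemma presented_functor_exists:
  assumes A: "A \<in> fp C" and B: "B \<in> fp C" and f: "f \<in> Hom C A B"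
  obtains F \<pi> where "presents C A B f \<pi> F"
proof -
  have f': "f \<in> Hom (Cfp C) A B" using assms by (simp add: Hom_Cfp)
  define N where "N = (\<lambda>X. app (rep_arrow (Cfp C) f) X ` carrier (FO (rep (Cfp C) B) X))"
  interpret N: subfunctor "Cfp C" "rep (Cfp C) A" N
    unfolding N_def by (rule Cfp.app_image_subfunctor[OF Cfp.rep_arrow_Hom[OF f']])
  have "presents C A B f (quot_proj (Cfp C) (rep (Cfp C) A) N) (quot_functor (Cfp C) (rep (Cfp C) A) N)"
    unfolding presents_def exact_def FpMod_def
    using assms N.quot_proj_Hom N.quot_proj_surj N.quot_proj_one_iff unfolding N_def by blast
  then show thesis by (rule that)
qed

end


section \<open>Definable subcategories are injectivity classes\<close>

lemma product_induced:
  assumes "is_product C I X P p" "W \<in> Obj C" "\<And>i. i \<in> I \<Longrightarrow> q i \<in> Hom C W (X i)"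
  obtains h where "h \<in> Hom C W P" "\<And>i. i \<in> I \<Longrightarrow> p i \<cdot>\<^bsub>C\<^esub> h = q i"
proof -
  have "\<exists>!h. h \<in> Hom C W P \<and> (\<forall>i\<in>I. p i \<cdot>\<^bsub>C\<^esub> h = q i)"
    using assms unfolding is_product_def by simp
  then show thesis using that by blast
qed

lemma product_eqI:
  assumes C: "category C" and P: "is_product C I X P p" and h: "h \<in> Hom C W P" and h': "h' \<in> Hom C W P"
    and eq: "\<And>i. i \<in> I \<Longrightarrow> p i \<cdot>\<^bsub>C\<^esub> h = p i \<cdot>\<^bsub>C\<^esub> h'"
  shows "h = h'"
proof -
  interpret category C by fact
  define q where "q = (\<lambda>i. p i \<cdot>\<^bsub>C\<^esub> h')"
  have "q i \<in> Hom C W (X i)" if "i \<in> I" for i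
    unfolding q_def using P that Comp_in_Hom[OF h'] unfolding is_product_def by blast
  then have "\<exists>!h. h \<in> Hom C W P \<and> (\<forall>i\<in>I. p i \<cdot>\<^bsub>C\<^esub> h = q i)"
    using P Hom_Obj[OF h] unfolding is_product_def by simp
  moreover have "h \<in> Hom C W P \<and> (\<forall>i\<in>I. p i \<cdot>\<^bsub>C\<^esub> h = q i)" using h eq by (simp add: q_def)
  moreover have "h' \<in> Hom C W P \<and> (\<forall>i\<in>I. p i \<cdot>\<^bsub>C\<^esub> h' = q i)" using h' by (simp add: q_def)
  ultimately show ?thesis by blast
qed

context finitely_accessible_category
begin

text \<open>
  In the language of model theory: the pp-type of \<open>x\<close> in \<open>X\<close> is contained in the pp-type of \<open>c\<close> in \<open>Y\<close>.
\<close>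

definition dominated :: "'o set \<Rightarrow> 'o \<Rightarrow> 'o \<Rightarrow> 'u \<Rightarrow> 'o \<Rightarrow> 'u \<Rightarrow> bool" where
  "dominated \<G> A X x Y c \<longleftrightarrow> x \<in> Hom C A X \<and> c \<in> Hom C A Y \<and>
     (\<forall>Z\<in>\<G>. \<forall>u\<in>Hom C A Z. (\<exists>y\<in>Hom C Z X. y \<cdot> u = x) \<longrightarrow> (\<exists>v\<in>Hom C Z Y. v \<cdot> u = c))"

text \<open>
  The object \<open>X\<close> is a direct limit of generators, so \<open>y f = x h\<close> holds already with \<open>x\<close> and \<open>y\<close>
  replaced by arrows \<open>u\<close> and \<open>b\<close> to a generator. By domination \<open>c\<close> is \<open>v u\<close> for some \<open>v\<close>, and then
  \<open>v b\<close> extends \<open>c h\<close> along \<open>f\<close>.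
\<close>

lemma dominated_extends:
  assumes gen: "generating \<G>"
    and dom: "dominated \<G> P X x Y c" and P: "P \<in> fp C" and A: "A \<in> fp C" and B: "B \<in> fp C"
    and f: "f \<in> Hom C A B" and h: "h \<in> Hom C A P" and y: "y \<in> Hom C B X" and eq: "y \<cdot> f = x \<cdot> h"
  obtains v where "v \<in> Hom C B Y" "v \<cdot> f = c \<cdot> h"
proof -
  have x: "x \<in> Hom C P X" using dom by (simp add: dominated_def)
  obtain J :: "('u, 'u) category" and G d where J: "directed J" and G\<G>: "\<And>i. i \<in> Obj J \<Longrightarrow> FO G i \<in> \<G>"
    and co: "is_colimit J C G X d" by (rule generating_colimit[OF gen Hom_Obj(2)[OF x]]) (rule that)
  obtain i b u where i: "i \<in> Obj J" and b: "b \<in> Hom C B (FO G i)" and u: "u \<in> Hom C P (FO G i)"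
    and db: "d i \<cdot> b = y" and du: "d i \<cdot> u = x" using fp_factor2[OF B P J co y x] .
  note di = colimit_component[OF co i]
  have "d i \<cdot> (b \<cdot> f) = d i \<cdot> (u \<cdot> h)"
    using eq db du Comp_assoc[OF f b di] Comp_assoc[OF h u di] by simp
  then obtain j w where j: "j \<in> Obj J" "w \<in> Hom J i j" and w: "FA G w \<cdot> (b \<cdot> f) = FA G w \<cdot> (u \<cdot> h)"
    using fp_merge[OF universe A J co i Comp_in_Hom[OF f b] Comp_in_Hom[OF h u]] by blast
  note Gw = diagram_Hom[OF J co j(2)]
  note wu = colimit_stage[OF co J j(2) u]
  note G\<G>[OF j(1)]
  moreover have "d j \<cdot> (FA G w \<cdot> u) = x" using wu(2) du by simp
  ultimately obtain v where v: "v \<in> Hom C (FO G j) Y" "v \<cdot> (FA G w \<cdot> u) = c"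
    using dom wu(1) colimit_component[OF co j(1)] unfolding dominated_def by blast
  have "(v \<cdot> (FA G w \<cdot> b)) \<cdot> f = v \<cdot> (FA G w \<cdot> (b \<cdot> f))"
    using Comp_assoc[OF f Comp_in_Hom[OF b Gw] v(1)] Comp_assoc[OF f b Gw] by simp
  also have "\<dots> = c \<cdot> h"
    unfolding w using Comp_assoc[OF h Comp_in_Hom[OF u Gw] v(1)] Comp_assoc[OF h u Gw] v(2) by simp
  finally show thesis using that Comp_in_Hom[OF Comp_in_Hom[OF b Gw] v(1)] by blast
qed

text \<open>The same argument for the relation \<open>x a = x b\<close>.\<close>

lemma dominated_mono:
  assumes gen: "generating \<G>"
    and dom: "dominated \<G> P X x Y c" and P: "P \<in> fp C" and A: "A \<in> fp C"
    and a: "a \<in> Hom C A P" and b: "b \<in> Hom C A P" and eq: "x \<cdot> a = x \<cdot> b"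
  shows "c \<cdot> a = c \<cdot> b"
proof -
  have x: "x \<in> Hom C P X" using dom by (simp add: dominated_def)
  obtain J :: "('u, 'u) category" and G d where J: "directed J" and G\<G>: "\<And>i. i \<in> Obj J \<Longrightarrow> FO G i \<in> \<G>"
    and co: "is_colimit J C G X d" by (rule generating_colimit[OF gen Hom_Obj(2)[OF x]]) (rule that)
  obtain i u where i: "i \<in> Obj J" and u: "u \<in> Hom C P (FO G i)" and du: "d i \<cdot> u = x"
    using fp_factor[OF P J co x] .
  note di = colimit_component[OF co i]
  have "d i \<cdot> (u \<cdot> a) = d i \<cdot> (u \<cdot> b)"
    using eq du Comp_assoc[OF a u di] Comp_assoc[OF b u di] by simp
  then obtain j w where j: "j \<in> Obj J" "w \<in> Hom J i j" and w: "FA G w \<cdot> (u \<cdot> a) = FA G w \<cdot> (u \<cdot> b)"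
    using fp_merge[OF universe A J co i Comp_in_Hom[OF a u] Comp_in_Hom[OF b u]] by blast
  note Gw = diagram_Hom[OF J co j(2)]
  note wu = colimit_stage[OF co J j(2) u]
  note G\<G>[OF j(1)]
  moreover have "d j \<cdot> (FA G w \<cdot> u) = x" using wu(2) du by simp
  ultimately obtain v where v: "v \<in> Hom C (FO G j) Y" "v \<cdot> (FA G w \<cdot> u) = c"
    using dom wu(1) colimit_component[OF co j(1)] unfolding dominated_def by blast
  have "c \<cdot> a = v \<cdot> (FA G w \<cdot> (u \<cdot> a))"
    using Comp_assoc[OF a Comp_in_Hom[OF u Gw] v(1)] Comp_assoc[OF a u Gw] v(2) by simp
  also have "\<dots> = c \<cdot> b"
    unfolding w using Comp_assoc[OF b Comp_in_Hom[OF u Gw] v(1)] Comp_assoc[OF b u Gw] v(2) by simp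
  finally show ?thesis .
qed

text \<open>
  For each arrow \<open>u\<close> to a generator through which \<open>c\<close> does not factor, some arrow from \<open>A\<close> to an
  object of the subcategory does not factor through \<open>u\<close> either. These arrows, one for each \<open>u\<close>, are the
  components of an arrow to a product that factors through none of the \<open>u\<close>.
\<close>

lemma dominated_exists:
  assumes gen: "generating \<G>" "\<And>A. A \<in> Obj C \<Longrightarrow> small {u \<in> Arr C. Dom C u = A \<and> Cod C u \<in> \<G>}"
    and prods: "has_products C" and D: "definable C D" and A: "A \<in> fp C" and c: "c \<in> Hom C A Y"
    and inj: "\<And>A B f. \<lbrakk>A \<in> fp C; B \<in> fp C; f \<in> Hom C A B; \<forall>X\<in>D. extends_along C A B f X\<rbrakk>
        \<Longrightarrow> extends_along C A B f Y"
  obtains X x where "X \<in> D" "dominated \<G> A X x Y c"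
proof -
  define U where "U = {u \<in> Arr C. Dom C u = A \<and> Cod C u \<in> \<G> \<and> \<not> (\<exists>v\<in>Hom C (Cod C u) Y. v \<cdot> u = c)}"
  have smU: "small U" by (rule small_subset[OF gen(2)[OF fp_Obj[OF A]]]) (auto simp: U_def)
  have "\<exists>X x. X \<in> D \<and> x \<in> Hom C A X \<and> \<not> (\<exists>k\<in>Hom C (Cod C u) X. k \<cdot> u = x)" if u: "u \<in> U" for u
  proof -
    have uH: "u \<in> Hom C A (Cod C u)" and uG: "Cod C u \<in> fp C" using u gen(1) by (auto simp: U_def Hom_def generating_def)
    have "\<not> extends_along C A (Cod C u) u Y" using u c unfolding U_def extends_along_def by blast
    then have "\<not> (\<forall>X\<in>D. extends_along C A (Cod C u) u X)" using inj[OF A uG uH] by blast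
    then show ?thesis unfolding extends_along_def by blast
  qed
  then obtain W w where W: "\<And>u. u \<in> U \<Longrightarrow> W u \<in> D" and w: "\<And>u. u \<in> U \<Longrightarrow> w u \<in> Hom C A (W u)"
    and nf: "\<And>u. u \<in> U \<Longrightarrow> \<not> (\<exists>k\<in>Hom C (Cod C u) (W u). k \<cdot> u = w u)" by metis
  have "W ` U \<subseteq> Obj C" using W D by (auto simp: definable_def)
  then obtain X p where prod: "is_product C U W X p" using prods smU unfolding has_products_def by blast
  have XD: "X \<in> D" using D smU W prod unfolding definable_def by blast
  obtain x where x: "x \<in> Hom C A X" "\<And>u. u \<in> U \<Longrightarrow> p u \<cdot> x = w u"
    using product_induced[OF prod fp_Obj[OF A] w] by metis
  have "dominated \<G> A X x Y c"
    unfolding dominated_def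
  proof (intro conjI ballI impI x c)
    fix Z u assume Z: "Z \<in> \<G>" and u: "u \<in> Hom C A Z" and "\<exists>y\<in>Hom C Z X. y \<cdot> u = x"
    then obtain y where y: "y \<in> Hom C Z X" "y \<cdot> u = x" by blast
    have dc: "u \<in> Arr C" "Dom C u = A" "Cod C u = Z" using u by (auto simp: Hom_def)
    have "u \<notin> U"
    proof
      assume uU: "u \<in> U"
      have pu: "p u \<in> Hom C X (W u)" using prod uU unfolding is_product_def by blast
      have "(p u \<cdot> y) \<cdot> u = w u" using Comp_assoc[OF u y(1) pu] y(2) x(2)[OF uU] by simp
      then show False using nf[OF uU] Comp_in_Hom[OF y(1) pu] dc by auto
    qed
    then show "\<exists>v\<in>Hom C Z Y. v \<cdot> u = c" using dc Z by (auto simp: U_def)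
  qed
  then show thesis using that XD by blast
qed

text \<open>
  Arrows out of an arbitrary object are determined by their composites with arrows from finitely
  presented objects, so cancellation has to be checked for the latter only.
\<close>

lemma pure_monoI:
  assumes m: "m \<in> Hom C X Y"
    and inj: "\<And>A a b. \<lbrakk>A \<in> fp C; a \<in> Hom C A X; b \<in> Hom C A X; m \<cdot> a = m \<cdot> b\<rbrakk> \<Longrightarrow> a = b"
    and pure: "\<And>A B f h h'. \<lbrakk>A \<in> fp C; B \<in> fp C; f \<in> Hom C A B; h \<in> Hom C A X; h' \<in> Hom C B Y;
        h' \<cdot> f = m \<cdot> h\<rbrakk> \<Longrightarrow> \<exists>k\<in>Hom C B X. k \<cdot> f = h"
  shows "pure_mono C X Y m"
proof -
  have "a = b" if W: "W \<in> Obj C" and a: "a \<in> Hom C W X" and b: "b \<in> Hom C W X" and eq: "m \<cdot> a = m \<cdot> b" for W a b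
  proof -
    obtain \<G> where gen: "generating \<G>" using generators by blast
    obtain J :: "('u, 'u) category" and G c where J: "directed J" and Gfp: "\<And>i. i \<in> Obj J \<Longrightarrow> FO G i \<in> fp C"
      and co: "is_colimit J C G W c" by (rule generating_colimit[OF gen W]) (rule that)
    have ci: "c i \<in> Hom C (FO G i) W" if "i \<in> Obj J" for i by (rule colimit_component[OF co that])
    have same: "b \<cdot> c i = a \<cdot> c i" if i: "i \<in> Obj J" for i
    proof (rule inj[symmetric])
      show "FO G i \<in> fp C" by (rule Gfp[OF i])
      show "a \<cdot> c i \<in> Hom C (FO G i) X" "b \<cdot> c i \<in> Hom C (FO G i) X"
        using Comp_in_Hom[OF ci[OF i]] a b by blast+
      show "m \<cdot> (a \<cdot> c i) = m \<cdot> (b \<cdot> c i)" using Comp_assoc[OF ci[OF i] a m] Comp_assoc[OF ci[OF i] b m] eq by simp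
    qed
    have "is_cocone J C G X (\<lambda>i. a \<cdot> c i)"
      unfolding is_cocone_def
    proof (intro conjI ballI cocone_functor[OF colimit_cocone[OF co]] Hom_Obj(2)[OF a] Comp_in_Hom[OF ci a])
      fix i j u assume i: "i \<in> Obj J" and j: "j \<in> Obj J" and u: "u \<in> Hom J i j"
      show "(a \<cdot> c j) \<cdot> FA G u = a \<cdot> c i"
        using Comp_assoc[OF diagram_Hom[OF J co u] ci[OF j] a] colimit_Comp[OF co J u] by simp
    qed
    from colimit_unique[OF co this a _ b] show ?thesis using same by blast
  qed
  then show ?thesis unfolding pure_mono_def mono_arrow_def using m pure by blast
qed

end


context finitely_accessible_category
begin

text \<open>
  Write \<open>Y\<close> as a direct limit of generators \<open>G\<^sub>i\<close> with structure arrows \<open>c\<^sub>i\<close>, and choose arrows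
  \<open>x\<^sub>i : G\<^sub>i \<rightarrow> X\<^sub>i\<close> into the subcategory that are dominated by the \<open>c\<^sub>i\<close>. The products \<open>Q\<^sub>i\<close> of all \<open>X\<^sub>j\<close>
  with \<open>j \<ge> i\<close> form a directed system under the projections, and the \<open>x\<^sub>j\<close> induce an arrow from
  \<open>Y\<close> to the direct limit of the \<open>Q\<^sub>i\<close>, which lies in the subcategory. This arrow is a pure
  monomorphism: a relation in the limit holds in \<open>Q\<^sub>i\<close> for some \<open>i\<close>, and its component at the index
  \<open>i\<close> itself is a relation of \<open>x\<^sub>i\<close>, hence one of \<open>c\<^sub>i\<close>.
\<close>

lemma definable_contains:
  assumes prods: "has_products C" and D: "definable C D" and Y: "Y \<in> Obj C"
    and inj: "\<And>A B f. \<lbrakk>A \<in> fp C; B \<in> fp C; f \<in> Hom C A B; \<forall>X\<in>D. extends_along C A B f X\<rbrakk>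
        \<Longrightarrow> extends_along C A B f Y"
  shows "Y \<in> D"
proof -
  obtain \<G> where gen: "generating \<G>" "\<And>A. A \<in> Obj C \<Longrightarrow> small {u \<in> Arr C. Dom C u = A \<and> Cod C u \<in> \<G>}"
    by (rule generators) (rule that; blast)
  obtain J :: "('u, 'u) category" and G c where J: "directed J" and Gfp: "\<And>i. i \<in> Obj J \<Longrightarrow> FO G i \<in> fp C"
    and co: "is_colimit J C G Y c" by (rule generating_colimit[OF gen(1) Y]) (rule that)
  interpret J: category J using J by (rule directed_category)
  note cJ = J.category_axioms
  note Gfun = cocone_functor[OF colimit_cocone[OF co]]
  note c = colimit_component[OF co]
  have DO: "D \<subseteq> Obj C" using D by (simp add: definable_def)
  have "\<exists>X x. X \<in> D \<and> dominated \<G> (FO G i) X x Y (c i)" if i: "i \<in> Obj J" for i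
    by (rule dominated_exists[OF gen(1,2) prods D Gfp[OF i] c[OF i] inj]) blast+
  then obtain X x where XD: "\<And>i. i \<in> Obj J \<Longrightarrow> X i \<in> D"
    and dom: "\<And>i. i \<in> Obj J \<Longrightarrow> dominated \<G> (FO G i) (X i) (x i) Y (c i)" by metis
  have x: "x i \<in> Hom C (FO G i) (X i)" if "i \<in> Obj J" for i using dom[OF that] by (simp add: dominated_def)
  define S where "S = (\<lambda>i. {j \<in> Obj J. Hom J i j \<noteq> {}})"
  have smS: "small (S i)" for i
    by (rule small_subset[of "Obj J"]) (use J in \<open>auto simp: S_def directed_def small_category_def\<close>)
  have S_mono: "S j \<subseteq> S i" if "u \<in> Hom J i j" for i j u
    unfolding S_def using J.Comp_in_Hom[OF that] by blast
  have S_self: "i \<in> S i" if "i \<in> Obj J" for i unfolding S_def using J.Ident_in_Hom[OF that] that by auto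
  have SJ: "S i \<subseteq> Obj J" for i by (auto simp: S_def)
  have "\<exists>Q p. is_product C (S i) X Q p" for i
    using prods smS[of i] XD DO SJ[of i] unfolding has_products_def by blast
  then obtain Q p where prod: "\<And>i. is_product C (S i) X (Q i) (p i)" by metis
  have QD: "Q i \<in> D" for i using D smS[of i] XD SJ[of i] prod[of i] unfolding definable_def by blast
  then have QO: "Q i \<in> Obj C" for i using DO by blast
  have p: "p i k \<in> Hom C (Q i) (X k)" if "k \<in> S i" for i k using prod[of i] that unfolding is_product_def by blast
  have "\<exists>r. r \<in> Hom C (Q i) (Q j) \<and> (\<forall>k\<in>S j. p j k \<cdot> r = p i k)" if u: "u \<in> Hom J i j" for i j u
    using product_induced[OF prod QO[of i], of j "p i"] p S_mono[OF u] by (metis subsetD)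
  then have "\<exists>r. r \<in> Hom C (Q (Dom J u)) (Q (Cod J u)) \<and> (\<forall>k\<in>S (Cod J u). p (Cod J u) k \<cdot> r = p (Dom J u) k)"
    if "u \<in> Arr J" for u using that by (auto simp: Hom_def)
  then obtain r where "\<And>u. u \<in> Arr J \<Longrightarrow> r u \<in> Hom C (Q (Dom J u)) (Q (Cod J u)) \<and>
      (\<forall>k\<in>S (Cod J u). p (Cod J u) k \<cdot> r u = p (Dom J u) k)" by metis
  then have r: "r u \<in> Hom C (Q i) (Q j)" and pr: "\<And>k. k \<in> S j \<Longrightarrow> p j k \<cdot> r u = p i k" if "u \<in> Hom J i j" for u i j
    using that by (auto simp: Hom_def)
  define H where "H = \<lparr>FO = Q, FA = r\<rparr>"
  have H: "is_functor J C H"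
    unfolding is_functor_def H_def func.simps
  proof (intro conjI ballI QO r)
    fix i assume i: "i \<in> Obj J"
    show "r (Ident J i) = Ident C (Q i)"
      by (rule product_eqI[OF category_axioms prod r[OF J.Ident_in_Hom[OF i]] Ident_in_Hom[OF QO]])
        (use pr[OF J.Ident_in_Hom[OF i]] Comp_Ident[OF p] in auto)
  next
    fix i j k u v assume u: "u \<in> Hom J i j" and v: "v \<in> Hom J j k"
    show "r (v \<cdot>\<^bsub>J\<^esub> u) = r v \<cdot> r u"
    proof (rule product_eqI[OF category_axioms prod r[OF J.Comp_in_Hom[OF u v]] Comp_in_Hom[OF r[OF u] r[OF v]]])
      fix l assume l: "l \<in> S k"
      then have lj: "l \<in> S j" using S_mono[OF v] by blast
      show "p k l \<cdot> r (v \<cdot>\<^bsub>J\<^esub> u) = p k l \<cdot> (r v \<cdot> r u)"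
        using pr[OF J.Comp_in_Hom[OF u v] l] pr[OF v l] pr[OF u lj] Comp_assoc[OF r[OF u] r[OF v] p[OF l]] by simp
    qed
  qed
  have "has_direct_limits C" using accessible by (simp add: finitely_accessible_def)
  then have "\<exists>L q. is_colimit J C H L q" using J H by (simp add: has_direct_limits_def)
  then obtain L q where L: "is_colimit J C H L q" by blast
  have "FO H ` Obj J \<subseteq> D" using QD by (auto simp: H_def)
  then have LD: "L \<in> D" using D J L unfolding definable_def by blast
  have q: "q i \<in> Hom C (Q i) L" if "i \<in> Obj J" for i using colimit_component[OF L that] by (simp add: H_def)
  \<comment> \<open>The transition arrow \<open>G\<^sub>i \<rightarrow> G\<^sub>k\<close>, which is the same for every choice.\<close>
  define g where "g = (\<lambda>i k. FA G (SOME u. u \<in> Hom J i k))"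
  have g_at: "g i k = FA G u" if "u \<in> Hom J i k" for i k u
  proof -
    have "(SOME u. u \<in> Hom J i k) = u" using that directed_thin[OF J] by blast
    then show ?thesis by (simp add: g_def)
  qed
  have FG: "FA G u \<in> Hom C (FO G i) (FO G j)" if "u \<in> Hom J i j" for i j u by (rule diagram_Hom[OF J co that])
  have xg: "x k \<cdot> g i k \<in> Hom C (FO G i) (X k)" if k: "k \<in> S i" for i k
  proof -
    obtain u where u: "u \<in> Hom J i k" using k by (auto simp: S_def)
    show ?thesis unfolding g_at[OF u] by (rule Comp_in_Hom[OF FG[OF u] x[OF J.Hom_Obj(2)[OF u]]])
  qed
  have "\<exists>m. m \<in> Hom C (FO G i) (Q i) \<and> (\<forall>k\<in>S i. p i k \<cdot> m = x k \<cdot> g i k)" if i: "i \<in> Obj J" for i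
    using product_induced[OF prod fp_Obj[OF Gfp[OF i]], of i "\<lambda>k. x k \<cdot> g i k"] xg by metis
  then obtain m where m: "\<And>i. i \<in> Obj J \<Longrightarrow> m i \<in> Hom C (FO G i) (Q i)"
    and pm: "\<And>i k. i \<in> Obj J \<Longrightarrow> k \<in> S i \<Longrightarrow> p i k \<cdot> m i = x k \<cdot> g i k" by metis
  have m_nat: "m j \<cdot> FA G u = r u \<cdot> m i" if u: "u \<in> Hom J i j" for i j u
  proof (rule product_eqI[OF category_axioms prod Comp_in_Hom[OF FG[OF u] m] Comp_in_Hom[OF m r[OF u]]])
    note ij = J.Hom_Obj[OF u]
    show "j \<in> Obj J" "i \<in> Obj J" by fact+
    fix k assume k: "k \<in> S j"
    then obtain v where v: "v \<in> Hom J j k" by (auto simp: S_def)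
    have ki: "k \<in> S i" using S_mono[OF u] k by blast
    have gi: "g i k = FA G v \<cdot> FA G u"
      using g_at[OF J.Comp_in_Hom[OF u v]] is_functor_Comp[OF Gfun cJ u v] by simp
    have "p j k \<cdot> (m j \<cdot> FA G u) = (x k \<cdot> FA G v) \<cdot> FA G u"
      using Comp_assoc[OF FG[OF u] m[OF ij(2)] p[OF k]] pm[OF ij(2) k] g_at[OF v] by simp
    also have "\<dots> = p i k \<cdot> m i"
      using Comp_assoc[OF FG[OF u] FG[OF v] x[OF J.Hom_Obj(2)[OF v]]] pm[OF ij(1) ki] gi by simp
    also have "\<dots> = p j k \<cdot> (r u \<cdot> m i)"
      using Comp_assoc[OF m[OF ij(1)] r[OF u] p[OF k]] pr[OF u k] by simp
    finally show "p j k \<cdot> (m j \<cdot> FA G u) = p j k \<cdot> (r u \<cdot> m i)" .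
  qed
  have mcone: "is_cocone J C G L (\<lambda>i. q i \<cdot> m i)"
    unfolding is_cocone_def
  proof (intro conjI ballI Gfun Comp_in_Hom[OF m q])
    show "L \<in> Obj C" using LD DO by blast
    fix i j u assume i: "i \<in> Obj J" and j: "j \<in> Obj J" and u: "u \<in> Hom J i j"
    have "q j \<cdot> r u = q i" using colimit_Comp[OF L J u] by (simp add: H_def)
    then show "(q j \<cdot> m j) \<cdot> FA G u = q i \<cdot> m i"
      using Comp_assoc[OF FG[OF u] m[OF j] q[OF j]] m_nat[OF u] Comp_assoc[OF m[OF i] r[OF u] q[OF j]] by simp
  qed
  obtain M where M: "M \<in> Hom C Y L" and Mc: "\<And>i. i \<in> Obj J \<Longrightarrow> M \<cdot> c i = q i \<cdot> m i"
    by (rule colimit_induced[OF co mcone]) (rule that; blast)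
  have Mch: "M \<cdot> (c i \<cdot> h) = q i \<cdot> (m i \<cdot> h)" if i: "i \<in> Obj J" and h: "h \<in> Hom C A (FO G i)" for i h A
    using Comp_assoc[OF h c[OF i] M] Mc[OF i] Comp_assoc[OF h m[OF i] q[OF i]] by simp
  \<comment> \<open>At the index \<open>n\<close> itself the arrow into the product \<open>Q\<^sub>n\<close> is \<open>x\<^sub>n\<close>.\<close>
  have pn: "p n n \<cdot> m n = x n" if n: "n \<in> Obj J" for n
  proof -
    have "g n n = Ident C (FO G n)"
      using g_at[OF J.Ident_in_Hom[OF n]] Gfun n by (simp add: is_functor_def)
    then show ?thesis using pm[OF n S_self[OF n]] Comp_Ident[OF x[OF n]] by simp
  qed
  have "pure_mono C Y L M"
  proof (rule pure_monoI[OF M])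
    fix A a b assume A: "A \<in> fp C" and a: "a \<in> Hom C A Y" and b: "b \<in> Hom C A Y" and eq: "M \<cdot> a = M \<cdot> b"
    obtain i a0 b0 where i: "i \<in> Obj J" and a0: "a0 \<in> Hom C A (FO G i)" and b0: "b0 \<in> Hom C A (FO G i)"
      and ca: "c i \<cdot> a0 = a" and cb: "c i \<cdot> b0 = b" using fp_factor2[OF A A J co a b] .
    have ma: "m i \<cdot> a0 \<in> Hom C A (FO H i)" and mb: "m i \<cdot> b0 \<in> Hom C A (FO H i)"
      using Comp_in_Hom[OF a0 m[OF i]] Comp_in_Hom[OF b0 m[OF i]] by (simp_all add: H_def)
    have "q i \<cdot> (m i \<cdot> a0) = q i \<cdot> (m i \<cdot> b0)" using Mch[OF i a0] Mch[OF i b0] ca cb eq by simp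
    then obtain n w where n: "n \<in> Obj J" and w: "w \<in> Hom J i n" and "FA H w \<cdot> (m i \<cdot> a0) = FA H w \<cdot> (m i \<cdot> b0)"
      using fp_merge[OF universe A J L i ma mb] by blast
    then have weq: "r w \<cdot> (m i \<cdot> a0) = r w \<cdot> (m i \<cdot> b0)" by (simp add: H_def)
    have at_n: "x n \<cdot> (FA G w \<cdot> h) = p n n \<cdot> (r w \<cdot> (m i \<cdot> h))" if h: "h \<in> Hom C A (FO G i)" for h
      using pn[OF n] m_nat[OF w] Comp_assoc[OF h m[OF i] r[OF w]] Comp_assoc[OF h FG[OF w] m[OF n]]
        Comp_assoc[OF Comp_in_Hom[OF h FG[OF w]] m[OF n] p[OF S_self[OF n]]] by simp
    have xeq: "x n \<cdot> (FA G w \<cdot> a0) = x n \<cdot> (FA G w \<cdot> b0)"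
      unfolding at_n[OF a0] at_n[OF b0] weq ..
    have "c n \<cdot> (FA G w \<cdot> a0) = c n \<cdot> (FA G w \<cdot> b0)"
      by (rule dominated_mono[OF gen(1) dom[OF n] Gfp[OF n] A Comp_in_Hom[OF a0 FG[OF w]]
            Comp_in_Hom[OF b0 FG[OF w]] xeq])
    then show "a = b" using colimit_stage(2)[OF co J w a0] colimit_stage(2)[OF co J w b0] ca cb by simp
  next
    fix A B f h h'
    assume A: "A \<in> fp C" and B: "B \<in> fp C" and f: "f \<in> Hom C A B" and h: "h \<in> Hom C A Y" and h': "h' \<in> Hom C B L"
      and eq: "h' \<cdot> f = M \<cdot> h"
    obtain i0 h0 where i0: "i0 \<in> Obj J" "h0 \<in> Hom C A (FO G i0)" "c i0 \<cdot> h0 = h" using fp_factor[OF A J co h] .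
    obtain j0 k0 where j0: "j0 \<in> Obj J" "k0 \<in> Hom C B (FO H j0)" "q j0 \<cdot> k0 = h'" using fp_factor[OF B J L h'] .
    obtain i u v where i: "i \<in> Obj J" and u: "u \<in> Hom J i0 i" and v: "v \<in> Hom J j0 i" using directed_upper_bound[OF J i0(1) j0(1)] .
    define h1 where "h1 = FA G u \<cdot> h0"
    define k1 where "k1 = FA H v \<cdot> k0"
    have h1: "h1 \<in> Hom C A (FO G i)" "c i \<cdot> h1 = h" using colimit_stage[OF co J u i0(2)] i0(3) by (simp_all add: h1_def)
    have k1: "k1 \<in> Hom C B (Q i)" "q i \<cdot> k1 = h'" using colimit_stage[OF L J v j0(2)] j0(3) by (simp_all add: k1_def) (simp add: H_def)
    have mh: "m i \<cdot> h1 \<in> Hom C A (FO H i)" and kf: "k1 \<cdot> f \<in> Hom C A (FO H i)"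
      using Comp_in_Hom[OF h1(1) m[OF i]] Comp_in_Hom[OF f k1(1)] by (simp_all add: H_def)
    have "q i \<cdot> (k1 \<cdot> f) = q i \<cdot> (m i \<cdot> h1)"
      using Comp_assoc[OF f k1(1) q[OF i]] k1(2) eq Mch[OF i h1(1)] h1(2) by simp
    then obtain n w where n: "n \<in> Obj J" and w: "w \<in> Hom J i n" and "FA H w \<cdot> (k1 \<cdot> f) = FA H w \<cdot> (m i \<cdot> h1)"
      using fp_merge[OF universe A J L i kf mh] by blast
    then have weq: "r w \<cdot> (k1 \<cdot> f) = r w \<cdot> (m i \<cdot> h1)" by (simp add: H_def)
    note rk = Comp_in_Hom[OF k1(1) r[OF w]]
    note pnn = p[OF S_self[OF n]]
    note Gh = Comp_in_Hom[OF h1(1) FG[OF w]]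
    have "(p n n \<cdot> (r w \<cdot> k1)) \<cdot> f = p n n \<cdot> (r w \<cdot> (k1 \<cdot> f))"
      using Comp_assoc[OF f rk pnn] Comp_assoc[OF f k1(1) r[OF w]] by simp
    also have "\<dots> = x n \<cdot> (FA G w \<cdot> h1)"
      unfolding weq using pn[OF n] m_nat[OF w] Comp_assoc[OF h1(1) m[OF i] r[OF w]]
        Comp_assoc[OF h1(1) FG[OF w] m[OF n]] Comp_assoc[OF Gh m[OF n] pnn] by simp
    finally obtain v where "v \<in> Hom C B Y" "v \<cdot> f = c n \<cdot> (FA G w \<cdot> h1)"
      using dominated_extends[OF gen(1) dom[OF n] Gfp[OF n] A B f Gh Comp_in_Hom[OF rk pnn]] by blast
    then show "\<exists>k\<in>Hom C B Y. k \<cdot> f = h" using colimit_stage(2)[OF co J w h1(1)] h1(2) by auto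
  qed
  then show ?thesis using D Y LD unfolding definable_def by blast
qed

end


section \<open>Right exactness of Day convolution\<close>

lemma parallel_pair_exists:
  assumes "universe TYPE('u)"
  obtains o1 o2 f1 f2 :: 'u where "parallel_pair o1 o2 f1 f2"
proof -
  obtain s :: "nat \<Rightarrow> 'u" where "inj s"
    using infinite_countable_subset[OF universe_infinite[OF assms]] by blast
  then have "parallel_pair (s 0) (s 1) (s 2) (s 3)"
    by unfold_locales (simp add: inj_eq)
  then show thesis by (rule that)
qed

locale day_convolution_product = finitely_accessible_category C
  for C :: "('o, 'u, 'x) ab_category_scheme" (structure) +
  fixes M :: "('o, 'u, 'y) monoidal_scheme"
    and T :: "(('o, 'u) ab_func, ('o, 'u) ab_transf) bifunctor"
  assumes day: "day_convolution C M T"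
    and bifunctor: "additive_bifunctor C M"
    and fp_closed: "full_monoidal_subcategory C M (fp C)"
begin

abbreviation (input) \<K> :: "(('o, 'u) ab_func, ('o, 'u) ab_transf) ab_category" where
  "\<K> \<equiv> Fun (Cfp C)"

abbreviation (input) R :: "'o \<Rightarrow> ('o, 'u) ab_func" where
  "R \<equiv> rep (Cfp C)"

lemma T_bifunctor: "additive_bifunctor \<K> T"
  using day by (simp add: day_convolution_def FpMod_def)

lemma T_Obj: "F \<in> Obj \<K> \<Longrightarrow> G \<in> Obj \<K> \<Longrightarrow> TO T F G \<in> Obj \<K>"
  using T_bifunctor by (simp add: additive_bifunctor_def)

lemma T_Ident: "F \<in> Obj \<K> \<Longrightarrow> G \<in> Obj \<K> \<Longrightarrow> TA T (Ident \<K> F) (Ident \<K> G) = Ident \<K> (TO T F G)"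
  using T_bifunctor by (simp add: additive_bifunctor_def)

lemma T_arrows:
  assumes s: "\<sigma> \<in> Hom \<K> F F'" and t: "\<tau> \<in> Hom \<K> G G'"
  shows "TA T \<sigma> \<tau> \<in> Hom \<K> (TO T F G) (TO T F' G')"
    and "\<sigma>' \<in> Hom \<K> F F' \<Longrightarrow> TA T (\<sigma> \<^bold>+\<^bsub>\<K>\<^esub> \<sigma>') \<tau> = TA T \<sigma> \<tau> \<^bold>+\<^bsub>\<K>\<^esub> TA T \<sigma>' \<tau>"
    and "\<tau>' \<in> Hom \<K> G G' \<Longrightarrow> TA T \<sigma> (\<tau> \<^bold>+\<^bsub>\<K>\<^esub> \<tau>') = TA T \<sigma> \<tau> \<^bold>+\<^bsub>\<K>\<^esub> TA T \<sigma> \<tau>'"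
    and "\<phi> \<in> Hom \<K> F' F'' \<Longrightarrow> \<psi> \<in> Hom \<K> G' G'' \<Longrightarrow>
      TA T (\<phi> \<cdot>\<^bsub>\<K>\<^esub> \<sigma>) (\<psi> \<cdot>\<^bsub>\<K>\<^esub> \<tau>) = TA T \<phi> \<psi> \<cdot>\<^bsub>\<K>\<^esub> TA T \<sigma> \<tau>"
proof -
  interpret K: category \<K> by (rule Cfp.category_Fun)
  note o = K.Hom_Obj[OF s] K.Hom_Obj[OF t]
  have *: "TA T \<sigma> \<tau> \<in> Hom \<K> (TO T F G) (TO T F' G') \<and>
        (\<forall>f'\<in>Hom \<K> F F'. TA T (\<sigma> \<^bold>+\<^bsub>\<K>\<^esub> f') \<tau> = TA T \<sigma> \<tau> \<^bold>+\<^bsub>\<K>\<^esub> TA T f' \<tau>) \<and>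
        (\<forall>g'\<in>Hom \<K> G G'. TA T \<sigma> (\<tau> \<^bold>+\<^bsub>\<K>\<^esub> g') = TA T \<sigma> \<tau> \<^bold>+\<^bsub>\<K>\<^esub> TA T \<sigma> g') \<and>
        (\<forall>X''\<in>Obj \<K>. \<forall>Y''\<in>Obj \<K>. \<forall>f'\<in>Hom \<K> F' X''. \<forall>g'\<in>Hom \<K> G' Y''.
           TA T (f' \<cdot>\<^bsub>\<K>\<^esub> \<sigma>) (g' \<cdot>\<^bsub>\<K>\<^esub> \<tau>) = TA T f' g' \<cdot>\<^bsub>\<K>\<^esub> TA T \<sigma> \<tau>)"
    using T_bifunctor s t o unfolding additive_bifunctor_def by simp
  then show "TA T \<sigma> \<tau> \<in> Hom \<K> (TO T F G) (TO T F' G')" by simp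
  show "\<sigma>' \<in> Hom \<K> F F' \<Longrightarrow> TA T (\<sigma> \<^bold>+\<^bsub>\<K>\<^esub> \<sigma>') \<tau> = TA T \<sigma> \<tau> \<^bold>+\<^bsub>\<K>\<^esub> TA T \<sigma>' \<tau>" using * by simp
  show "\<tau>' \<in> Hom \<K> G G' \<Longrightarrow> TA T \<sigma> (\<tau> \<^bold>+\<^bsub>\<K>\<^esub> \<tau>') = TA T \<sigma> \<tau> \<^bold>+\<^bsub>\<K>\<^esub> TA T \<sigma> \<tau>'" using * by simp
  show "TA T (\<phi> \<cdot>\<^bsub>\<K>\<^esub> \<sigma>) (\<psi> \<cdot>\<^bsub>\<K>\<^esub> \<tau>) = TA T \<phi> \<psi> \<cdot>\<^bsub>\<K>\<^esub> TA T \<sigma> \<tau>"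
    if p: "\<phi> \<in> Hom \<K> F' F''" and q: "\<psi> \<in> Hom \<K> G' G''"
    using * p q K.Hom_Obj(2)[OF p] K.Hom_Obj(2)[OF q] by simp
qed

text \<open>
  The coequalizer of \<open>\<psi>\<close> and zero is a colimit over a shape with four arrows, and exactness of
  \<open>P \<rightarrow> Q \<rightarrow> Q' \<rightarrow> 0\<close> says that \<open>Q'\<close> is this coequalizer.
\<close>

lemma cocontinuous_exact:
  assumes Phi: "is_functor \<K> \<K> \<Phi>" and coc: "cocontinuous C \<Phi>"
    and psi: "\<psi> \<in> Hom \<K> P Q" and pi: "\<pi> \<in> Hom \<K> Q Q'" and ex: "exact (Cfp C) \<psi> \<pi> P Q Q'"
    and zero: "FA \<Phi> (zero_trans (Cfp C) P Q) = zero_trans (Cfp C) (FO \<Phi> P) (FO \<Phi> Q)"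
  shows "exact (Cfp C) (FA \<Phi> \<psi>) (FA \<Phi> \<pi>) (FO \<Phi> P) (FO \<Phi> Q) (FO \<Phi> Q')"
proof -
  obtain o1 o2 f1 f2 :: 'u where "parallel_pair o1 o2 f1 f2" using parallel_pair_exists[OF universe] .
  then interpret parallel_pair o1 o2 f1 f2 .
  have pres: "preserves_colimits_of_shape shape \<K> \<K> \<Phi>"
    using coc small_category_shape[OF universe] unfolding cocontinuous_def FpMod_def by blast
  have co: "is_coequalizer \<K> \<psi> (zero_trans (Cfp C) P Q) Q Q' \<pi>"
    by (rule Cfp.exact_coequalizer[OF psi pi ex])
  have z: "zero_trans (Cfp C) P Q \<in> Hom \<K> P Q"
    by (rule Cfp.zero_trans_Hom[OF Cfp.Hom_FunD(1,2)[OF psi]])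
  have "is_coequalizer \<K> (FA \<Phi> \<psi>) (FA \<Phi> (zero_trans (Cfp C) P Q)) (FO \<Phi> Q) (FO \<Phi> Q') (FA \<Phi> \<pi>)"
    by (rule functor_coequalizer[OF Cfp.category_Fun Cfp.category_Fun Phi pres psi z co])
  then show ?thesis
    unfolding zero by (rule Cfp.coequalizer_exact[OF is_functor_Hom[OF Phi Cfp.category_Fun psi]])
qed

lemma T_exact_right:
  assumes F: "F \<in> Obj \<K>" and psi: "\<psi> \<in> Hom \<K> P Q" and pi: "\<pi> \<in> Hom \<K> Q Q'" and ex: "exact (Cfp C) \<psi> \<pi> P Q Q'"
  shows "exact (Cfp C) (TA T (Ident \<K> F) \<psi>) (TA T (Ident \<K> F) \<pi>) (TO T F P) (TO T F Q) (TO T F Q')"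
proof -
  interpret K: category \<K> by (rule Cfp.category_Fun)
  define \<Phi> where "\<Phi> = \<lparr>FO = (\<lambda>G. TO T F G), FA = (\<lambda>\<tau>. TA T (Ident \<K> F) \<tau>)\<rparr>"
  note i = K.Ident_in_Hom[OF F]
  have Phi: "is_functor \<K> \<K> \<Phi>"
    unfolding is_functor_def \<Phi>_def func.simps
  proof (intro conjI ballI T_Obj[OF F] T_arrows(1)[OF i] T_Ident[OF F])
    fix X Y Z f g assume f: "f \<in> Hom \<K> X Y" and g: "g \<in> Hom \<K> Y Z"
    show "TA T (Ident \<K> F) (g \<cdot>\<^bsub>\<K>\<^esub> f) = TA T (Ident \<K> F) g \<cdot>\<^bsub>\<K>\<^esub> TA T (Ident \<K> F) f"
      using T_arrows(4)[OF i f i g] K.Comp_Ident[OF i] by simp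
  qed
  have coc: "cocontinuous C \<Phi>" using day F unfolding day_convolution_def FpMod_def \<Phi>_def by blast
  note PQ = Cfp.Hom_FunD(1,2)[OF psi]
  note z = Cfp.zero_trans_Hom[OF PQ]
  have "TA T (Ident \<K> F) (zero_trans (Cfp C) P Q) = zero_trans (Cfp C) (TO T F P) (TO T F Q)"
    by (rule Cfp.app_idempotent_Add[OF T_arrows(1)[OF i z]])
      (use T_arrows(3)[OF i z z] Cfp.zero_trans_Add[OF PQ] in simp)
  with cocontinuous_exact[OF Phi coc psi pi ex] show ?thesis by (simp add: \<Phi>_def)
qed

lemma T_exact_left:
  assumes F: "F \<in> Obj \<K>" and psi: "\<psi> \<in> Hom \<K> P Q" and pi: "\<pi> \<in> Hom \<K> Q Q'" and ex: "exact (Cfp C) \<psi> \<pi> P Q Q'"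
  shows "exact (Cfp C) (TA T \<psi> (Ident \<K> F)) (TA T \<pi> (Ident \<K> F)) (TO T P F) (TO T Q F) (TO T Q' F)"
proof -
  interpret K: category \<K> by (rule Cfp.category_Fun)
  define \<Phi> where "\<Phi> = \<lparr>FO = (\<lambda>G. TO T G F), FA = (\<lambda>\<tau>. TA T \<tau> (Ident \<K> F))\<rparr>"
  note i = K.Ident_in_Hom[OF F]
  have Phi: "is_functor \<K> \<K> \<Phi>"
    unfolding is_functor_def \<Phi>_def func.simps
  proof (intro conjI ballI)
    show "TO T X F \<in> Obj \<K>" if "X \<in> Obj \<K>" for X using T_Obj[OF that F] .
    show "TA T f (Ident \<K> F) \<in> Hom \<K> (TO T X F) (TO T Y F)" if "f \<in> Hom \<K> X Y" for X Y f
      using T_arrows(1)[OF that i] .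
    show "TA T (Ident \<K> X) (Ident \<K> F) = Ident \<K> (TO T X F)" if "X \<in> Obj \<K>" for X using T_Ident[OF that F] .
    fix X Y Z f g assume f: "f \<in> Hom \<K> X Y" and g: "g \<in> Hom \<K> Y Z"
    show "TA T (g \<cdot>\<^bsub>\<K>\<^esub> f) (Ident \<K> F) = TA T g (Ident \<K> F) \<cdot>\<^bsub>\<K>\<^esub> TA T f (Ident \<K> F)"
      using T_arrows(4)[OF f i g i] K.Comp_Ident[OF i] by simp
  qed
  have coc: "cocontinuous C \<Phi>" using day F unfolding day_convolution_def FpMod_def \<Phi>_def by blast
  note PQ = Cfp.Hom_FunD(1,2)[OF psi]
  note z = Cfp.zero_trans_Hom[OF PQ]
  have "TA T (zero_trans (Cfp C) P Q) (Ident \<K> F) = zero_trans (Cfp C) (TO T P F) (TO T Q F)"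
    by (rule Cfp.app_idempotent_Add[OF T_arrows(1)[OF z i]])
      (use T_arrows(2)[OF z i z] Cfp.zero_trans_Add[OF PQ] in simp)
  with cocontinuous_exact[OF Phi coc psi pi ex] show ?thesis by (simp add: \<Phi>_def)
qed

section \<open>The tensor product of presented functors\<close>

lemma M_arrows:
  assumes f: "f \<in> Hom C X X'" and g: "g \<in> Hom C Y Y'"
  shows "TA M f g \<in> Hom C (TO M X Y) (TO M X' Y')"
proof -
  note o = Hom_Obj[OF f] Hom_Obj[OF g]
  show ?thesis using bifunctor f g o unfolding additive_bifunctor_def by simp
qed

lemma fp_tensor: "A \<in> fp C \<Longrightarrow> B \<in> fp C \<Longrightarrow> TO M A B \<in> fp C"
  using fp_closed by (simp add: full_monoidal_subcategory_def)

lemma rep_arrow_Ident: "A \<in> fp C \<Longrightarrow> rep_arrow (Cfp C) (Ident C A) = Ident \<K> (R A)"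
proof -
  assume A: "A \<in> fp C"
  then have AO: "A \<in> Obj (Cfp C)" by simp
  note i = Cfp.Ident_in_Hom[OF AO]
  have "rep_arrow (Cfp C) (Ident (Cfp C) A) = Ident \<K> (R A)"
  proof (rule Cfp.Fun_eqI[OF Cfp.rep_arrow_Hom[OF i] Cfp.Ident_Fun_closed[OF Cfp.rep_additive[OF AO]]])
    fix X x assume X: "X \<in> Obj (Cfp C)" and "x \<in> carrier (FO (R A) X)"
    then have x: "x \<in> Hom (Cfp C) A X" by simp
    show "app (rep_arrow (Cfp C) (Ident (Cfp C) A)) X x = app (Ident \<K> (R A)) X x"
      using app_rep_arrow[OF i X x] Cfp.Comp_Ident[OF x] Cfp.app_Ident[OF X, of x "R A"] x by simp
  qed
  then show ?thesis by simp
qed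

text \<open>
  Right exactness in both variables: \<open>G \<otimes> F\<close> is the quotient of \<open>(A',-) \<otimes> (A,-)\<close> by the images of
  \<open>(A',-) \<otimes> (B,-)\<close> and \<open>(B',-) \<otimes> (A,-)\<close>, and all three are representable.
\<close>

lemma tensor_cokernel:
  assumes pG: "presents C A' B' g \<pi>G G" and pF: "presents C A B f \<pi>F F"
  obtains \<pi> where "\<pi> \<in> Hom \<K> (R (TO M A' A)) (TO T G F)"
    "\<And>X. X \<in> fp C \<Longrightarrow> app \<pi> X ` Hom C (TO M A' A) X = carrier (FO (TO T G F) X)"
    "\<And>X a. X \<in> fp C \<Longrightarrow> a \<in> Hom C (TO M A' A) X \<Longrightarrow> app \<pi> X a = \<one>\<^bsub>FO (TO T G F) X\<^esub> \<longleftrightarrow>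
       (\<exists>k\<in>Hom C (TO M A' B) X. \<exists>l\<in>Hom C (TO M B' A) X.
          a = k \<cdot> TA M (Ident C A') f \<^bold>+ l \<cdot> TA M g (Ident C A))"
proof -
  note A' = presentsD(1)[OF pG] and B' = presentsD(2)[OF pG] and g = presentsD(3)[OF pG] and piG = presentsD(4)[OF pG]
  note A = presentsD(1)[OF pF] and B = presentsD(2)[OF pF] and f = presentsD(3)[OF pF] and piF = presentsD(4)[OF pF]
  interpret K: category \<K> by (rule Cfp.category_Fun)
  define \<gamma> where "\<gamma> = rep_arrow (Cfp C) g"
  define \<phi> where "\<phi> = rep_arrow (Cfp C) f"
  have ga: "\<gamma> \<in> Hom \<K> (R B') (R A')" unfolding \<gamma>_def by (rule Cfp.rep_arrow_Hom) (simp add: Hom_Cfp A' B' g)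
  have ph: "\<phi> \<in> Hom \<K> (R B) (R A)" unfolding \<phi>_def by (rule Cfp.rep_arrow_Hom) (simp add: Hom_Cfp A B f)
  have exG: "exact (Cfp C) \<gamma> \<pi>G (R B') (R A') G" and exF: "exact (Cfp C) \<phi> \<pi>F (R B) (R A) F"
    using presentsD(5)[OF pG] presentsD(5)[OF pF] by (simp_all add: \<gamma>_def \<phi>_def)
  note F = K.Hom_Obj(2)[OF piF] and G = K.Hom_Obj(2)[OF piG]
  note RA = K.Hom_Obj(1)[OF piF] and RA' = K.Hom_Obj(1)[OF piG] and RB = K.Hom_Obj(1)[OF ph] and RB' = K.Hom_Obj(1)[OF ga]
  note iF = K.Ident_in_Hom[OF F] and iA = K.Ident_in_Hom[OF RA] and iA' = K.Ident_in_Hom[OF RA'] and iB' = K.Ident_in_Hom[OF RB']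
  (* With A for (A,-) and so on, the commutative diagram is as follows; the row through
     A' * A and the column through A' * F are right exact, and rho' is surjective.

                        B' * A  --rho'-->  B' * F
                          | beta             | beta'
       A' * B --alpha-->  A' * A  --rho-->  A' * F
                                             | sigma
                                           G * F                     *)
  define \<alpha> where "\<alpha> = TA T (Ident \<K> (R A')) \<phi>"
  define \<beta> where "\<beta> = TA T \<gamma> (Ident \<K> (R A))"
  define \<rho> where "\<rho> = TA T (Ident \<K> (R A')) \<pi>F"
  define \<rho>' where "\<rho>' = TA T (Ident \<K> (R B')) \<pi>F"
  define \<beta>' where "\<beta>' = TA T \<gamma> (Ident \<K> F)"
  define \<sigma> where "\<sigma> = TA T \<pi>G (Ident \<K> F)"
  have al: "\<alpha> \<in> Hom \<K> (TO T (R A') (R B)) (TO T (R A') (R A))" unfolding \<alpha>_def by (rule T_arrows(1)[OF iA' ph])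
  have be: "\<beta> \<in> Hom \<K> (TO T (R B') (R A)) (TO T (R A') (R A))" unfolding \<beta>_def by (rule T_arrows(1)[OF ga iA])
  have rh: "\<rho> \<in> Hom \<K> (TO T (R A') (R A)) (TO T (R A') F)" unfolding \<rho>_def by (rule T_arrows(1)[OF iA' piF])
  have rh': "\<rho>' \<in> Hom \<K> (TO T (R B') (R A)) (TO T (R B') F)" unfolding \<rho>'_def by (rule T_arrows(1)[OF iB' piF])
  have be': "\<beta>' \<in> Hom \<K> (TO T (R B') F) (TO T (R A') F)" unfolding \<beta>'_def by (rule T_arrows(1)[OF ga iF])
  have si: "\<sigma> \<in> Hom \<K> (TO T (R A') F) (TO T G F)" unfolding \<sigma>_def by (rule T_arrows(1)[OF piG iF])
  have square: "\<rho> \<cdot>\<^bsub>\<K>\<^esub> \<beta> = \<beta>' \<cdot>\<^bsub>\<K>\<^esub> \<rho>'"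
    unfolding \<rho>_def \<beta>_def \<beta>'_def \<rho>'_def
    using T_arrows(4)[OF ga iA iA' piF] T_arrows(4)[OF iB' piF ga iF]
      K.Ident_Comp[OF ga] K.Comp_Ident[OF ga] K.Ident_Comp[OF piF] K.Comp_Ident[OF piF] by simp
  note ex1 = T_exact_right[OF RA' ph piF exF, folded \<alpha>_def \<rho>_def]
  note ex2 = T_exact_left[OF F ga piG exG, folded \<beta>'_def \<sigma>_def]
  note ex3 = T_exact_right[OF RB' ph piF exF, folded \<rho>'_def]
  obtain \<Phi> where iso: "\<And>A B. A \<in> fp C \<Longrightarrow> B \<in> fp C \<Longrightarrow> iso_arrow \<K> (TO T (R A) (R B)) (R (TO M A B)) (\<Phi> A B)"
    and nat: "\<And>A A' B B' f g. A \<in> fp C \<Longrightarrow> A' \<in> fp C \<Longrightarrow> B \<in> fp C \<Longrightarrow> B' \<in> fp C \<Longrightarrow> f \<in> Hom C A A' \<Longrightarrow> g \<in> Hom C B B' \<Longrightarrow>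
       \<Phi> A B \<cdot>\<^bsub>\<K>\<^esub> TA T (rep_arrow (Cfp C) f) (rep_arrow (Cfp C) g) = rep_arrow (Cfp C) (TA M f g) \<cdot>\<^bsub>\<K>\<^esub> \<Phi> A' B'"
    using day unfolding day_convolution_def FpMod_def by blast
  have Phi: "\<Phi> P Q \<in> Hom \<K> (TO T (R P) (R Q)) (R (TO M P Q))" if "P \<in> fp C" "Q \<in> fp C" for P Q
    using iso[OF that] by (simp add: iso_arrow_def)
  have onto: "\<exists>v\<in>carrier (FO (TO T (R P) (R Q)) X). app (\<Phi> P Q) X v = k"
    if P: "P \<in> fp C" and Q: "Q \<in> fp C" and X: "X \<in> fp C" and k: "k \<in> Hom C (TO M P Q) X" for P Q X k
  proof -
    obtain \<iota> where io: "\<iota> \<in> Hom \<K> (R (TO M P Q)) (TO T (R P) (R Q))" and inv: "\<Phi> P Q \<cdot>\<^bsub>\<K>\<^esub> \<iota> = Ident \<K> (R (TO M P Q))"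
      using iso[OF P Q] unfolding iso_arrow_def by blast
    have XO: "X \<in> Obj (Cfp C)" using X by simp
    have k': "k \<in> carrier (FO (R (TO M P Q)) X)" using k fp_tensor[OF P Q] X by (simp add: Hom_Cfp)
    have "app (\<Phi> P Q) X (app \<iota> X k) = k"
      using Cfp.app_Comp[OF io Phi[OF P Q] XO k'] inv Cfp.app_Ident[OF XO k'] by simp
    then show ?thesis using Cfp.app_closed[OF io XO k'] by blast
  qed
  obtain \<iota> where io: "\<iota> \<in> Hom \<K> (R (TO M A' A)) (TO T (R A') (R A))" and inv: "\<iota> \<cdot>\<^bsub>\<K>\<^esub> \<Phi> A' A = Ident \<K> (TO T (R A') (R A))"
    and inv': "\<Phi> A' A \<cdot>\<^bsub>\<K>\<^esub> \<iota> = Ident \<K> (R (TO M A' A))"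
    using iso[OF A' A] unfolding iso_arrow_def by blast
  have iA'C: "Ident C A' \<in> Hom C A' A'" and iAC: "Ident C A \<in> Hom C A A"
    using Ident_in_Hom[OF fp_Obj[OF A']] Ident_in_Hom[OF fp_Obj[OF A]] .
  have sf: "TA M (Ident C A') f \<in> Hom C (TO M A' A) (TO M A' B)" by (rule M_arrows[OF iA'C f])
  have sg: "TA M g (Ident C A) \<in> Hom C (TO M A' A) (TO M B' A)" by (rule M_arrows[OF g iAC])
  have nat\<alpha>: "app (\<Phi> A' A) X (app \<alpha> X v) = app (\<Phi> A' B) X v \<cdot> TA M (Ident C A') f"
    if X: "X \<in> fp C" and v: "v \<in> carrier (FO (TO T (R A') (R B)) X)" for X v
  proof -
    have XO: "X \<in> Obj (Cfp C)" using X by simp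
    have sf': "TA M (Ident C A') f \<in> Hom (Cfp C) (TO M A' A) (TO M A' B)" using sf fp_tensor A' A B by (simp add: Hom_Cfp)
    have w: "app (\<Phi> A' B) X v \<in> Hom (Cfp C) (TO M A' B) X"
      using Cfp.app_closed[OF Phi[OF A' B] XO v] by simp
    have "\<Phi> A' A \<cdot>\<^bsub>\<K>\<^esub> \<alpha> = rep_arrow (Cfp C) (TA M (Ident C A') f) \<cdot>\<^bsub>\<K>\<^esub> \<Phi> A' B"
      using nat[OF A' A' A B iA'C f] by (simp add: \<alpha>_def \<phi>_def rep_arrow_Ident[OF A'])
    then have "app (\<Phi> A' A) X (app \<alpha> X v) = app (rep_arrow (Cfp C) (TA M (Ident C A') f)) X (app (\<Phi> A' B) X v)"
      using Cfp.app_Comp[OF al Phi[OF A' A] XO v] Cfp.app_Comp[OF Phi[OF A' B] Cfp.rep_arrow_Hom[OF sf'] XO v] by simp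
    then show ?thesis using app_rep_arrow[OF sf' XO w] by simp
  qed
  have nat\<beta>: "app (\<Phi> A' A) X (app \<beta> X w) = app (\<Phi> B' A) X w \<cdot> TA M g (Ident C A)"
    if X: "X \<in> fp C" and w: "w \<in> carrier (FO (TO T (R B') (R A)) X)" for X w
  proof -
    have XO: "X \<in> Obj (Cfp C)" using X by simp
    have sg': "TA M g (Ident C A) \<in> Hom (Cfp C) (TO M A' A) (TO M B' A)" using sg fp_tensor A' A B' by (simp add: Hom_Cfp)
    have w': "app (\<Phi> B' A) X w \<in> Hom (Cfp C) (TO M B' A) X"
      using Cfp.app_closed[OF Phi[OF B' A] XO w] by simp
    have "\<Phi> A' A \<cdot>\<^bsub>\<K>\<^esub> \<beta> = rep_arrow (Cfp C) (TA M g (Ident C A)) \<cdot>\<^bsub>\<K>\<^esub> \<Phi> B' A"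
      using nat[OF A' B' A A g iAC] by (simp add: \<beta>_def \<gamma>_def rep_arrow_Ident[OF A])
    then have "app (\<Phi> A' A) X (app \<beta> X w) = app (rep_arrow (Cfp C) (TA M g (Ident C A))) X (app (\<Phi> B' A) X w)"
      using Cfp.app_Comp[OF be Phi[OF A' A] XO w] Cfp.app_Comp[OF Phi[OF B' A] Cfp.rep_arrow_Hom[OF sg'] XO w] by simp
    then show ?thesis using app_rep_arrow[OF sg' XO w'] by simp
  qed
  define \<pi> where "\<pi> = (\<sigma> \<cdot>\<^bsub>\<K>\<^esub> \<rho>) \<cdot>\<^bsub>\<K>\<^esub> \<iota>"
  have sr: "\<sigma> \<cdot>\<^bsub>\<K>\<^esub> \<rho> \<in> Hom \<K> (TO T (R A') (R A)) (TO T G F)" by (rule Cfp.Comp_Fun_closed[OF rh si])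
  have pi: "\<pi> \<in> Hom \<K> (R (TO M A' A)) (TO T G F)" unfolding \<pi>_def by (rule Cfp.Comp_Fun_closed[OF io sr])
  have pi_at: "app \<pi> X (app (\<Phi> A' A) X x) = app \<sigma> X (app \<rho> X x)"
    if X: "X \<in> fp C" and x: "x \<in> carrier (FO (TO T (R A') (R A)) X)" for X x
  proof -
    have XO: "X \<in> Obj (Cfp C)" using X by simp
    note cl = Cfp.app_closed[OF Phi[OF A' A] XO x]
    have "app \<iota> X (app (\<Phi> A' A) X x) = x"
      using Cfp.app_Comp[OF Phi[OF A' A] io XO x] inv Cfp.app_Ident[OF XO x] by simp
    then show ?thesis
      using Cfp.app_Comp[OF io sr XO cl] Cfp.app_Comp[OF rh si XO x] by (simp add: \<pi>_def)
  qed
  have Phi_cl: "app (\<Phi> A' A) X x \<in> Hom C (TO M A' A) X" if X: "X \<in> fp C" and x: "x \<in> carrier (FO (TO T (R A') (R A)) X)" for X x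
    using Cfp.app_closed[OF Phi[OF A' A] _ x] X fp_tensor[OF A' A] by (simp add: Hom_Cfp)
  show thesis
  proof (rule that[OF pi])
    fix X assume X: "X \<in> fp C"
    then have XO: "X \<in> Obj (Cfp C)" by simp
    show "app \<pi> X ` Hom C (TO M A' A) X = carrier (FO (TO T G F) X)"
    proof (intro equalityI subsetI)
      fix z assume "z \<in> app \<pi> X ` Hom C (TO M A' A) X"
      then show "z \<in> carrier (FO (TO T G F) X)"
        using Cfp.app_closed[OF pi XO] X fp_tensor[OF A' A] by (auto simp: Hom_Cfp)
    next
      fix z assume "z \<in> carrier (FO (TO T G F) X)"
      then have "z \<in> app \<sigma> X ` carrier (FO (TO T (R A') F) X)" using ex2 XO unfolding exact_def by metis
      then obtain y where y: "y \<in> carrier (FO (TO T (R A') F) X)" "z = app \<sigma> X y" by blast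
      have "y \<in> app \<rho> X ` carrier (FO (TO T (R A') (R A)) X)" using ex1 XO y(1) unfolding exact_def by metis
      then obtain x where x: "x \<in> carrier (FO (TO T (R A') (R A)) X)" "y = app \<rho> X x" by blast
      then have "z = app \<pi> X (app (\<Phi> A' A) X x)" using pi_at[OF X x(1)] y(2) by simp
      then show "z \<in> app \<pi> X ` Hom C (TO M A' A) X" using Phi_cl[OF X x(1)] by blast
    qed
  next
    fix X a assume X: "X \<in> fp C" and a: "a \<in> Hom C (TO M A' A) X"
    then have XO: "X \<in> Obj (Cfp C)" by simp
    let ?P = "FO (TO T (R A') (R A)) X" and ?PB = "FO (TO T (R A') (R B)) X" and ?PB' = "FO (TO T (R B') (R A)) X"
    let ?e = "\<one>\<^bsub>FO (TO T G F) X\<^esub>"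
    have P: "comm_group ?P" by (rule Cfp.functor_comm_group[OF Cfp.Hom_FunD(2)[OF al] XO])
    interpret P: comm_group "?P" by (rule P)
    have sum: "app (\<Phi> A' A) X (app \<alpha> X v \<otimes>\<^bsub>?P\<^esub> app \<beta> X w)
        = app (\<Phi> A' B) X v \<cdot> TA M (Ident C A') f \<^bold>+ app (\<Phi> B' A) X w \<cdot> TA M g (Ident C A)"
      if v: "v \<in> carrier ?PB" and w: "w \<in> carrier ?PB'" for v w
      using Cfp.app_mult[OF Phi[OF A' A] XO Cfp.app_closed[OF al XO v] Cfp.app_closed[OF be XO w]]
        nat\<alpha>[OF X v] nat\<beta>[OF X w] by simp
    show "app \<pi> X a = ?e \<longleftrightarrow>
       (\<exists>k\<in>Hom C (TO M A' B) X. \<exists>l\<in>Hom C (TO M B' A) X.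
          a = k \<cdot> TA M (Ident C A') f \<^bold>+ l \<cdot> TA M g (Ident C A))"
    proof
      assume dead: "app \<pi> X a = ?e"
      obtain x where x: "x \<in> carrier ?P" and xa: "app (\<Phi> A' A) X x = a"
        using onto[OF A' A X a] by blast
      have rx: "app \<rho> X x \<in> carrier (FO (TO T (R A') F) X)" by (rule Cfp.app_closed[OF rh XO x])
      have "app \<sigma> X (app \<rho> X x) = ?e" using pi_at[OF X x] xa dead by simp
      then have "app \<rho> X x \<in> app \<beta>' X ` carrier (FO (TO T (R B') F) X)"
        using ex2 XO rx unfolding exact_def by metis
      then obtain z where z: "z \<in> carrier (FO (TO T (R B') F) X)" "app \<rho> X x = app \<beta>' X z" by blast
      have "z \<in> app \<rho>' X ` carrier ?PB'" using ex3 XO z(1) unfolding exact_def by metis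
      then obtain w where w: "w \<in> carrier ?PB'" "z = app \<rho>' X w" by blast
      note bw = Cfp.app_closed[OF be XO w(1)]
      have "app \<rho> X x = app \<rho> X (app \<beta> X w)"
        using z(2) w(2) square Cfp.app_Comp[OF be rh XO w(1)] Cfp.app_Comp[OF rh' be' XO w(1)] by simp
      then have "app \<rho> X (x \<otimes>\<^bsub>?P\<^esub> inv\<^bsub>?P\<^esub> app \<beta> X w) = \<one>\<^bsub>FO (TO T (R A') F) X\<^esub>"
        using map_eq_iff[OF Cfp.Hom_FunD(3)[OF rh XO] x bw] by simp
      moreover have xw: "x \<otimes>\<^bsub>?P\<^esub> inv\<^bsub>?P\<^esub> app \<beta> X w \<in> carrier ?P"
        using x bw by simp
      ultimately have "x \<otimes>\<^bsub>?P\<^esub> inv\<^bsub>?P\<^esub> app \<beta> X w \<in> app \<alpha> X ` carrier ?PB"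
        using ex1 XO unfolding exact_def by metis
      then obtain v where v: "v \<in> carrier ?PB"
        "x \<otimes>\<^bsub>?P\<^esub> inv\<^bsub>?P\<^esub> app \<beta> X w = app \<alpha> X v" by blast
      have "x = app \<alpha> X v \<otimes>\<^bsub>?P\<^esub> app \<beta> X w"
        unfolding v(2)[symmetric] using x bw by (simp add: P.m_assoc)
      then have "a = app (\<Phi> A' B) X v \<cdot> TA M (Ident C A') f \<^bold>+ app (\<Phi> B' A) X w \<cdot> TA M g (Ident C A)"
        using sum[OF v(1) w(1)] xa by simp
      moreover have "app (\<Phi> A' B) X v \<in> Hom C (TO M A' B) X" "app (\<Phi> B' A) X w \<in> Hom C (TO M B' A) X"
        using Cfp.app_closed[OF Phi[OF A' B] XO v(1)] Cfp.app_closed[OF Phi[OF B' A] XO w(1)] X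
          fp_tensor[OF A' B] fp_tensor[OF B' A] by (simp_all add: Hom_Cfp)
      ultimately show "\<exists>k\<in>Hom C (TO M A' B) X. \<exists>l\<in>Hom C (TO M B' A) X.
          a = k \<cdot> TA M (Ident C A') f \<^bold>+ l \<cdot> TA M g (Ident C A)" by blast
    next
      assume "\<exists>k\<in>Hom C (TO M A' B) X. \<exists>l\<in>Hom C (TO M B' A) X.
          a = k \<cdot> TA M (Ident C A') f \<^bold>+ l \<cdot> TA M g (Ident C A)"
      then obtain k l where k: "k \<in> Hom C (TO M A' B) X" and l: "l \<in> Hom C (TO M B' A) X"
        and akl: "a = k \<cdot> TA M (Ident C A') f \<^bold>+ l \<cdot> TA M g (Ident C A)" by blast
      obtain v where v: "v \<in> carrier ?PB" "app (\<Phi> A' B) X v = k" using onto[OF A' B X k] by blast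
      obtain w where w: "w \<in> carrier ?PB'" "app (\<Phi> B' A) X w = l" using onto[OF B' A X l] by blast
      note av = Cfp.app_closed[OF al XO v(1)] and bw = Cfp.app_closed[OF be XO w(1)]
      have dv: "app \<sigma> X (app \<rho> X (app \<alpha> X v)) = ?e"
      proof -
        have "app \<rho> X (app \<alpha> X v) = \<one>\<^bsub>FO (TO T (R A') F) X\<^esub>" using ex1 XO av v(1) unfolding exact_def by blast
        then show ?thesis using Cfp.app_one[OF si XO] by simp
      qed
      have dw: "app \<sigma> X (app \<rho> X (app \<beta> X w)) = ?e"
      proof -
        note rw = Cfp.app_closed[OF rh' XO w(1)]
        have "app \<rho> X (app \<beta> X w) = app \<beta>' X (app \<rho>' X w)"
          using square Cfp.app_Comp[OF be rh XO w(1)] Cfp.app_Comp[OF rh' be' XO w(1)] by simp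
        then show ?thesis using ex2 XO Cfp.app_closed[OF be' XO rw] rw unfolding exact_def by auto
      qed
      have m: "app \<alpha> X v \<otimes>\<^bsub>?P\<^esub> app \<beta> X w \<in> carrier ?P" using av bw by simp
      have "a = app (\<Phi> A' A) X (app \<alpha> X v \<otimes>\<^bsub>?P\<^esub> app \<beta> X w)"
        using sum[OF v(1) w(1)] akl v(2) w(2) by simp
      then have "app \<pi> X a = app \<sigma> X (app \<rho> X (app \<alpha> X v \<otimes>\<^bsub>?P\<^esub> app \<beta> X w))"
        using pi_at[OF X m] by simp
      also have "\<dots> = app \<sigma> X (app \<rho> X (app \<alpha> X v)) \<otimes>\<^bsub>FO (TO T G F) X\<^esub> app \<sigma> X (app \<rho> X (app \<beta> X w))"
        using Cfp.app_mult[OF rh XO av bw]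
          Cfp.app_mult[OF si XO Cfp.app_closed[OF rh XO av] Cfp.app_closed[OF rh XO bw]] by simp
      also have "\<dots> = ?e"
      proof -
        interpret Q: comm_group "FO (TO T G F) X" by (rule Cfp.functor_comm_group[OF Cfp.Hom_FunD(2)[OF si] XO])
        show ?thesis unfolding dv dw by simp
      qed
      finally show "app \<pi> X a = ?e" .
    qed
  qed
qed

end


context small_preadditive_category
begin

lemma Add_Zero:
  assumes f: "f \<in> Hom C A B"
  shows "f \<^bold>+ Zero C A B = f" "Zero C A B \<^bold>+ f = f"
proof -
  interpret comm_group "hom_group C A B" by (rule hom_comm_group[OF Hom_Obj[OF f]])
  show "f \<^bold>+ Zero C A B = f" "Zero C A B \<^bold>+ f = f"
    using r_one[of f] l_one[of f] f by simp_all
qed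

lemma Add_idem_Zero:
  assumes f: "f \<in> Hom C A B" and eq: "f \<^bold>+ f = f"
  shows "f = Zero C A B"
proof -
  interpret comm_group "hom_group C A B" by (rule hom_comm_group[OF Hom_Obj[OF f]])
  show ?thesis using r_cancel_one'[of f f] f eq by simp
qed

text \<open>
  An arrow out of a biproduct is a pair of arrows, each of which factors through a stage; the two
  components of an arrow that vanishes in the limit die one after the other.
\<close>

lemma fp_biproduct:
  assumes U: "universe TYPE('u)" and A: "A \<in> fp C" and B: "B \<in> fp C"
    and i: "i \<in> Hom C A S" and j: "j \<in> Hom C B S" and p: "p \<in> Hom C S A" and q: "q \<in> Hom C S B"
    and sum: "i \<cdot> p \<^bold>+ j \<cdot> q = Ident C S"
  shows "S \<in> fp C"
proof (rule fpI)
  show S: "S \<in> Obj C" using Hom_Obj(2)[OF i] .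
  have ip: "i \<cdot> p \<in> Hom C S S" and jq: "j \<cdot> q \<in> Hom C S S" using Comp_in_Hom[OF p i] Comp_in_Hom[OF q j] .
  have split: "h = (h \<cdot> i) \<cdot> p \<^bold>+ (h \<cdot> j) \<cdot> q" if h: "h \<in> Hom C S L" for h L
    using Comp_Add[OF ip jq h] sum Comp_Ident[OF h] Comp_assoc[OF p i h] Comp_assoc[OF q j h] by simp
  {
    fix J :: "('u, 'u) category" and G L c h
    assume J: "directed J" and co: "is_colimit J C G L c" and h: "h \<in> Hom C S L"
    obtain k a b where k: "k \<in> Obj J" and a: "a \<in> Hom C A (FO G k)" and b: "b \<in> Hom C B (FO G k)"
      and ca: "c k \<cdot> a = h \<cdot> i" and cb: "c k \<cdot> b = h \<cdot> j"
      using fp_factor2[OF A B J co Comp_in_Hom[OF i h] Comp_in_Hom[OF j h]] .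
    note ck = colimit_component[OF co k]
    have "c k \<cdot> (a \<cdot> p \<^bold>+ b \<cdot> q) = h"
      using Comp_Add[OF Comp_in_Hom[OF p a] Comp_in_Hom[OF q b] ck] Comp_assoc[OF p a ck] Comp_assoc[OF q b ck]
        ca cb split[OF h] by simp
    then show "\<exists>k\<in>Obj J. \<exists>a\<in>Hom C S (FO G k). c k \<cdot> a = h"
      using k Hom_Add[OF Comp_in_Hom[OF p a] Comp_in_Hom[OF q b]] by blast
  next
    fix J :: "('u, 'u) category" and G L c k a
    assume J: "directed J" and co: "is_colimit J C G L c" and k: "k \<in> Obj J" and a: "a \<in> Hom C S (FO G k)"
      and dead: "c k \<cdot> a = Zero C S L"
    note ck = colimit_component[OF co k]
    note LO = Hom_Obj(2)[OF ck] and GO = Hom_Obj(1)[OF ck]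
    interpret J: category J using J by (rule directed_category)
    have vanish: "\<exists>l\<in>Obj J. \<exists>u\<in>Hom J k' l. FA G u \<cdot> b = Zero C P (FO G l)"
      if P: "P \<in> fp C" and k': "k' \<in> Obj J" and b: "b \<in> Hom C P (FO G k')" and "c k' \<cdot> b = Zero C P L" for P k' b
    proof -
      note PO = fp_Obj[OF P]
      note ck' = colimit_component[OF co k']
      note zH = Zero_Hom[OF PO Hom_Obj(1)[OF ck']]
      have "c k' \<cdot> b = c k' \<cdot> Zero C P (FO G k')" using that(4) Comp_Zero[OF PO ck'] by simp
      then obtain l u where l: "l \<in> Obj J" "u \<in> Hom J k' l" "FA G u \<cdot> b = FA G u \<cdot> Zero C P (FO G k')"
        using fp_merge[OF U P J co k' b zH] by blast
      then show ?thesis using Comp_Zero[OF PO diagram_Hom[OF J co l(2)]] by auto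
    qed
    have "c k \<cdot> (a \<cdot> i) = Zero C A L" using Comp_assoc[OF i a ck] dead Zero_Comp[OF LO i] by simp
    then obtain l u where l: "l \<in> Obj J" and u: "u \<in> Hom J k l" and ui: "FA G u \<cdot> (a \<cdot> i) = Zero C A (FO G l)"
      using vanish[OF A k Comp_in_Hom[OF i a]] by blast
    note Gu = diagram_Hom[OF J co u]
    define a1 where "a1 = FA G u \<cdot> a"
    have a1: "a1 \<in> Hom C S (FO G l)" "c l \<cdot> a1 = Zero C S L"
      using colimit_stage[OF co J u a] dead by (simp_all add: a1_def)
    have a1i: "a1 \<cdot> i = Zero C A (FO G l)" using ui Comp_assoc[OF i a Gu] by (simp add: a1_def)
    note cl = colimit_component[OF co l]
    have "c l \<cdot> (a1 \<cdot> j) = Zero C B L" using Comp_assoc[OF j a1(1) cl] a1(2) Zero_Comp[OF LO j] by simp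
    then obtain n w where n: "n \<in> Obj J" and w: "w \<in> Hom J l n" and wj: "FA G w \<cdot> (a1 \<cdot> j) = Zero C B (FO G n)"
      using vanish[OF B l Comp_in_Hom[OF j a1(1)]] by blast
    note Gw = diagram_Hom[OF J co w]
    note GnO = Hom_Obj(2)[OF Gw]
    define a2 where "a2 = FA G w \<cdot> a1"
    have a2: "a2 \<in> Hom C S (FO G n)" unfolding a2_def by (rule Comp_in_Hom[OF a1(1) Gw])
    have a2i: "a2 \<cdot> i = Zero C A (FO G n)"
      using Comp_assoc[OF i a1(1) Gw] a1i Comp_Zero[OF Hom_Obj(1)[OF i] Gw] by (simp add: a2_def)
    have a2j: "a2 \<cdot> j = Zero C B (FO G n)" using Comp_assoc[OF j a1(1) Gw] wj by (simp add: a2_def)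
    have "a2 = Zero C S (FO G n)"
      using split[OF a2] a2i a2j Zero_Comp[OF GnO p] Zero_Comp[OF GnO q] Add_Zero(1)[OF Zero_Hom[OF S GnO]] by simp
    moreover have "a2 = FA G (w \<cdot>\<^bsub>J\<^esub> u) \<cdot> a"
      using is_functor_Comp[OF cocone_functor[OF colimit_cocone[OF co]] J.category_axioms u w] Comp_assoc[OF a Gu Gw]
      by (simp add: a2_def a1_def)
    ultimately show "\<exists>l\<in>Obj J. \<exists>u\<in>Hom J k l. FA G u \<cdot> a = Zero C S (FO G l)"
      using n J.Comp_in_Hom[OF u w] by metis
  }
qed

end

context day_convolution_product
begin

text \<open>
  The sum of the images of \<open>(A' \<otimes> B,-)\<close> and \<open>(B' \<otimes> A,-)\<close> is the image of the single representable
  functor at the biproduct \<open>S\<close> of \<open>A' \<otimes> B\<close> and \<open>B' \<otimes> A\<close>.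
\<close>

lemma tensor_presented:
  assumes pG: "presents C A' B' g \<pi>G G" and pF: "presents C A B f \<pi>F F"
  obtains S s \<pi> where "presents C (TO M A' A) S s \<pi> (TO T G F)"
    "\<And>X. X \<in> Obj C \<Longrightarrow> extends_along C (TO M A' A) S s X \<longleftrightarrow>
       (\<forall>h\<in>Hom C (TO M A' A) X. \<exists>k\<in>Hom C (TO M A' B) X. \<exists>l\<in>Hom C (TO M B' A) X.
          h = k \<cdot> TA M (Ident C A') f \<^bold>+ l \<cdot> TA M g (Ident C A))"
proof -
  note A' = presentsD(1)[OF pG] and B' = presentsD(2)[OF pG] and g = presentsD(3)[OF pG]
  note A = presentsD(1)[OF pF] and B = presentsD(2)[OF pF] and f = presentsD(3)[OF pF]
  define P where "P = TO M A' B"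
  define Q where "Q = TO M B' A"
  define N where "N = TO M A' A"
  define \<alpha> where "\<alpha> = TA M (Ident C A') f"
  define \<beta> where "\<beta> = TA M g (Ident C A)"
  have P: "P \<in> fp C" and Q: "Q \<in> fp C" and N: "N \<in> fp C"
    unfolding P_def Q_def N_def by (intro fp_tensor A A' B B')+
  have al: "\<alpha> \<in> Hom C N P" unfolding \<alpha>_def N_def P_def by (intro M_arrows f Ident_in_Hom fp_Obj A')
  have be: "\<beta> \<in> Hom C N Q" unfolding \<beta>_def N_def Q_def by (intro M_arrows g Ident_in_Hom fp_Obj A)
  obtain S i j p q where i: "i \<in> Hom C P S" and j: "j \<in> Hom C Q S" and p: "p \<in> Hom C S P" and q: "q \<in> Hom C S Q"
    and eqs: "p \<cdot> i = Ident C P" "q \<cdot> j = Ident C Q" "p \<cdot> j = Zero C Q P" "q \<cdot> i = Zero C P Q"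
      "i \<cdot> p \<^bold>+ j \<cdot> q = Ident C S"
    using biproducts[OF fp_Obj[OF P] fp_Obj[OF Q]] by blast
  have S: "S \<in> fp C" by (rule fp_biproduct[OF universe P Q i j p q eqs(5)])
  define s where "s = i \<cdot> \<alpha> \<^bold>+ j \<cdot> \<beta>"
  note ia = Comp_in_Hom[OF al i] and jb = Comp_in_Hom[OF be j]
  have s: "s \<in> Hom C N S" unfolding s_def by (rule Hom_Add[OF ia jb])
  have factor_iff: "(\<exists>t\<in>Hom C S X. h = t \<cdot> s) \<longleftrightarrow> (\<exists>k\<in>Hom C P X. \<exists>l\<in>Hom C Q X. h = k \<cdot> \<alpha> \<^bold>+ l \<cdot> \<beta>)"
    if X: "X \<in> Obj C" for X h
  proof
    assume "\<exists>t\<in>Hom C S X. h = t \<cdot> s"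
    then obtain t where t: "t \<in> Hom C S X" "h = t \<cdot> s" by blast
    have "h = (t \<cdot> i) \<cdot> \<alpha> \<^bold>+ (t \<cdot> j) \<cdot> \<beta>"
      unfolding t(2) s_def using Comp_Add[OF ia jb t(1)] Comp_assoc[OF al i t(1)] Comp_assoc[OF be j t(1)] by simp
    then show "\<exists>k\<in>Hom C P X. \<exists>l\<in>Hom C Q X. h = k \<cdot> \<alpha> \<^bold>+ l \<cdot> \<beta>"
      using Comp_in_Hom[OF i t(1)] Comp_in_Hom[OF j t(1)] by blast
  next
    assume "\<exists>k\<in>Hom C P X. \<exists>l\<in>Hom C Q X. h = k \<cdot> \<alpha> \<^bold>+ l \<cdot> \<beta>"
    then obtain k l where k: "k \<in> Hom C P X" and l: "l \<in> Hom C Q X" and h: "h = k \<cdot> \<alpha> \<^bold>+ l \<cdot> \<beta>" by blast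
    define t where "t = k \<cdot> p \<^bold>+ l \<cdot> q"
    note kp = Comp_in_Hom[OF p k] and lq = Comp_in_Hom[OF q l]
    have t: "t \<in> Hom C S X" unfolding t_def by (rule Hom_Add[OF kp lq])
    have ti: "t \<cdot> i = k"
      unfolding t_def Add_Comp[OF i kp lq] Comp_assoc[OF i p k] Comp_assoc[OF i q l] eqs
      using Comp_Ident[OF k] Comp_Zero[OF Hom_Obj(1)[OF k] l] Add_Zero(1)[OF k] by simp
    have tj: "t \<cdot> j = l"
      unfolding t_def Add_Comp[OF j kp lq] Comp_assoc[OF j p k] Comp_assoc[OF j q l] eqs
      using Comp_Ident[OF l] Comp_Zero[OF Hom_Obj(1)[OF l] k] Add_Zero(2)[OF l] by simp
    have "t \<cdot> s = h"
      unfolding s_def h using Comp_Add[OF ia jb t] Comp_assoc[OF al i t] Comp_assoc[OF be j t] ti tj by simp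
    then show "\<exists>t\<in>Hom C S X. h = t \<cdot> s" using t by blast
  qed
  obtain \<pi> where pi: "\<pi> \<in> Hom \<K> (R N) (TO T G F)"
    and surj: "\<And>X. X \<in> fp C \<Longrightarrow> app \<pi> X ` Hom C N X = carrier (FO (TO T G F) X)"
    and ker: "\<And>X a. X \<in> fp C \<Longrightarrow> a \<in> Hom C N X \<Longrightarrow> app \<pi> X a = \<one>\<^bsub>FO (TO T G F) X\<^esub> \<longleftrightarrow>
       (\<exists>k\<in>Hom C P X. \<exists>l\<in>Hom C Q X. a = k \<cdot> \<alpha> \<^bold>+ l \<cdot> \<beta>)"
    using tensor_cokernel[OF pG pF] unfolding N_def P_def Q_def \<alpha>_def \<beta>_def by blast
  have "exact (Cfp C) (rep_arrow (Cfp C) s) \<pi> (R S) (R N) (TO T G F)"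
    unfolding exact_rep_Cfp_iff[OF N S s] using surj ker factor_iff[OF fp_Obj] by simp
  then have "presents C N S s \<pi> (TO T G F)" unfolding presents_def FpMod_def using N S s pi by blast
  moreover have "extends_along C N S s X \<longleftrightarrow>
     (\<forall>h\<in>Hom C N X. \<exists>k\<in>Hom C P X. \<exists>l\<in>Hom C Q X. h = k \<cdot> \<alpha> \<^bold>+ l \<cdot> \<beta>)" if "X \<in> Obj C" for X
    unfolding extends_along_def using factor_iff[OF that] by (metis (no_types, lifting))
  ultimately show thesis by (intro that) (simp_all add: N_def P_def Q_def \<alpha>_def \<beta>_def)
qed

end

section \<open>Tensor-ideals and fp-hom-closed subcategories\<close>

text \<open>The adjunction between \<open>- \<otimes> Y\<close> and \<open>hom(Y,-)\<close> is natural in the first variable.\<close>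

lemma extends_along_curry:
  assumes csm: "closed_symmetric_monoidal C M" and f: "f \<in> Hom C A B" and Y: "Y \<in> Obj C" and X: "X \<in> Obj C"
  shows "extends_along C A B f (ihom M Y X) \<longleftrightarrow>
    extends_along C (TO M A Y) (TO M B Y) (TA M f (Ident C Y)) X"
proof -
  interpret symmetric_monoidal C M "TO M" "TA M" using csm by (simp_all add: closed_symmetric_monoidal_def)
  note o = Hom_Obj[OF f]
  have ev: "ev M Y X \<in> Hom C (TO M (ihom M Y X) Y) X"
    and adj: "\<And>W f. W \<in> Obj C \<Longrightarrow> f \<in> Hom C (TO M W Y) X \<Longrightarrow>
        \<exists>!g. g \<in> Hom C W (ihom M Y X) \<and> ev M Y X \<cdot>\<^bsub>C\<^esub> TA M g (Ident C Y) = f"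
    using csm X Y unfolding closed_symmetric_monoidal_def by auto
  note iY = Ident_in_Hom[OF Y]
  have tens: "TA M g (Ident C Y) \<in> Hom C (TO M W Y) (TO M W' Y)" if g: "g \<in> Hom C W W'" for g W W'
    using tensor_bifunctor g iY Hom_Obj[OF g] Y unfolding additive_bifunctor_def by simp
  have uncurry: "ev M Y X \<cdot>\<^bsub>C\<^esub> TA M g (Ident C Y) \<in> Hom C (TO M W Y) X" if "g \<in> Hom C W (ihom M Y X)" for g W
    by (rule Comp_in_Hom[OF tens[OF that] ev])
  have nat: "ev M Y X \<cdot>\<^bsub>C\<^esub> TA M (k \<cdot>\<^bsub>C\<^esub> f) (Ident C Y) = (ev M Y X \<cdot>\<^bsub>C\<^esub> TA M k (Ident C Y)) \<cdot>\<^bsub>C\<^esub> TA M f (Ident C Y)"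
    if k: "k \<in> Hom C B (ihom M Y X)" for k
  proof -
    have "TA M (k \<cdot>\<^bsub>C\<^esub> f) (Ident C Y \<cdot>\<^bsub>C\<^esub> Ident C Y) = TA M k (Ident C Y) \<cdot>\<^bsub>C\<^esub> TA M f (Ident C Y)"
      using tensor_bifunctor f k iY o Hom_Obj[OF k] Y unfolding additive_bifunctor_def by simp
    then show ?thesis using Comp_Ident[OF iY] Comp_assoc[OF tens[OF f] tens[OF k] ev] by simp
  qed
  show ?thesis
    unfolding extends_along_def
  proof (intro iffI ballI)
    fix h assume L: "\<forall>h\<in>Hom C A (ihom M Y X). \<exists>k\<in>Hom C B (ihom M Y X). k \<cdot>\<^bsub>C\<^esub> f = h" and h: "h \<in> Hom C (TO M A Y) X"
    obtain h' where h': "h' \<in> Hom C A (ihom M Y X)" "ev M Y X \<cdot>\<^bsub>C\<^esub> TA M h' (Ident C Y) = h" using adj[OF o(1) h] by blast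
    obtain k where k: "k \<in> Hom C B (ihom M Y X)" "k \<cdot>\<^bsub>C\<^esub> f = h'" using L h'(1) by blast
    show "\<exists>k\<in>Hom C (TO M B Y) X. k \<cdot>\<^bsub>C\<^esub> TA M f (Ident C Y) = h"
      using nat[OF k(1)] k(2) h'(2) uncurry[OF k(1)] by auto
  next
    fix h assume R: "\<forall>h\<in>Hom C (TO M A Y) X. \<exists>k\<in>Hom C (TO M B Y) X. k \<cdot>\<^bsub>C\<^esub> TA M f (Ident C Y) = h"
      and h: "h \<in> Hom C A (ihom M Y X)"
    obtain k where k: "k \<in> Hom C (TO M B Y) X" "k \<cdot>\<^bsub>C\<^esub> TA M f (Ident C Y) = ev M Y X \<cdot>\<^bsub>C\<^esub> TA M h (Ident C Y)"
      using R uncurry[OF h] by blast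
    obtain k' where k': "k' \<in> Hom C B (ihom M Y X)" "ev M Y X \<cdot>\<^bsub>C\<^esub> TA M k' (Ident C Y) = k" using adj[OF o(2) k(1)] by blast
    have "ev M Y X \<cdot>\<^bsub>C\<^esub> TA M (k' \<cdot>\<^bsub>C\<^esub> f) (Ident C Y) = ev M Y X \<cdot>\<^bsub>C\<^esub> TA M h (Ident C Y)"
      using nat[OF k'(1)] k'(2) k(2) by simp
    then have "k' \<cdot>\<^bsub>C\<^esub> f = h" using adj[OF o(1) uncurry[OF h]] Comp_in_Hom[OF f k'(1)] h by blast
    then show "\<exists>k\<in>Hom C B (ihom M Y X). k \<cdot>\<^bsub>C\<^esub> f = h" using k'(1) by blast
  qed
qed

lemma extends_along_iso:
  assumes C: "category C" and f: "f \<in> Hom C A B" and f': "f' \<in> Hom C A' B'"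
    and a: "iso_arrow C A A' a" and b: "iso_arrow C B B' b" and sq: "b \<cdot>\<^bsub>C\<^esub> f = f' \<cdot>\<^bsub>C\<^esub> a"
    and ext: "extends_along C A B f X"
  shows "extends_along C A' B' f' X"
  unfolding extends_along_def
proof
  interpret category C by fact
  obtain a' where a: "a \<in> Hom C A A'" and a': "a' \<in> Hom C A' A" and aa': "a \<cdot>\<^bsub>C\<^esub> a' = Ident C A'" 
    using a unfolding iso_arrow_def by blast
  obtain b' where b: "b \<in> Hom C B B'" and b': "b' \<in> Hom C B' B" and bb': "b' \<cdot>\<^bsub>C\<^esub> b = Ident C B"
    using b unfolding iso_arrow_def by blast
  fix h assume h: "h \<in> Hom C A' X"
  obtain k where k: "k \<in> Hom C B X" "k \<cdot>\<^bsub>C\<^esub> f = h \<cdot>\<^bsub>C\<^esub> a" using ext Comp_in_Hom[OF a h] unfolding extends_along_def by blast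
  have "f' = (b \<cdot>\<^bsub>C\<^esub> f) \<cdot>\<^bsub>C\<^esub> a'" unfolding sq Comp_assoc[OF a' a f'] aa' using Comp_Ident[OF f'] by simp
  then have "b' \<cdot>\<^bsub>C\<^esub> f' = f \<cdot>\<^bsub>C\<^esub> a'"
    using Comp_assoc[OF a' Comp_in_Hom[OF f b] b'] Comp_assoc[OF f b b'] bb' Ident_Comp[OF f] by simp
  then have "(k \<cdot>\<^bsub>C\<^esub> b') \<cdot>\<^bsub>C\<^esub> f' = (k \<cdot>\<^bsub>C\<^esub> f) \<cdot>\<^bsub>C\<^esub> a'"
    using Comp_assoc[OF f' b' k(1)] Comp_assoc[OF a' f k(1)] by simp
  also have "\<dots> = h" unfolding k(2) Comp_assoc[OF a' a h] aa' by (rule Comp_Ident[OF h])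
  finally show "\<exists>k\<in>Hom C B' X. k \<cdot>\<^bsub>C\<^esub> f' = h" using Comp_in_Hom[OF b' k(1)] by blast
qed

lemma extends_along_ihom_iff:
  assumes csm: "closed_symmetric_monoidal C M" and f: "f \<in> Hom C A B" and Y: "Y \<in> Obj C" and X: "X \<in> Obj C"
  shows "extends_along C A B f (ihom M Y X) \<longleftrightarrow>
    extends_along C (TO M Y A) (TO M Y B) (TA M (Ident C Y) f) X"
proof -
  interpret symmetric_monoidal C M "TO M" "TA M" using csm by (simp_all add: closed_symmetric_monoidal_def)
  note o = Hom_Obj[OF f]
  note iY = Ident_in_Hom[OF Y]
  have l: "TA M f (Ident C Y) \<in> Hom C (TO M A Y) (TO M B Y)" and r: "TA M (Ident C Y) f \<in> Hom C (TO M Y A) (TO M Y B)"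
    using tensor_bifunctor f iY o Y unfolding additive_bifunctor_def by simp_all
  have br: "iso_arrow C (TO M P Q) (TO M Q P) (braid M P Q)" if "P \<in> Obj C" "Q \<in> Obj C" for P Q
    using braid_iso[OF that] .
  note cat = category_axioms
  have sq: "braid M B Y \<cdot>\<^bsub>C\<^esub> TA M f (Ident C Y) = TA M (Ident C Y) f \<cdot>\<^bsub>C\<^esub> braid M A Y"
    "braid M Y B \<cdot>\<^bsub>C\<^esub> TA M (Ident C Y) f = TA M f (Ident C Y) \<cdot>\<^bsub>C\<^esub> braid M Y A"
    using braid_natural[OF f iY] braid_natural[OF iY f] by simp_all
  show ?thesis
    unfolding extends_along_curry[OF csm f Y X]
    using extends_along_iso[OF cat l r br[OF o(1) Y] br[OF o(2) Y] sq(1)]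
      extends_along_iso[OF cat r l br[OF Y o(1)] br[OF Y o(2)] sq(2)] by blast
qed

theorem theorem3p8:
  fixes C :: "('o, 'u) ab_category"
    and M :: "('o, 'u) closed_monoidal"
    and T :: "(('o, 'u) ab_func, ('o, 'u) ab_transf) bifunctor"
    and D :: "'o set"
  assumes "universe TYPE('u)"
    and "additive_category C"
    and "finitely_accessible C"
    and "has_products C"
    and "closed_symmetric_monoidal C M"
    and "full_monoidal_subcategory C M (fp C)"
    and "day_convolution C M T"
    and "definable C D"
  shows "tensor_ideal C T (serre_of C D) \<longleftrightarrow> fp_hom_closed C M D"
proof -
  note csm = \<open>closed_symmetric_monoidal C M\<close>
  interpret additive_category C by fact
  interpret finitely_accessible_category C by unfold_locales fact+
  interpret sm: symmetric_monoidal C M "TO M" "TA M" using csm by (simp_all add: closed_symmetric_monoidal_def)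
  interpret day_convolution_product C M T
    by unfold_locales (use \<open>day_convolution C M T\<close> \<open>full_monoidal_subcategory C M (fp C)\<close> sm.tensor_bifunctor in auto)
  have DO: "D \<subseteq> Obj C" using \<open>definable C D\<close> by (simp add: definable_def)
  have ihom_Obj: "ihom M Y X \<in> Obj C" if "Y \<in> Obj C" "X \<in> Obj C" for X Y
    using csm that by (simp add: closed_symmetric_monoidal_def)
  show ?thesis
  proof
    assume closed: "fp_hom_closed C M D"
    show "tensor_ideal C T (serre_of C D)"
      unfolding tensor_ideal_def
    proof (intro ballI)
      fix F G assume F: "F \<in> serre_of C D" and "G \<in> fp_mod C"
      then have "F \<in> fp_mod C" "G \<in> fp_mod C" by (simp_all add: serre_of_def)
      then obtain A B f \<pi>F A' B' g \<pi>G where pF: "presents C A B f \<pi>F F" and pG: "presents C A' B' g \<pi>G G"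
        unfolding fp_mod_iff by blast
      note A' = presentsD(1)[OF pG] and B' = presentsD(2)[OF pG] and g = presentsD(3)[OF pG]
      note A = presentsD(1)[OF pF] and f = presentsD(3)[OF pF]
      obtain S s \<pi> where pT: "presents C (TO M A' A) S s \<pi> (TO T G F)"
        and ext: "\<And>X. X \<in> Obj C \<Longrightarrow> extends_along C (TO M A' A) S s X \<longleftrightarrow>
       (\<forall>h\<in>Hom C (TO M A' A) X. \<exists>k\<in>Hom C (TO M A' B) X. \<exists>l\<in>Hom C (TO M B' A) X.
          h = k \<cdot>\<^bsub>C\<^esub> TA M (Ident C A') f \<^bold>+\<^bsub>C\<^esub> l \<cdot>\<^bsub>C\<^esub> TA M g (Ident C A))"
        using tensor_presented[OF pG pF] by metis
      have "extends_along C (TO M A' A) S s X" if X: "X \<in> D" for X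
      proof -
        have XO: "X \<in> Obj C" using X DO by blast
        have "ihom M A' X \<in> D" using closed A' X by (simp add: fp_hom_closed_def)
        then have "extends_along C A B f (ihom M A' X)" using F serre_of_iff[OF pF DO] by blast
        then have e: "extends_along C (TO M A' A) (TO M A' B) (TA M (Ident C A') f) X"
          using extends_along_ihom_iff[OF csm f fp_Obj[OF A'] XO] by simp
        have b: "TA M g (Ident C A) \<in> Hom C (TO M A' A) (TO M B' A)"
          by (intro M_arrows g Ident_in_Hom fp_Obj A)
        note z = Zero_Hom[OF fp_Obj[OF fp_tensor[OF B' A]] XO]
        show ?thesis
          unfolding ext[OF XO]
        proof
          fix h assume h: "h \<in> Hom C (TO M A' A) X"
          then obtain k where k: "k \<in> Hom C (TO M A' B) X" "k \<cdot>\<^bsub>C\<^esub> TA M (Ident C A') f = h"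
            using e unfolding extends_along_def by blast
          have "h = k \<cdot>\<^bsub>C\<^esub> TA M (Ident C A') f \<^bold>+\<^bsub>C\<^esub> Zero C (TO M B' A) X \<cdot>\<^bsub>C\<^esub> TA M g (Ident C A)"
            using k(2) Zero_Comp[OF XO b] Add_Zero(1)[OF h] by simp
          then show "\<exists>k\<in>Hom C (TO M A' B) X. \<exists>l\<in>Hom C (TO M B' A) X.
              h = k \<cdot>\<^bsub>C\<^esub> TA M (Ident C A') f \<^bold>+\<^bsub>C\<^esub> l \<cdot>\<^bsub>C\<^esub> TA M g (Ident C A)" using k(1) z by blast
        qed
      qed
      then show "TO T G F \<in> serre_of C D" using serre_of_iff[OF pT DO] by blast
    qed
  next
    assume ideal: "tensor_ideal C T (serre_of C D)"
    show "fp_hom_closed C M D"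
      unfolding fp_hom_closed_def
    proof (intro ballI)
      fix A' X assume A': "A' \<in> fp C" and X: "X \<in> D"
      have XO: "X \<in> Obj C" using X DO by blast
      note A'O = fp_Obj[OF A']
      define z where "z = Zero C A' A'"
      have z: "z \<in> Hom C A' A'" unfolding z_def by (rule Zero_Hom[OF A'O A'O])
      \<comment> \<open>The functor presented by the zero arrow on \<open>A'\<close> is \<open>(A',-)\<close>, up to isomorphism.\<close>
      have "\<exists>G \<pi>. presents C A' A' z \<pi> G" by (rule presented_functor_exists[OF A' A' z]) blast
      then obtain G \<pi>G where pG: "presents C A' A' z \<pi>G G" by blast
      have G: "G \<in> fp_mod C" using pG fp_mod_iff by blast
      show "ihom M A' X \<in> D"
      proof (rule definable_contains[OF \<open>has_products C\<close> \<open>definable C D\<close> ihom_Obj[OF A'O XO]])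
        fix A B f assume A: "A \<in> fp C" and B: "B \<in> fp C" and f: "f \<in> Hom C A B" and all: "\<forall>X\<in>D. extends_along C A B f X"
        obtain F \<pi>F where pF: "presents C A B f \<pi>F F" using presented_functor_exists[OF A B f] .
        have "F \<in> serre_of C D" using serre_of_iff[OF pF DO] all by blast
        then have TS: "TO T G F \<in> serre_of C D" using ideal G by (simp add: tensor_ideal_def)
        obtain S s \<pi> where pT: "presents C (TO M A' A) S s \<pi> (TO T G F)"
          and ext: "\<And>X. X \<in> Obj C \<Longrightarrow> extends_along C (TO M A' A) S s X \<longleftrightarrow>
         (\<forall>h\<in>Hom C (TO M A' A) X. \<exists>k\<in>Hom C (TO M A' B) X. \<exists>l\<in>Hom C (TO M A' A) X.
            h = k \<cdot>\<^bsub>C\<^esub> TA M (Ident C A') f \<^bold>+\<^bsub>C\<^esub> l \<cdot>\<^bsub>C\<^esub> TA M z (Ident C A))"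
          using tensor_presented[OF pG pF] by metis
        note iA = Ident_in_Hom[OF fp_Obj[OF A]]
        have zA: "TA M z (Ident C A) \<in> Hom C (TO M A' A) (TO M A' A)" by (rule M_arrows[OF z iA])
        have "TA M (z \<^bold>+\<^bsub>C\<^esub> z) (Ident C A) = TA M z (Ident C A) \<^bold>+\<^bsub>C\<^esub> TA M z (Ident C A)"
          using sm.tensor_bifunctor A'O fp_Obj[OF A] z iA unfolding additive_bifunctor_def by simp
        then have z0: "TA M z (Ident C A) = Zero C (TO M A' A) (TO M A' A)"
          using Add_idem_Zero[OF zA] Add_Zero(1)[OF z] by (simp add: z_def)
        have "extends_along C (TO M A' A) S s X" using TS serre_of_iff[OF pT DO] X by blast
        then have "extends_along C (TO M A' A) (TO M A' B) (TA M (Ident C A') f) X"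
          unfolding ext[OF XO]
          unfolding extends_along_def
        proof (intro ballI)
          fix h assume L: "\<forall>h\<in>Hom C (TO M A' A) X. \<exists>k\<in>Hom C (TO M A' B) X. \<exists>l\<in>Hom C (TO M A' A) X.
            h = k \<cdot>\<^bsub>C\<^esub> TA M (Ident C A') f \<^bold>+\<^bsub>C\<^esub> l \<cdot>\<^bsub>C\<^esub> TA M z (Ident C A)" and h: "h \<in> Hom C (TO M A' A) X"
          obtain k l where k: "k \<in> Hom C (TO M A' B) X" and l: "l \<in> Hom C (TO M A' A) X"
            and hkl: "h = k \<cdot>\<^bsub>C\<^esub> TA M (Ident C A') f \<^bold>+\<^bsub>C\<^esub> l \<cdot>\<^bsub>C\<^esub> TA M z (Ident C A)" using L h by blast
          have kf: "k \<cdot>\<^bsub>C\<^esub> TA M (Ident C A') f \<in> Hom C (TO M A' A) X"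
            by (rule Comp_in_Hom[OF M_arrows[OF Ident_in_Hom[OF A'O] f] k])
          have "l \<cdot>\<^bsub>C\<^esub> TA M z (Ident C A) = Zero C (TO M A' A) X"
            unfolding z0 by (rule Comp_Zero[OF Hom_Obj(1)[OF h] l])
          then have "k \<cdot>\<^bsub>C\<^esub> TA M (Ident C A') f = h" using hkl Add_Zero(1)[OF kf] by simp
          then show "\<exists>k\<in>Hom C (TO M A' B) X. k \<cdot>\<^bsub>C\<^esub> TA M (Ident C A') f = h" using k by blast
        qed
        then show "extends_along C A B f (ihom M A' X)"
          using extends_along_ihom_iff[OF csm f A'O XO] by simp
      qed
    qed
  qed
qed

end
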